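(* Let $f:A\to X$ and $g:B\to X$ be maps into $X$, and let $x:X$. Then there is an equivalence $$\mathrm{fib}_{f\ast g}(x)\simeq \mathrm{fib}_f(x)\ast\mathrm{fib}_g(x).$$
   Context: Setting: Martin-Löf type theory with function extensionality and a univalent universe $\mathcal{U}$ closed under the usual type formers and homotopy pushouts; types are in $\mathcal{U}$. For $f:A\to X$ and $g:B\to X$, $A\ast_X B$ is the pushout of $A\xleftarrow{\pi_1}A\times_X B\xrightarrow{\pi_2}B$, where $A\times_X B=\sum_{a:A}\sum_{b:B}f(a)=g(b)$. The join of maps $f\ast g:A\ast_X B\to X$ is the map induced by the universal property of the pushout from $f$, $g$ and the canonical homotopy $f\circ\pi_1\sim g\circ\pi_2$. For types $P,Q$, the join $P\ast Q$ is the pushout of $P\leftarrow P\times Q\to Q$ (the projections). $\mathrm{fib}_h(x):=\sum_{a}h(a)=x$ is the homotopy fiber. *)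

theory Defs
  imports Main
begin

text \<open>
  Isabelle/HOL has no library of homotopy type theory, and its own function types validate neither
  univalence nor proof relevance.  The type theory is therefore an object
  language here: raw terms, and an inductive definition of the derivable judgements.  The rules
  follow Appendix A.2 of the HoTT book (intensional identity types, judgemental beta rules for
  all eliminators, judgemental eta only for dependent functions), restricted to a single
  univalent universe.
\<close>

section \<open>Raw terms\<close>

text \<open>
  De Bruijn indices.  Bound variables per argument: the second argument of \<open>Pi\<close>, \<open>Lam\<close> and \<open>Sig\<close>
  binds one variable.  Every motive \<open>C\<close> binds the eliminated element, except that the motive of \<open>J\<close>
  binds the end point (index 1) and the path (index 0).  In the branches, \<open>IndSig\<close> binds the two
  components (index 1 the first, index 0 the second), \<open>IndPlus\<close> binds one variable in each branch,
  the successor branch of \<open>IndNat\<close> binds the predecessor (index 1) and the inductive hypothesis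
  (index 0), and the three branches of \<open>IndPush\<close> and \<open>GlueComp\<close> bind an element of, respectively,
  the left type, the right type, and the apex of the span.
\<close>

datatype tm =
    Var nat
  | Univ
  | Pi tm tm | Lam tm tm | App tm tm
  | Sig tm tm | MkPair tm tm | IndSig tm tm tm
  | Path tm tm tm | Refl tm | J tm tm tm tm tm
  | Empty | IndEmpty tm tm
  | Unit | Star | IndUnit tm tm tm
  | Plus tm tm | InL tm | InR tm | IndPlus tm tm tm tm
  | Nats | Zero | Succ tm | IndNat tm tm tm tm
  | Pushout tm tm tm tm tm
  | PInl tm | PInr tm | Glue tm | IndPush tm tm tm tm tm | GlueComp tm tm tm tm tm
  | Funext tm tm
  | Univalence tm tm

type_synonym ctx = "tm list"  \<comment> \<open>innermost variable first\<close>

definition upr :: "(nat \<Rightarrow> nat) \<Rightarrow> nat \<Rightarrow> nat" where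
  "upr \<rho> = case_nat 0 (\<lambda>i. Suc (\<rho> i))"

primrec ren :: "(nat \<Rightarrow> nat) \<Rightarrow> tm \<Rightarrow> tm" where
  "ren \<rho> (Var i) = Var (\<rho> i)"
| "ren \<rho> Univ = Univ"
| "ren \<rho> (Pi A B) = Pi (ren \<rho> A) (ren (upr \<rho>) B)"
| "ren \<rho> (Lam A b) = Lam (ren \<rho> A) (ren (upr \<rho>) b)"
| "ren \<rho> (App f a) = App (ren \<rho> f) (ren \<rho> a)"
| "ren \<rho> (Sig A B) = Sig (ren \<rho> A) (ren (upr \<rho>) B)"
| "ren \<rho> (MkPair a b) = MkPair (ren \<rho> a) (ren \<rho> b)"
| "ren \<rho> (IndSig C d p) = IndSig (ren (upr \<rho>) C) (ren (upr (upr \<rho>)) d) (ren \<rho> p)"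
| "ren \<rho> (Path A a b) = Path (ren \<rho> A) (ren \<rho> a) (ren \<rho> b)"
| "ren \<rho> (Refl a) = Refl (ren \<rho> a)"
| "ren \<rho> (J C d a b p) = J (ren (upr (upr \<rho>)) C) (ren \<rho> d) (ren \<rho> a) (ren \<rho> b) (ren \<rho> p)"
| "ren \<rho> Empty = Empty"
| "ren \<rho> (IndEmpty C e) = IndEmpty (ren (upr \<rho>) C) (ren \<rho> e)"
| "ren \<rho> Unit = Unit"
| "ren \<rho> Star = Star"
| "ren \<rho> (IndUnit C c e) = IndUnit (ren (upr \<rho>) C) (ren \<rho> c) (ren \<rho> e)"
| "ren \<rho> (Plus A B) = Plus (ren \<rho> A) (ren \<rho> B)"
| "ren \<rho> (InL a) = InL (ren \<rho> a)"
| "ren \<rho> (InR b) = InR (ren \<rho> b)"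
| "ren \<rho> (IndPlus C l r e) =
     IndPlus (ren (upr \<rho>) C) (ren (upr \<rho>) l) (ren (upr \<rho>) r) (ren \<rho> e)"
| "ren \<rho> Nats = Nats"
| "ren \<rho> Zero = Zero"
| "ren \<rho> (Succ n) = Succ (ren \<rho> n)"
| "ren \<rho> (IndNat C z s n) =
     IndNat (ren (upr \<rho>) C) (ren \<rho> z) (ren (upr (upr \<rho>)) s) (ren \<rho> n)"
| "ren \<rho> (Pushout S A B u v) =
     Pushout (ren \<rho> S) (ren \<rho> A) (ren \<rho> B) (ren \<rho> u) (ren \<rho> v)"
| "ren \<rho> (PInl a) = PInl (ren \<rho> a)"
| "ren \<rho> (PInr b) = PInr (ren \<rho> b)"
| "ren \<rho> (Glue c) = Glue (ren \<rho> c)"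
| "ren \<rho> (IndPush C l r s e) =
     IndPush (ren (upr \<rho>) C) (ren (upr \<rho>) l) (ren (upr \<rho>) r) (ren (upr \<rho>) s) (ren \<rho> e)"
| "ren \<rho> (GlueComp C l r s c) =
     GlueComp (ren (upr \<rho>) C) (ren (upr \<rho>) l) (ren (upr \<rho>) r) (ren (upr \<rho>) s) (ren \<rho> c)"
| "ren \<rho> (Funext f g) = Funext (ren \<rho> f) (ren \<rho> g)"
| "ren \<rho> (Univalence A B) = Univalence (ren \<rho> A) (ren \<rho> B)"

definition wk :: "nat \<Rightarrow> tm \<Rightarrow> tm" where
  "wk k = ren (\<lambda>i. i + k)"

text \<open>\<open>wkb\<close> weakens underneath one binder.\<close>

definition wkb :: "nat \<Rightarrow> tm \<Rightarrow> tm" where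
  "wkb k = ren (upr (\<lambda>i. i + k))"

definition up :: "(nat \<Rightarrow> tm) \<Rightarrow> nat \<Rightarrow> tm" where
  "up \<sigma> = case_nat (Var 0) (\<lambda>i. wk 1 (\<sigma> i))"

primrec sub :: "(nat \<Rightarrow> tm) \<Rightarrow> tm \<Rightarrow> tm" where
  "sub \<sigma> (Var i) = \<sigma> i"
| "sub \<sigma> Univ = Univ"
| "sub \<sigma> (Pi A B) = Pi (sub \<sigma> A) (sub (up \<sigma>) B)"
| "sub \<sigma> (Lam A b) = Lam (sub \<sigma> A) (sub (up \<sigma>) b)"
| "sub \<sigma> (App f a) = App (sub \<sigma> f) (sub \<sigma> a)"
| "sub \<sigma> (Sig A B) = Sig (sub \<sigma> A) (sub (up \<sigma>) B)"
| "sub \<sigma> (MkPair a b) = MkPair (sub \<sigma> a) (sub \<sigma> b)"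
| "sub \<sigma> (IndSig C d p) = IndSig (sub (up \<sigma>) C) (sub (up (up \<sigma>)) d) (sub \<sigma> p)"
| "sub \<sigma> (Path A a b) = Path (sub \<sigma> A) (sub \<sigma> a) (sub \<sigma> b)"
| "sub \<sigma> (Refl a) = Refl (sub \<sigma> a)"
| "sub \<sigma> (J C d a b p) = J (sub (up (up \<sigma>)) C) (sub \<sigma> d) (sub \<sigma> a) (sub \<sigma> b) (sub \<sigma> p)"
| "sub \<sigma> Empty = Empty"
| "sub \<sigma> (IndEmpty C e) = IndEmpty (sub (up \<sigma>) C) (sub \<sigma> e)"
| "sub \<sigma> Unit = Unit"
| "sub \<sigma> Star = Star"
| "sub \<sigma> (IndUnit C c e) = IndUnit (sub (up \<sigma>) C) (sub \<sigma> c) (sub \<sigma> e)"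
| "sub \<sigma> (Plus A B) = Plus (sub \<sigma> A) (sub \<sigma> B)"
| "sub \<sigma> (InL a) = InL (sub \<sigma> a)"
| "sub \<sigma> (InR b) = InR (sub \<sigma> b)"
| "sub \<sigma> (IndPlus C l r e) =
     IndPlus (sub (up \<sigma>) C) (sub (up \<sigma>) l) (sub (up \<sigma>) r) (sub \<sigma> e)"
| "sub \<sigma> Nats = Nats"
| "sub \<sigma> Zero = Zero"
| "sub \<sigma> (Succ n) = Succ (sub \<sigma> n)"
| "sub \<sigma> (IndNat C z s n) =
     IndNat (sub (up \<sigma>) C) (sub \<sigma> z) (sub (up (up \<sigma>)) s) (sub \<sigma> n)"
| "sub \<sigma> (Pushout S A B u v) =
     Pushout (sub \<sigma> S) (sub \<sigma> A) (sub \<sigma> B) (sub \<sigma> u) (sub \<sigma> v)"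
| "sub \<sigma> (PInl a) = PInl (sub \<sigma> a)"
| "sub \<sigma> (PInr b) = PInr (sub \<sigma> b)"
| "sub \<sigma> (Glue c) = Glue (sub \<sigma> c)"
| "sub \<sigma> (IndPush C l r s e) =
     IndPush (sub (up \<sigma>) C) (sub (up \<sigma>) l) (sub (up \<sigma>) r) (sub (up \<sigma>) s) (sub \<sigma> e)"
| "sub \<sigma> (GlueComp C l r s c) =
     GlueComp (sub (up \<sigma>) C) (sub (up \<sigma>) l) (sub (up \<sigma>) r) (sub (up \<sigma>) s) (sub \<sigma> c)"
| "sub \<sigma> (Funext f g) = Funext (sub \<sigma> f) (sub \<sigma> g)"
| "sub \<sigma> (Univalence A B) = Univalence (sub \<sigma> A) (sub \<sigma> B)"

text \<open>
  \<open>inst k t\<close> replaces index 0 by \<open>t\<close>, where \<open>t\<close> lives under \<open>k\<close> new binders.  So \<open>inst 0 t\<close> is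
  ordinary instantiation of the innermost variable, and \<open>inst2 a b\<close> instantiates
  index 1 by \<open>a\<close> and index 0 by \<open>b\<close>.
\<close>

definition inst :: "nat \<Rightarrow> tm \<Rightarrow> tm \<Rightarrow> tm" where
  "inst k t = sub (case_nat t (\<lambda>i. Var (i + k)))"

definition inst2 :: "tm \<Rightarrow> tm \<Rightarrow> tm \<Rightarrow> tm" where
  "inst2 a b = sub (case_nat b (case_nat a Var))"


section \<open>Derived notions of the object language\<close>

definition Arr :: "tm \<Rightarrow> tm \<Rightarrow> tm" where
  "Arr A B = Pi A (wk 1 B)"

definition Prod :: "tm \<Rightarrow> tm \<Rightarrow> tm" where
  "Prod A B = Sig A (wk 1 B)"

definition idf :: "tm \<Rightarrow> tm" where
  "idf A = Lam A (Var 0)"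

definition comp :: "tm \<Rightarrow> tm \<Rightarrow> tm \<Rightarrow> tm" where
  "comp A g f = Lam A (App (wk 1 g) (App (wk 1 f) (Var 0)))"

text \<open>Projections from \<open>Sig A B\<close>; the second one has type \<open>inst 0 (Fst A p) B\<close>.\<close>

definition Fst :: "tm \<Rightarrow> tm \<Rightarrow> tm" where
  "Fst A p = IndSig (wk 1 A) (Var 1) p"

definition Snd :: "tm \<Rightarrow> tm \<Rightarrow> tm \<Rightarrow> tm" where
  "Snd A B p = IndSig (inst 1 (Fst (wk 1 A) (Var 0)) B) (Var 0) p"

text \<open>Pointwise identifications of two elements of \<open>Pi A B\<close>.\<close>

definition Homot :: "tm \<Rightarrow> tm \<Rightarrow> tm \<Rightarrow> tm \<Rightarrow> tm" where
  "Homot A B f g = Pi A (Path B (App (wk 1 f) (Var 0)) (App (wk 1 g) (Var 0)))"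

text \<open>A map is an equivalence if it has a section and a retraction.\<close>

definition isEquiv :: "tm \<Rightarrow> tm \<Rightarrow> tm \<Rightarrow> tm" where
  "isEquiv A B f = Prod
     (Sig (Arr B A) (Homot (wk 1 B) (wk 2 B) (comp (wk 1 B) (wk 1 f) (Var 0)) (idf (wk 1 B))))
     (Sig (Arr B A) (Homot (wk 1 A) (wk 2 A) (comp (wk 1 A) (Var 0) (wk 1 f)) (idf (wk 1 A))))"

definition Equiv :: "tm \<Rightarrow> tm \<Rightarrow> tm" where
  "Equiv A B = Sig (Arr A B) (isEquiv (wk 1 A) (wk 1 B) (Var 0))"

text \<open>Transport of \<open>u\<close> along \<open>p : Path A a b\<close> in the family \<open>C\<close> over \<open>A\<close>.\<close>

definition transp :: "tm \<Rightarrow> tm \<Rightarrow> tm \<Rightarrow> tm \<Rightarrow> tm \<Rightarrow> tm" where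
  "transp C u a b p = J (wk 1 C) u a b p"

text \<open>
  Dependent action on \<open>p : Path A a b\<close> of the section \<open>F\<close> (an open term over \<open>A\<close>) of the family
  \<open>C\<close>, of type \<open>Path (inst 0 b C) (transp C (inst 0 a F) a b p) (inst 0 b F)\<close>.
\<close>

definition apd :: "tm \<Rightarrow> tm \<Rightarrow> tm \<Rightarrow> tm \<Rightarrow> tm \<Rightarrow> tm" where
  "apd C F a b p =
     J (Path (wk 1 C)
          (transp (wkb 2 C) (wk 2 (inst 0 a F)) (wk 2 a) (Var 1) (Var 0))
          (wk 1 F))
       (Refl (inst 0 a F)) a b p"

definition happly :: "tm \<Rightarrow> tm \<Rightarrow> tm \<Rightarrow> tm \<Rightarrow> tm" where
  "happly A B f g = Lam (Path (Pi A B) f g)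
     (J (Homot (wk 3 A) (wkb 3 B) (wk 3 f) (Var 1))
        (Lam (wk 1 A) (Refl (App (wk 2 f) (Var 0))))
        (wk 1 f) (wk 1 g) (Var 0))"

definition idEquiv :: "tm \<Rightarrow> tm" where
  "idEquiv A = MkPair (idf A)
     (MkPair (MkPair (idf A) (Lam A (Refl (Var 0)))) (MkPair (idf A) (Lam A (Refl (Var 0)))))"

definition idtoequiv :: "tm \<Rightarrow> tm \<Rightarrow> tm" where
  "idtoequiv A B = Lam (Path Univ A B)
     (J (Equiv (wk 3 A) (Var 1)) (idEquiv (wk 1 A)) (wk 1 A) (wk 1 B) (Var 0))"

text \<open>
  For the span of \<open>u : Arr S A\<close> and \<open>v : Arr S B\<close>: the type, over \<open>S\<close>, of the third branch of the
  induction principle of the pushout, for a motive \<open>C\<close> and point branches \<open>l\<close>, \<open>r\<close>.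
\<close>

definition GlueBranch :: "tm \<Rightarrow> tm \<Rightarrow> tm \<Rightarrow> tm \<Rightarrow> tm \<Rightarrow> tm" where
  "GlueBranch u v C l r =
     (let a = App (wk 1 u) (Var 0); b = App (wk 1 v) (Var 0) in
      Path (inst 1 (PInr b) C)
        (transp (wkb 1 C) (inst 1 a l) (PInl a) (PInr b) (Glue (Var 0)))
        (inst 1 b r))"


section \<open>Judgements\<close>

text \<open>
  Typing is the diagonal of judgemental equality: the judgement that \<open>a\<close> has type \<open>A\<close> is that \<open>a\<close>
  is judgementally equal to itself at \<open>A\<close>, and likewise for types.  So each
  rule for a constructor below is at once its typing rule and the rule that it preserves
  judgemental equality in every argument.
\<close>

inductive
  wf_ctx :: "ctx \<Rightarrow> bool" and
  eq_ty :: "ctx \<Rightarrow> tm \<Rightarrow> tm \<Rightarrow> bool"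
    ("_ \<turnstile> _ \<doteq> _ type" [51, 51, 51] 50) and
  eq_tm :: "ctx \<Rightarrow> tm \<Rightarrow> tm \<Rightarrow> tm \<Rightarrow> bool"
    ("_ \<turnstile> _ \<doteq> _ \<Ztypecolon> _" [51, 51, 51, 51] 50) and
  is_ty :: "ctx \<Rightarrow> tm \<Rightarrow> bool"
    ("_ \<turnstile> _ type" [51, 51] 50) and
  has_ty :: "ctx \<Rightarrow> tm \<Rightarrow> tm \<Rightarrow> bool"
    ("_ \<turnstile> _ \<Ztypecolon> _" [51, 51, 51] 50)
where
  "\<Gamma> \<turnstile> A type \<equiv> \<Gamma> \<turnstile> A \<doteq> A type"
| "\<Gamma> \<turnstile> a \<Ztypecolon> A \<equiv> \<Gamma> \<turnstile> a \<doteq> a \<Ztypecolon> A"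

\<comment> \<open>Contexts and structural rules.  Simultaneous substitution (whose instances are weakening,
   substitution, and its compatibility with judgemental equality) is included as a rule.\<close>
| ctx_nil: "wf_ctx []"
| ctx_cons: "\<Gamma> \<turnstile> A type \<Longrightarrow> wf_ctx (A # \<Gamma>)"
| var: "wf_ctx \<Gamma> \<Longrightarrow> i < length \<Gamma> \<Longrightarrow> \<Gamma> \<turnstile> Var i \<Ztypecolon> wk (Suc i) (\<Gamma> ! i)"
| ty_sym: "\<Gamma> \<turnstile> A \<doteq> B type \<Longrightarrow> \<Gamma> \<turnstile> B \<doteq> A type"
| ty_trans: "\<Gamma> \<turnstile> A \<doteq> B type \<Longrightarrow> \<Gamma> \<turnstile> B \<doteq> C type \<Longrightarrow> \<Gamma> \<turnstile> A \<doteq> C type"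
| tm_sym: "\<Gamma> \<turnstile> a \<doteq> b \<Ztypecolon> A \<Longrightarrow> \<Gamma> \<turnstile> b \<doteq> a \<Ztypecolon> A"
| tm_trans: "\<Gamma> \<turnstile> a \<doteq> b \<Ztypecolon> A \<Longrightarrow> \<Gamma> \<turnstile> b \<doteq> c \<Ztypecolon> A \<Longrightarrow> \<Gamma> \<turnstile> a \<doteq> c \<Ztypecolon> A"
| conv: "\<Gamma> \<turnstile> a \<doteq> b \<Ztypecolon> A \<Longrightarrow> \<Gamma> \<turnstile> A \<doteq> B type \<Longrightarrow> \<Gamma> \<turnstile> a \<doteq> b \<Ztypecolon> B"
| ty_subst: "\<lbrakk>\<Gamma> \<turnstile> A \<doteq> B type; wf_ctx \<Delta>;
     \<forall>i<length \<Gamma>. \<Delta> \<turnstile> \<sigma> i \<doteq> \<tau> i \<Ztypecolon> sub \<sigma> (wk (Suc i) (\<Gamma> ! i))\<rbrakk>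
   \<Longrightarrow> \<Delta> \<turnstile> sub \<sigma> A \<doteq> sub \<tau> B type"
| tm_subst: "\<lbrakk>\<Gamma> \<turnstile> a \<doteq> b \<Ztypecolon> A; wf_ctx \<Delta>;
     \<forall>i<length \<Gamma>. \<Delta> \<turnstile> \<sigma> i \<doteq> \<tau> i \<Ztypecolon> sub \<sigma> (wk (Suc i) (\<Gamma> ! i))\<rbrakk>
   \<Longrightarrow> \<Delta> \<turnstile> sub \<sigma> a \<doteq> sub \<tau> b \<Ztypecolon> sub \<sigma> A"

\<comment> \<open>The universe (Russell style; it is not an element of itself)\<close>
| univ: "wf_ctx \<Gamma> \<Longrightarrow> \<Gamma> \<turnstile> Univ type"
| univ_el: "\<Gamma> \<turnstile> A \<doteq> B \<Ztypecolon> Univ \<Longrightarrow> \<Gamma> \<turnstile> A \<doteq> B type"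

\<comment> \<open>Dependent functions\<close>
| pi_ty: "\<Gamma> \<turnstile> A \<doteq> A' type \<Longrightarrow> A # \<Gamma> \<turnstile> B \<doteq> B' type \<Longrightarrow> \<Gamma> \<turnstile> Pi A B \<doteq> Pi A' B' type"
| pi_univ: "\<Gamma> \<turnstile> A \<doteq> A' \<Ztypecolon> Univ \<Longrightarrow> A # \<Gamma> \<turnstile> B \<doteq> B' \<Ztypecolon> Univ
   \<Longrightarrow> \<Gamma> \<turnstile> Pi A B \<doteq> Pi A' B' \<Ztypecolon> Univ"
| lam: "\<Gamma> \<turnstile> A \<doteq> A' type \<Longrightarrow> A # \<Gamma> \<turnstile> b \<doteq> b' \<Ztypecolon> B \<Longrightarrow> \<Gamma> \<turnstile> Lam A b \<doteq> Lam A' b' \<Ztypecolon> Pi A B"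
| app: "\<Gamma> \<turnstile> f \<doteq> f' \<Ztypecolon> Pi A B \<Longrightarrow> \<Gamma> \<turnstile> a \<doteq> a' \<Ztypecolon> A \<Longrightarrow> \<Gamma> \<turnstile> App f a \<doteq> App f' a' \<Ztypecolon> inst 0 a B"
| pi_beta: "A # \<Gamma> \<turnstile> b \<Ztypecolon> B \<Longrightarrow> \<Gamma> \<turnstile> a \<Ztypecolon> A \<Longrightarrow> \<Gamma> \<turnstile> App (Lam A b) a \<doteq> inst 0 a b \<Ztypecolon> inst 0 a B"
| pi_eta: "\<Gamma> \<turnstile> f \<Ztypecolon> Pi A B \<Longrightarrow> \<Gamma> \<turnstile> Lam A (App (wk 1 f) (Var 0)) \<doteq> f \<Ztypecolon> Pi A B"

\<comment> \<open>Dependent pairs\<close>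
| sig_ty: "\<Gamma> \<turnstile> A \<doteq> A' type \<Longrightarrow> A # \<Gamma> \<turnstile> B \<doteq> B' type \<Longrightarrow> \<Gamma> \<turnstile> Sig A B \<doteq> Sig A' B' type"
| sig_univ: "\<Gamma> \<turnstile> A \<doteq> A' \<Ztypecolon> Univ \<Longrightarrow> A # \<Gamma> \<turnstile> B \<doteq> B' \<Ztypecolon> Univ
   \<Longrightarrow> \<Gamma> \<turnstile> Sig A B \<doteq> Sig A' B' \<Ztypecolon> Univ"
| pair: "\<lbrakk>A # \<Gamma> \<turnstile> B type; \<Gamma> \<turnstile> a \<doteq> a' \<Ztypecolon> A; \<Gamma> \<turnstile> b \<doteq> b' \<Ztypecolon> inst 0 a B\<rbrakk>
   \<Longrightarrow> \<Gamma> \<turnstile> MkPair a b \<doteq> MkPair a' b' \<Ztypecolon> Sig A B"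
| sig_ind: "\<lbrakk>Sig A B # \<Gamma> \<turnstile> C \<doteq> C' type;
     B # A # \<Gamma> \<turnstile> d \<doteq> d' \<Ztypecolon> inst 2 (MkPair (Var 1) (Var 0)) C;
     \<Gamma> \<turnstile> p \<doteq> p' \<Ztypecolon> Sig A B\<rbrakk>
   \<Longrightarrow> \<Gamma> \<turnstile> IndSig C d p \<doteq> IndSig C' d' p' \<Ztypecolon> inst 0 p C"
| sig_beta: "\<lbrakk>Sig A B # \<Gamma> \<turnstile> C type;
     B # A # \<Gamma> \<turnstile> d \<Ztypecolon> inst 2 (MkPair (Var 1) (Var 0)) C;
     \<Gamma> \<turnstile> a \<Ztypecolon> A; \<Gamma> \<turnstile> b \<Ztypecolon> inst 0 a B\<rbrakk>
   \<Longrightarrow> \<Gamma> \<turnstile> IndSig C d (MkPair a b) \<doteq> inst2 a b d \<Ztypecolon> inst 0 (MkPair a b) C"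

\<comment> \<open>Identity types (based path induction)\<close>
| path_ty: "\<lbrakk>\<Gamma> \<turnstile> A \<doteq> A' type; \<Gamma> \<turnstile> a \<doteq> a' \<Ztypecolon> A; \<Gamma> \<turnstile> b \<doteq> b' \<Ztypecolon> A\<rbrakk>
   \<Longrightarrow> \<Gamma> \<turnstile> Path A a b \<doteq> Path A' a' b' type"
| path_univ: "\<lbrakk>\<Gamma> \<turnstile> A \<doteq> A' \<Ztypecolon> Univ; \<Gamma> \<turnstile> a \<doteq> a' \<Ztypecolon> A; \<Gamma> \<turnstile> b \<doteq> b' \<Ztypecolon> A\<rbrakk>
   \<Longrightarrow> \<Gamma> \<turnstile> Path A a b \<doteq> Path A' a' b' \<Ztypecolon> Univ"
| refl: "\<Gamma> \<turnstile> a \<doteq> a' \<Ztypecolon> A \<Longrightarrow> \<Gamma> \<turnstile> Refl a \<doteq> Refl a' \<Ztypecolon> Path A a a"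
| path_ind: "\<lbrakk>\<Gamma> \<turnstile> a \<doteq> a' \<Ztypecolon> A;
     Path (wk 1 A) (wk 1 a) (Var 0) # A # \<Gamma> \<turnstile> C \<doteq> C' type;
     \<Gamma> \<turnstile> d \<doteq> d' \<Ztypecolon> inst2 a (Refl a) C;
     \<Gamma> \<turnstile> b \<doteq> b' \<Ztypecolon> A; \<Gamma> \<turnstile> p \<doteq> p' \<Ztypecolon> Path A a b\<rbrakk>
   \<Longrightarrow> \<Gamma> \<turnstile> J C d a b p \<doteq> J C' d' a' b' p' \<Ztypecolon> inst2 b p C"
| path_beta: "\<lbrakk>\<Gamma> \<turnstile> a \<Ztypecolon> A;
     Path (wk 1 A) (wk 1 a) (Var 0) # A # \<Gamma> \<turnstile> C type;
     \<Gamma> \<turnstile> d \<Ztypecolon> inst2 a (Refl a) C\<rbrakk>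
   \<Longrightarrow> \<Gamma> \<turnstile> J C d a a (Refl a) \<doteq> d \<Ztypecolon> inst2 a (Refl a) C"

\<comment> \<open>Empty and unit type\<close>
| empty_univ: "wf_ctx \<Gamma> \<Longrightarrow> \<Gamma> \<turnstile> Empty \<Ztypecolon> Univ"
| empty_ind: "Empty # \<Gamma> \<turnstile> C \<doteq> C' type \<Longrightarrow> \<Gamma> \<turnstile> e \<doteq> e' \<Ztypecolon> Empty
   \<Longrightarrow> \<Gamma> \<turnstile> IndEmpty C e \<doteq> IndEmpty C' e' \<Ztypecolon> inst 0 e C"
| unit_univ: "wf_ctx \<Gamma> \<Longrightarrow> \<Gamma> \<turnstile> Unit \<Ztypecolon> Univ"
| star: "wf_ctx \<Gamma> \<Longrightarrow> \<Gamma> \<turnstile> Star \<Ztypecolon> Unit"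
| unit_ind: "\<lbrakk>Unit # \<Gamma> \<turnstile> C \<doteq> C' type; \<Gamma> \<turnstile> c \<doteq> c' \<Ztypecolon> inst 0 Star C; \<Gamma> \<turnstile> e \<doteq> e' \<Ztypecolon> Unit\<rbrakk>
   \<Longrightarrow> \<Gamma> \<turnstile> IndUnit C c e \<doteq> IndUnit C' c' e' \<Ztypecolon> inst 0 e C"
| unit_beta: "\<lbrakk>Unit # \<Gamma> \<turnstile> C type; \<Gamma> \<turnstile> c \<Ztypecolon> inst 0 Star C\<rbrakk>
   \<Longrightarrow> \<Gamma> \<turnstile> IndUnit C c Star \<doteq> c \<Ztypecolon> inst 0 Star C"

\<comment> \<open>Coproducts\<close>
| plus_ty: "\<Gamma> \<turnstile> A \<doteq> A' type \<Longrightarrow> \<Gamma> \<turnstile> B \<doteq> B' type \<Longrightarrow> \<Gamma> \<turnstile> Plus A B \<doteq> Plus A' B' type"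
| plus_univ: "\<Gamma> \<turnstile> A \<doteq> A' \<Ztypecolon> Univ \<Longrightarrow> \<Gamma> \<turnstile> B \<doteq> B' \<Ztypecolon> Univ
   \<Longrightarrow> \<Gamma> \<turnstile> Plus A B \<doteq> Plus A' B' \<Ztypecolon> Univ"
| inl: "\<Gamma> \<turnstile> a \<doteq> a' \<Ztypecolon> A \<Longrightarrow> \<Gamma> \<turnstile> B type \<Longrightarrow> \<Gamma> \<turnstile> InL a \<doteq> InL a' \<Ztypecolon> Plus A B"
| inr: "\<Gamma> \<turnstile> b \<doteq> b' \<Ztypecolon> B \<Longrightarrow> \<Gamma> \<turnstile> A type \<Longrightarrow> \<Gamma> \<turnstile> InR b \<doteq> InR b' \<Ztypecolon> Plus A B"
| plus_ind: "\<lbrakk>Plus A B # \<Gamma> \<turnstile> C \<doteq> C' type;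
     A # \<Gamma> \<turnstile> l \<doteq> l' \<Ztypecolon> inst 1 (InL (Var 0)) C;
     B # \<Gamma> \<turnstile> r \<doteq> r' \<Ztypecolon> inst 1 (InR (Var 0)) C;
     \<Gamma> \<turnstile> e \<doteq> e' \<Ztypecolon> Plus A B\<rbrakk>
   \<Longrightarrow> \<Gamma> \<turnstile> IndPlus C l r e \<doteq> IndPlus C' l' r' e' \<Ztypecolon> inst 0 e C"
| plus_beta_inl: "\<lbrakk>Plus A B # \<Gamma> \<turnstile> C type;
     A # \<Gamma> \<turnstile> l \<Ztypecolon> inst 1 (InL (Var 0)) C;
     B # \<Gamma> \<turnstile> r \<Ztypecolon> inst 1 (InR (Var 0)) C;
     \<Gamma> \<turnstile> a \<Ztypecolon> A\<rbrakk>
   \<Longrightarrow> \<Gamma> \<turnstile> IndPlus C l r (InL a) \<doteq> inst 0 a l \<Ztypecolon> inst 0 (InL a) C"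
| plus_beta_inr: "\<lbrakk>Plus A B # \<Gamma> \<turnstile> C type;
     A # \<Gamma> \<turnstile> l \<Ztypecolon> inst 1 (InL (Var 0)) C;
     B # \<Gamma> \<turnstile> r \<Ztypecolon> inst 1 (InR (Var 0)) C;
     \<Gamma> \<turnstile> b \<Ztypecolon> B\<rbrakk>
   \<Longrightarrow> \<Gamma> \<turnstile> IndPlus C l r (InR b) \<doteq> inst 0 b r \<Ztypecolon> inst 0 (InR b) C"

\<comment> \<open>Natural numbers\<close>
| nat_univ: "wf_ctx \<Gamma> \<Longrightarrow> \<Gamma> \<turnstile> Nats \<Ztypecolon> Univ"
| zero: "wf_ctx \<Gamma> \<Longrightarrow> \<Gamma> \<turnstile> Zero \<Ztypecolon> Nats"
| succ: "\<Gamma> \<turnstile> n \<doteq> n' \<Ztypecolon> Nats \<Longrightarrow> \<Gamma> \<turnstile> Succ n \<doteq> Succ n' \<Ztypecolon> Nats"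
| nat_ind: "\<lbrakk>Nats # \<Gamma> \<turnstile> C \<doteq> C' type;
     \<Gamma> \<turnstile> z \<doteq> z' \<Ztypecolon> inst 0 Zero C;
     C # Nats # \<Gamma> \<turnstile> s \<doteq> s' \<Ztypecolon> inst 2 (Succ (Var 1)) C;
     \<Gamma> \<turnstile> n \<doteq> n' \<Ztypecolon> Nats\<rbrakk>
   \<Longrightarrow> \<Gamma> \<turnstile> IndNat C z s n \<doteq> IndNat C' z' s' n' \<Ztypecolon> inst 0 n C"
| nat_beta_zero: "\<lbrakk>Nats # \<Gamma> \<turnstile> C type;
     \<Gamma> \<turnstile> z \<Ztypecolon> inst 0 Zero C;
     C # Nats # \<Gamma> \<turnstile> s \<Ztypecolon> inst 2 (Succ (Var 1)) C\<rbrakk>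
   \<Longrightarrow> \<Gamma> \<turnstile> IndNat C z s Zero \<doteq> z \<Ztypecolon> inst 0 Zero C"
| nat_beta_succ: "\<lbrakk>Nats # \<Gamma> \<turnstile> C type;
     \<Gamma> \<turnstile> z \<Ztypecolon> inst 0 Zero C;
     C # Nats # \<Gamma> \<turnstile> s \<Ztypecolon> inst 2 (Succ (Var 1)) C;
     \<Gamma> \<turnstile> n \<Ztypecolon> Nats\<rbrakk>
   \<Longrightarrow> \<Gamma> \<turnstile> IndNat C z s (Succ n) \<doteq> inst2 n (IndNat C z s n) s \<Ztypecolon> inst 0 (Succ n) C"

\<comment> \<open>Homotopy pushouts: judgemental computation on points, and computation on \<open>Glue\<close> up to the
   identification \<open>GlueComp\<close>\<close>
| push_univ: "\<lbrakk>\<Gamma> \<turnstile> S \<doteq> S' \<Ztypecolon> Univ; \<Gamma> \<turnstile> A \<doteq> A' \<Ztypecolon> Univ; \<Gamma> \<turnstile> B \<doteq> B' \<Ztypecolon> Univ;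
     \<Gamma> \<turnstile> u \<doteq> u' \<Ztypecolon> Arr S A; \<Gamma> \<turnstile> v \<doteq> v' \<Ztypecolon> Arr S B\<rbrakk>
   \<Longrightarrow> \<Gamma> \<turnstile> Pushout S A B u v \<doteq> Pushout S' A' B' u' v' \<Ztypecolon> Univ"
| push_inl: "\<Gamma> \<turnstile> Pushout S A B u v \<Ztypecolon> Univ \<Longrightarrow> \<Gamma> \<turnstile> a \<doteq> a' \<Ztypecolon> A
   \<Longrightarrow> \<Gamma> \<turnstile> PInl a \<doteq> PInl a' \<Ztypecolon> Pushout S A B u v"
| push_inr: "\<Gamma> \<turnstile> Pushout S A B u v \<Ztypecolon> Univ \<Longrightarrow> \<Gamma> \<turnstile> b \<doteq> b' \<Ztypecolon> B
   \<Longrightarrow> \<Gamma> \<turnstile> PInr b \<doteq> PInr b' \<Ztypecolon> Pushout S A B u v"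
| push_glue: "\<Gamma> \<turnstile> Pushout S A B u v \<Ztypecolon> Univ \<Longrightarrow> \<Gamma> \<turnstile> c \<doteq> c' \<Ztypecolon> S
   \<Longrightarrow> \<Gamma> \<turnstile> Glue c \<doteq> Glue c' \<Ztypecolon> Path (Pushout S A B u v) (PInl (App u c)) (PInr (App v c))"
| push_ind: "\<lbrakk>Pushout S A B u v # \<Gamma> \<turnstile> C \<doteq> C' type;
     A # \<Gamma> \<turnstile> l \<doteq> l' \<Ztypecolon> inst 1 (PInl (Var 0)) C;
     B # \<Gamma> \<turnstile> r \<doteq> r' \<Ztypecolon> inst 1 (PInr (Var 0)) C;
     S # \<Gamma> \<turnstile> s \<doteq> s' \<Ztypecolon> GlueBranch u v C l r;
     \<Gamma> \<turnstile> e \<doteq> e' \<Ztypecolon> Pushout S A B u v\<rbrakk>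
   \<Longrightarrow> \<Gamma> \<turnstile> IndPush C l r s e \<doteq> IndPush C' l' r' s' e' \<Ztypecolon> inst 0 e C"
| push_beta_inl: "\<lbrakk>Pushout S A B u v # \<Gamma> \<turnstile> C type;
     A # \<Gamma> \<turnstile> l \<Ztypecolon> inst 1 (PInl (Var 0)) C;
     B # \<Gamma> \<turnstile> r \<Ztypecolon> inst 1 (PInr (Var 0)) C;
     S # \<Gamma> \<turnstile> s \<Ztypecolon> GlueBranch u v C l r;
     \<Gamma> \<turnstile> a \<Ztypecolon> A\<rbrakk>
   \<Longrightarrow> \<Gamma> \<turnstile> IndPush C l r s (PInl a) \<doteq> inst 0 a l \<Ztypecolon> inst 0 (PInl a) C"
| push_beta_inr: "\<lbrakk>Pushout S A B u v # \<Gamma> \<turnstile> C type;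
     A # \<Gamma> \<turnstile> l \<Ztypecolon> inst 1 (PInl (Var 0)) C;
     B # \<Gamma> \<turnstile> r \<Ztypecolon> inst 1 (PInr (Var 0)) C;
     S # \<Gamma> \<turnstile> s \<Ztypecolon> GlueBranch u v C l r;
     \<Gamma> \<turnstile> b \<Ztypecolon> B\<rbrakk>
   \<Longrightarrow> \<Gamma> \<turnstile> IndPush C l r s (PInr b) \<doteq> inst 0 b r \<Ztypecolon> inst 0 (PInr b) C"
| push_comp_glue: "\<lbrakk>Pushout S A B u v # \<Gamma> \<turnstile> C \<doteq> C' type;
     A # \<Gamma> \<turnstile> l \<doteq> l' \<Ztypecolon> inst 1 (PInl (Var 0)) C;
     B # \<Gamma> \<turnstile> r \<doteq> r' \<Ztypecolon> inst 1 (PInr (Var 0)) C;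
     S # \<Gamma> \<turnstile> s \<doteq> s' \<Ztypecolon> GlueBranch u v C l r;
     \<Gamma> \<turnstile> c \<doteq> c' \<Ztypecolon> S\<rbrakk>
   \<Longrightarrow> \<Gamma> \<turnstile> GlueComp C l r s c \<doteq> GlueComp C' l' r' s' c' \<Ztypecolon>
        Path (inst 0 c (GlueBranch u v C l r))
          (apd C (IndPush (wkb 1 C) (wkb 1 l) (wkb 1 r) (wkb 1 s) (Var 0))
             (PInl (App u c)) (PInr (App v c)) (Glue c))
          (inst 0 c s)"

\<comment> \<open>Function extensionality and univalence\<close>
| funext: "\<Gamma> \<turnstile> f \<doteq> f' \<Ztypecolon> Pi A B \<Longrightarrow> \<Gamma> \<turnstile> g \<doteq> g' \<Ztypecolon> Pi A B
   \<Longrightarrow> \<Gamma> \<turnstile> Funext f g \<doteq> Funext f' g' \<Ztypecolon>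
        isEquiv (Path (Pi A B) f g) (Homot A B f g) (happly A B f g)"
| univalence: "\<Gamma> \<turnstile> A \<doteq> A' \<Ztypecolon> Univ \<Longrightarrow> \<Gamma> \<turnstile> B \<doteq> B' \<Ztypecolon> Univ
   \<Longrightarrow> \<Gamma> \<turnstile> Univalence A B \<doteq> Univalence A' B' \<Ztypecolon>
        isEquiv (Path Univ A B) (Equiv A B) (idtoequiv A B)"


section \<open>Fibers and joins\<close>

definition Fib :: "tm \<Rightarrow> tm \<Rightarrow> tm \<Rightarrow> tm \<Rightarrow> tm" where
  "Fib A X h x = Sig A (Path (wk 1 X) (App (wk 1 h) (Var 0)) (wk 1 x))"

text \<open>
  Recursion into \<open>X\<close> out of the pushout of \<open>u : Arr S A\<close> and \<open>v : Arr S B\<close>, for a cocone consisting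
  of \<open>l : Arr A X\<close>, \<open>r : Arr B X\<close> and \<open>h c : Path X (l (u c)) (r (v c))\<close>.  The third branch is the
  composite of \<open>h c\<close> with the path saying that transport of \<open>l (u c)\<close> along \<open>Glue c\<close> in the constant family
  \<open>X\<close> is trivial; it is defined by path induction on \<open>Glue c\<close>, with value \<open>h c\<close> at reflexivity.
\<close>

definition RecPush :: "tm \<Rightarrow> tm \<Rightarrow> tm \<Rightarrow> tm \<Rightarrow> tm \<Rightarrow> tm \<Rightarrow> tm \<Rightarrow> tm" where
  "RecPush u v X l r h e =
     (let a = App (wk 1 u) (Var 0); b = App (wk 1 v) (Var 0) in
      IndPush (wk 1 X)
        (App (wk 1 l) (Var 0))
        (App (wk 1 r) (Var 0))
        (J (Path (wk 3 X)
              (transp (wk 4 X) (wk 2 (App (wk 1 l) a)) (wk 2 (PInl a)) (Var 1) (Var 0))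
              (wk 2 (App (wk 1 r) b)))
           (App (wk 1 h) (Var 0)) (PInl a) (PInr b) (Glue (Var 0)))
        e)"

text \<open>The pullback of \<open>f : Arr A X\<close> and \<open>g : Arr B X\<close>; \<open>PullbackTail\<close> is the family over \<open>A\<close>.\<close>

definition PullbackTail :: "tm \<Rightarrow> tm \<Rightarrow> tm \<Rightarrow> tm \<Rightarrow> tm" where
  "PullbackTail B X f g =
     Sig (wk 1 B) (Path (wk 2 X) (App (wk 2 f) (Var 1)) (App (wk 2 g) (Var 0)))"

definition Pullback :: "tm \<Rightarrow> tm \<Rightarrow> tm \<Rightarrow> tm \<Rightarrow> tm \<Rightarrow> tm" where
  "Pullback A B X f g = Sig A (PullbackTail B X f g)"

definition pb_pi1 :: "tm \<Rightarrow> tm \<Rightarrow> tm \<Rightarrow> tm \<Rightarrow> tm \<Rightarrow> tm" where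
  "pb_pi1 A B X f g = Lam (Pullback A B X f g) (Fst (wk 1 A) (Var 0))"

definition pb_pi2 :: "tm \<Rightarrow> tm \<Rightarrow> tm \<Rightarrow> tm \<Rightarrow> tm \<Rightarrow> tm" where
  "pb_pi2 A B X f g = Lam (Pullback A B X f g)
     (Fst (wk 1 B) (Snd (wk 1 A) (wkb 1 (PullbackTail B X f g)) (Var 0)))"

text \<open>The canonical homotopy from \<open>f\<close> after \<open>pb_pi1\<close> to \<open>g\<close> after \<open>pb_pi2\<close>: the last component.\<close>

definition pb_homot :: "tm \<Rightarrow> tm \<Rightarrow> tm \<Rightarrow> tm \<Rightarrow> tm \<Rightarrow> tm" where
  "pb_homot A B X f g = Lam (Pullback A B X f g)
     (Snd (wk 1 B)
        (Path (wk 2 X) (App (wk 2 f) (Fst (wk 2 A) (Var 1))) (App (wk 2 g) (Var 0)))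
        (Snd (wk 1 A) (wkb 1 (PullbackTail B X f g)) (Var 0)))"

definition JoinOver :: "tm \<Rightarrow> tm \<Rightarrow> tm \<Rightarrow> tm \<Rightarrow> tm \<Rightarrow> tm" where
  "JoinOver A B X f g =
     Pushout (Pullback A B X f g) A B (pb_pi1 A B X f g) (pb_pi2 A B X f g)"

definition join_map :: "tm \<Rightarrow> tm \<Rightarrow> tm \<Rightarrow> tm \<Rightarrow> tm \<Rightarrow> tm" where
  "join_map A B X f g = Lam (JoinOver A B X f g)
     (RecPush (wk 1 (pb_pi1 A B X f g)) (wk 1 (pb_pi2 A B X f g)) (wk 1 X)
        (wk 1 f) (wk 1 g) (wk 1 (pb_homot A B X f g)) (Var 0))"

definition Join :: "tm \<Rightarrow> tm \<Rightarrow> tm" where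
  "Join P Q = Pushout (Prod P Q) P Q
     (Lam (Prod P Q) (Fst (wk 1 P) (Var 0)))
     (Lam (Prod P Q) (Snd (wk 1 P) (wk 2 Q) (Var 0)))"

end

theory Submission
  imports Defs
begin

text \<open>
  The total space of the family of joins of fibers, \<open>tot = (\<Sigma> y : X. fib f y * fib g y)\<close>, is equivalent to
  \<open>A *\<^sub>X B\<close> over \<open>X\<close>.  Both maps are defined by pushout recursion: \<open>fwd\<close> sends \<open>inl a\<close> to
  \<open>(f a, inl (a, refl))\<close>, \<open>inr b\<close> to \<open>(g b, inr (b, refl))\<close>, and \<open>back\<close> forgets the paths.  All
  homotopies between composites are squares in non-dependent path types, and after path induction each
  of them is an instance of the computation rule of one recursor on \<open>glue\<close>.  By univalence the fiber
  of \<open>f * g\<close> over \<open>x\<close> is then the fiber over \<open>x\<close> of the projection from \<open>tot\<close>, that is, the join of the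
  two fibers.

  The derivation itself is found by a type checker for an annotated version of the object language,
  which is sound for the judgements and is run by the simplifier.  It is found once, in the context of
  six variables \<open>A B X f g x\<close>, for which the given terms are then substituted.
\<close>

section \<open>Substitution\<close>

text \<open>Why the total space: a map out of the fiber of \<open>f * g\<close> over a fixed
  \<open>x\<close> would need pushout induction on \<open>w\<close> into the functions from
  \<open>(f * g) w = x\<close> to the join, and its glue branch would transport in a family of
  function types. Summing over the base point removes the path, so \<open>fwd\<close> is plain
  recursion on \<open>w\<close>. Two features of the object theory determine the remaining work.
  Recursion computes on \<open>Glue\<close> only up to a path, so every homotopy out of a pushout
  costs one square per glue path. Pairs have no judgemental eta, so the squares of the two round
  trips are proved for literal tuples and then extended by Sigma induction. The construction is
  asymmetric on purpose. Gluing over \<open>(a, b, p)\<close> always happens above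
  \<open>g b\<close>, to which the left point is slid along \<open>p\<close>; composition and
  \<open>tri\<close> are defined by induction on their last path. When the path on the right is
  reflexivity, these choices make the squares collapse to computation rules of recursors.\<close>

lemma upr_simps [simp]: "upr \<rho> 0 = 0" "upr \<rho> (Suc i) = Suc (\<rho> i)"
  by (simp_all add: upr_def)

lemma up_0 [simp]: "up \<sigma> 0 = Var 0"
  by (simp add: up_def)

lemma up_Suc: "up \<sigma> (Suc i) = wk 1 (\<sigma> i)"
  by (simp add: up_def)

lemma up_Var: "up (\<lambda>i. Var (\<rho> i)) = (\<lambda>i. Var (upr \<rho> i))"
  by (auto simp: up_def upr_def wk_def split: nat.split)

lemma sub_Var_ren: "sub (\<lambda>i. Var (\<rho> i)) t = ren \<rho> t"
  by (induction t arbitrary: \<rho>) (simp_all add: up_Var)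

lemma sub_Var [simp]: "sub Var t = t"
proof -
  have "up Var = Var" by (auto simp: up_def wk_def split: nat.split)
  then show ?thesis by (induction t) simp_all
qed

lemma upr_comp: "upr \<rho> (upr \<pi> i) = upr (\<lambda>i. \<rho> (\<pi> i)) i"
  by (cases i) simp_all

lemma ren_ren: "ren \<rho> (ren \<pi> t) = ren (\<lambda>i. \<rho> (\<pi> i)) t"
  by (induction t arbitrary: \<rho> \<pi>) (simp_all add: upr_comp)

lemma up_upr: "up \<sigma> (upr \<rho> i) = up (\<lambda>i. \<sigma> (\<rho> i)) i"
  by (cases i) (simp_all add: up_Suc)

lemma sub_ren: "sub \<sigma> (ren \<rho> t) = sub (\<lambda>i. \<sigma> (\<rho> i)) t"
  by (induction t arbitrary: \<rho> \<sigma>) (simp_all add: up_upr)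

lemma ren_up: "ren (upr \<rho>) (up \<sigma> i) = up (\<lambda>i. ren \<rho> (\<sigma> i)) i"
  by (cases i) (simp_all add: up_Suc wk_def ren_ren)

lemma ren_sub: "ren \<rho> (sub \<sigma> t) = sub (\<lambda>i. ren \<rho> (\<sigma> i)) t"
  by (induction t arbitrary: \<rho> \<sigma>) (simp_all add: ren_up)

lemma sub_up: "sub (up \<sigma>) (up \<tau> i) = up (\<lambda>i. sub \<sigma> (\<tau> i)) i"
  by (cases i) (simp_all add: up_Suc wk_def sub_ren ren_sub)

lemma sub_sub: "sub \<sigma> (sub \<tau> t) = sub (\<lambda>i. sub \<sigma> (\<tau> i)) t"
  by (induction t arbitrary: \<sigma> \<tau>) (simp_all add: sub_up)

section \<open>Annotated terms\<close>

text \<open>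
  Raw terms do not determine their types (\<open>PInl a\<close> lies in many pushouts), so the checker works on
  terms that carry annotations and are erased to raw terms by \<open>tr\<close>.  \<open>TY\<close> is the sort of large types.
  In a constant \<open>K d ts\<close> the arguments are listed innermost first, like contexts.  The fields of \<open>Decl\<close>
  are: an identifying tag, the parameter types, the type, the body, whether conversion may unfold the
  body, whether the constant reduces when its last argument is canonical, and derived computation
  rules for that case (shape of the argument, types of its components, right-hand side).
\<close>

datatype xt =
    V nat | U | TY
  | PiX xt xt | LamX xt xt | AppX xt xt
  | SigX xt xt | PairX xt xt xt | IndSigX xt xt xt xt xt
  | PathX xt xt xt | ReflX xt | JX xt xt xt xt xt xt
  | PushX xt xt xt xt xt | InlX xt xt | InrX xt xt | GlueX xt xt
  | IndPushX xt xt xt xt xt xt | GlueCompX xt xt xt xt xt xt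
  | K decl "xt list"
and decl = Decl nat "xt list" xt dbody bool bool "(nat \<times> xt list \<times> xt) list"
and dbody = Prim tm | Def xt

primrec lift :: "nat \<Rightarrow> nat \<Rightarrow> xt \<Rightarrow> xt" where
  "lift k c (V i) = V (if i < c then i else i + k)"
| "lift k c U = U"
| "lift k c TY = TY"
| "lift k c (PiX A B) = PiX (lift k c A) (lift k (Suc c) B)"
| "lift k c (LamX A b) = LamX (lift k c A) (lift k (Suc c) b)"
| "lift k c (AppX f a) = AppX (lift k c f) (lift k c a)"
| "lift k c (SigX A B) = SigX (lift k c A) (lift k (Suc c) B)"
| "lift k c (PairX T a b) = PairX (lift k c T) (lift k c a) (lift k c b)"
| "lift k c (IndSigX A B C d p) = IndSigX (lift k c A) (lift k (Suc c) B) (lift k (Suc c) C)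
     (lift k (Suc (Suc c)) d) (lift k c p)"
| "lift k c (PathX A a b) = PathX (lift k c A) (lift k c a) (lift k c b)"
| "lift k c (ReflX a) = ReflX (lift k c a)"
| "lift k c (JX A C d a b p) = JX (lift k c A) (lift k (Suc (Suc c)) C) (lift k c d) (lift k c a)
     (lift k c b) (lift k c p)"
| "lift k c (PushX S A B u v) = PushX (lift k c S) (lift k c A) (lift k c B) (lift k c u) (lift k c v)"
| "lift k c (InlX T a) = InlX (lift k c T) (lift k c a)"
| "lift k c (InrX T a) = InrX (lift k c T) (lift k c a)"
| "lift k c (GlueX T a) = GlueX (lift k c T) (lift k c a)"
| "lift k c (IndPushX T C l r s e) = IndPushX (lift k c T) (lift k (Suc c) C) (lift k (Suc c) l)
     (lift k (Suc c) r) (lift k (Suc c) s) (lift k c e)"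
| "lift k c (GlueCompX T C l r s e) = GlueCompX (lift k c T) (lift k (Suc c) C) (lift k (Suc c) l)
     (lift k (Suc c) r) (lift k (Suc c) s) (lift k c e)"
| "lift k c (K d ts) = K d (map (lift k c) ts)"

text \<open>The number \<open>e\<close> counts the variables that take the place of the replaced
  block: 0 for an instantiation in the same context, 1 or 2 for the type of a branch, and the length
  of the context when the body of a constant is moved there from its parameters.\<close>

primrec xsub :: "nat \<Rightarrow> nat \<Rightarrow> xt list \<Rightarrow> xt \<Rightarrow> xt" where
  "xsub c e us (V i) =
     (if i < c then V i else if i - c < length us then lift c 0 (us ! (i - c)) else V (i - length us + e))"
| "xsub c e us U = U"
| "xsub c e us TY = TY"
| "xsub c e us (PiX A B) = PiX (xsub c e us A) (xsub (Suc c) e us B)"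
| "xsub c e us (LamX A b) = LamX (xsub c e us A) (xsub (Suc c) e us b)"
| "xsub c e us (AppX f a) = AppX (xsub c e us f) (xsub c e us a)"
| "xsub c e us (SigX A B) = SigX (xsub c e us A) (xsub (Suc c) e us B)"
| "xsub c e us (PairX T a b) = PairX (xsub c e us T) (xsub c e us a) (xsub c e us b)"
| "xsub c e us (IndSigX A B C d p) = IndSigX (xsub c e us A) (xsub (Suc c) e us B)
     (xsub (Suc c) e us C) (xsub (Suc (Suc c)) e us d) (xsub c e us p)"
| "xsub c e us (PathX A a b) = PathX (xsub c e us A) (xsub c e us a) (xsub c e us b)"
| "xsub c e us (ReflX a) = ReflX (xsub c e us a)"
| "xsub c e us (JX A C d a b p) = JX (xsub c e us A) (xsub (Suc (Suc c)) e us C) (xsub c e us d)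
     (xsub c e us a) (xsub c e us b) (xsub c e us p)"
| "xsub c e us (PushX S A B u v) = PushX (xsub c e us S) (xsub c e us A) (xsub c e us B)
     (xsub c e us u) (xsub c e us v)"
| "xsub c e us (InlX T a) = InlX (xsub c e us T) (xsub c e us a)"
| "xsub c e us (InrX T a) = InrX (xsub c e us T) (xsub c e us a)"
| "xsub c e us (GlueX T a) = GlueX (xsub c e us T) (xsub c e us a)"
| "xsub c e us (IndPushX T C l r s p) = IndPushX (xsub c e us T) (xsub (Suc c) e us C)
     (xsub (Suc c) e us l) (xsub (Suc c) e us r) (xsub (Suc c) e us s) (xsub c e us p)"
| "xsub c e us (GlueCompX T C l r s p) = GlueCompX (xsub c e us T) (xsub (Suc c) e us C)
     (xsub (Suc c) e us l) (xsub (Suc c) e us r) (xsub (Suc c) e us s) (xsub c e us p)"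
| "xsub c e us (K d ts) = K d (map (xsub c e us) ts)"

text \<open>
  \<open>tr t n\<close> is taken in a context of \<open>n\<close> local variables on top of \<open>base\<close>.  The depth is needed
  because the body of a constant refers to \<open>base\<close> underneath the parameters only.
\<close>

definition env :: "nat \<Rightarrow> tm list \<Rightarrow> nat \<Rightarrow> tm" where
  "env n us i = (if i < length us then us ! i else Var (i - length us + n))"

primrec tr :: "xt \<Rightarrow> nat \<Rightarrow> tm" and trd :: "decl \<Rightarrow> tm" and trb :: "dbody \<Rightarrow> nat \<Rightarrow> tm" where
  "tr (V i) n = Var i"
| "tr U n = Univ"
| "tr TY n = Univ"
| "tr (PiX A B) n = Pi (tr A n) (tr B (Suc n))"
| "tr (LamX A b) n = Lam (tr A n) (tr b (Suc n))"
| "tr (AppX f a) n = App (tr f n) (tr a n)"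
| "tr (SigX A B) n = Sig (tr A n) (tr B (Suc n))"
| "tr (PairX T a b) n = MkPair (tr a n) (tr b n)"
| "tr (IndSigX A B C d p) n = IndSig (tr C (Suc n)) (tr d (Suc (Suc n))) (tr p n)"
| "tr (PathX A a b) n = Path (tr A n) (tr a n) (tr b n)"
| "tr (ReflX a) n = Refl (tr a n)"
| "tr (JX A C d a b p) n = J (tr C (Suc (Suc n))) (tr d n) (tr a n) (tr b n) (tr p n)"
| "tr (PushX S A B u v) n = Pushout (tr S n) (tr A n) (tr B n) (tr u n) (tr v n)"
| "tr (InlX T a) n = PInl (tr a n)"
| "tr (InrX T a) n = PInr (tr a n)"
| "tr (GlueX T a) n = Glue (tr a n)"
| "tr (IndPushX T C l r s e) n = IndPush (tr C (Suc n)) (tr l (Suc n)) (tr r (Suc n)) (tr s (Suc n)) (tr e n)"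
| "tr (GlueCompX T C l r s e) n = GlueComp (tr C (Suc n)) (tr l (Suc n)) (tr r (Suc n)) (tr s (Suc n)) (tr e n)"
| "tr (K d ts) n = sub (env n (map (\<lambda>f. f n) (map tr ts))) (trd d)"
| "trd (Decl nm ps T b ab io rl) = trb b (length ps)"
| "trb (Prim t) m = t"
| "trb (Def t) m = tr t m"

text \<open>Neither \<open>lift\<close> nor \<open>xsub\<close> enters the declaration inside
  \<open>K\<close>, so the other two predicates of the mutual induction are trivial.\<close>

lemma xt_induct [case_names V U TY PiX LamX AppX SigX PairX IndSigX PathX ReflX JX PushX InlX InrX
    GlueX IndPushX GlueCompX K]:
  assumes "\<And>i. P (V i)" "P U" "P TY"
    "\<And>A B. P A \<Longrightarrow> P B \<Longrightarrow> P (PiX A B)"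
    "\<And>A b. P A \<Longrightarrow> P b \<Longrightarrow> P (LamX A b)"
    "\<And>f a. P f \<Longrightarrow> P a \<Longrightarrow> P (AppX f a)"
    "\<And>A B. P A \<Longrightarrow> P B \<Longrightarrow> P (SigX A B)"
    "\<And>T a b. P T \<Longrightarrow> P a \<Longrightarrow> P b \<Longrightarrow> P (PairX T a b)"
    "\<And>A B C d p. P A \<Longrightarrow> P B \<Longrightarrow> P C \<Longrightarrow> P d \<Longrightarrow> P p \<Longrightarrow> P (IndSigX A B C d p)"
    "\<And>A a b. P A \<Longrightarrow> P a \<Longrightarrow> P b \<Longrightarrow> P (PathX A a b)"
    "\<And>a. P a \<Longrightarrow> P (ReflX a)"
    "\<And>A C d a b p. P A \<Longrightarrow> P C \<Longrightarrow> P d \<Longrightarrow> P a \<Longrightarrow> P b \<Longrightarrow> P p \<Longrightarrow> P (JX A C d a b p)"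
    "\<And>S A B u v. P S \<Longrightarrow> P A \<Longrightarrow> P B \<Longrightarrow> P u \<Longrightarrow> P v \<Longrightarrow> P (PushX S A B u v)"
    "\<And>T a. P T \<Longrightarrow> P a \<Longrightarrow> P (InlX T a)"
    "\<And>T a. P T \<Longrightarrow> P a \<Longrightarrow> P (InrX T a)"
    "\<And>T a. P T \<Longrightarrow> P a \<Longrightarrow> P (GlueX T a)"
    "\<And>T C l r s e. P T \<Longrightarrow> P C \<Longrightarrow> P l \<Longrightarrow> P r \<Longrightarrow> P s \<Longrightarrow> P e \<Longrightarrow> P (IndPushX T C l r s e)"
    "\<And>T C l r s e. P T \<Longrightarrow> P C \<Longrightarrow> P l \<Longrightarrow> P r \<Longrightarrow> P s \<Longrightarrow> P e \<Longrightarrow> P (GlueCompX T C l r s e)"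
    "\<And>d ts. (\<And>t. t \<in> set ts \<Longrightarrow> P t) \<Longrightarrow> P (K d ts)"
  shows "P t"
  by (rule xt.induct[of P "\<lambda>_. True" "\<lambda>_. True"]) (rule TrueI | rule assms; assumption)+

lemma upr_if: "upr (\<lambda>i. if i < c then i else i + k) = (\<lambda>i. if i < Suc c then i else i + k)"
  by (auto simp: upr_def split: nat.split)

text \<open>The side condition puts the inserted block inside the \<open>n\<close> local variables.
  The references of a body to \<open>base\<close> then lie above the cutoff \<open>c\<close> and are
  shifted along with everything else.\<close>

lemma tr_lift:
  "c + k \<le> n \<Longrightarrow> tr (lift k c t) n = ren (\<lambda>i. if i < c then i else i + k) (tr t (n - k))"
proof (induction t arbitrary: c n rule: xt_induct)
  case (K d ts)
  then show ?case
    by (auto simp: ren_sub env_def intro!: arg_cong[where f="\<lambda>\<sigma>. sub \<sigma> _"])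
qed (simp_all add: upr_if Suc_diff_le)

definition sbs :: "nat \<Rightarrow> nat \<Rightarrow> tm list \<Rightarrow> nat \<Rightarrow> tm" where
  "sbs c e us i = (if i < c then Var i else if i - c < length us then wk c (us ! (i - c))
     else Var (i - length us + e))"

lemma wk_wk: "wk j (wk k t) = wk (j + k) t"
  by (simp add: wk_def ren_ren ac_simps)

lemma up_sbs: "up (sbs c e us) = sbs (Suc c) e us"
proof
  fix i show "up (sbs c e us) i = sbs (Suc c) e us i"
    by (cases i) (auto simp: up_Suc sbs_def wk_wk, auto simp: wk_def)
qed

lemma tr_xsub:
  "e + c \<le> p \<Longrightarrow> tr (xsub c e us t) p
     = sub (sbs c e (map (\<lambda>u. tr u (p - c)) us)) (tr t (p - e + length us))"
proof (induction t arbitrary: c p rule: xt_induct)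
  case (V i)
  then show ?case by (auto simp: sbs_def tr_lift wk_def)
next
  case (K d ts)
  then show ?case
    by (auto simp: sub_sub env_def sbs_def intro!: arg_cong[where f="\<lambda>\<sigma>. sub \<sigma> _"] ext)
qed (simp_all add: up_sbs Suc_diff_le)

section \<open>A normalising type checker\<close>

primrec dname where "dname (Decl nm ps T b ab io rl) = nm"
primrec dpar where "dpar (Decl nm ps T b ab io rl) = ps"
primrec dar where "dar (Decl nm ps T b ab io rl) = length ps"
primrec dty where "dty (Decl nm ps T b ab io rl) = T"
primrec dbd where "dbd (Decl nm ps T b ab io rl) = (case b of Prim _ \<Rightarrow> TY | Def t \<Rightarrow> t)"
primrec dab where "dab (Decl nm ps T b ab io rl) = (case b of Prim _ \<Rightarrow> False | Def _ \<Rightarrow> ab)"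
primrec diota where "diota (Decl nm ps T b ab io rl) = (case b of Prim _ \<Rightarrow> False | Def _ \<Rightarrow> io)"
primrec drules where "drules (Decl nm ps T b ab io rl) = rl"

text \<open>
  Unfolding leaves the erasure unchanged, so conversion by \<open>unf\<close> is syntactic equality of raw terms
  and needs no typing.  Annotations are replaced by \<open>U\<close> since they are erased anyway.
\<close>

primrec unf :: "xt \<Rightarrow> nat \<Rightarrow> xt" and unfd :: "decl \<Rightarrow> xt" and unfb :: "dbody \<Rightarrow> nat \<Rightarrow> xt" where
  "unf (V i) n = V i"
| "unf U n = U"
| "unf TY n = TY"
| "unf (PiX A B) n = PiX (unf A n) (unf B (Suc n))"
| "unf (LamX A b) n = LamX (unf A n) (unf b (Suc n))"
| "unf (AppX f a) n = AppX (unf f n) (unf a n)"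
| "unf (SigX A B) n = SigX (unf A n) (unf B (Suc n))"
| "unf (PairX T a b) n = PairX U (unf a n) (unf b n)"
| "unf (IndSigX A B C d p) n = IndSigX U U (unf C (Suc n)) (unf d (Suc (Suc n))) (unf p n)"
| "unf (PathX A a b) n = PathX (unf A n) (unf a n) (unf b n)"
| "unf (ReflX a) n = ReflX (unf a n)"
| "unf (JX A C d a b p) n = JX U (unf C (Suc (Suc n))) (unf d n) (unf a n) (unf b n) (unf p n)"
| "unf (PushX S A B u v) n = PushX (unf S n) (unf A n) (unf B n) (unf u n) (unf v n)"
| "unf (InlX T a) n = InlX U (unf a n)"
| "unf (InrX T a) n = InrX U (unf a n)"
| "unf (GlueX T a) n = GlueX U (unf a n)"
| "unf (IndPushX T C l r s e) n = IndPushX U (unf C (Suc n)) (unf l (Suc n)) (unf r (Suc n)) (unf s (Suc n)) (unf e n)"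
| "unf (GlueCompX T C l r s e) n = GlueCompX U (unf C (Suc n)) (unf l (Suc n)) (unf r (Suc n)) (unf s (Suc n)) (unf e n)"
| "unf (K d ts) n = (if dab d then
       if length ts = dar d then xsub 0 n (map (\<lambda>f. f n) (map unf ts)) (unfd d) else K d ts
     else K d (map (\<lambda>f. f n) (map unf ts)))"
| "unfd (Decl nm ps T b ab io rl) = unfb b (length ps)"
| "unfb (Prim t) m = TY"
| "unfb (Def t) m = unf t m"

text \<open>Unfolding at the head only: a rule needs to see the outermost type former, while the
  components keep their short folded form.\<close>

primrec expo :: "xt \<Rightarrow> nat \<Rightarrow> xt" and expod :: "decl \<Rightarrow> xt" and expob :: "dbody \<Rightarrow> nat \<Rightarrow> xt" where
  "expo (V i) n = V i"
| "expo U n = U"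
| "expo TY n = TY"
| "expo (PiX A B) n = PiX A B"
| "expo (LamX A b) n = LamX A b"
| "expo (AppX f a) n = AppX f a"
| "expo (SigX A B) n = SigX A B"
| "expo (PairX T a b) n = PairX T a b"
| "expo (IndSigX A B C d p) n = IndSigX A B C d p"
| "expo (PathX A a b) n = PathX A a b"
| "expo (ReflX a) n = ReflX a"
| "expo (JX A C d a b p) n = JX A C d a b p"
| "expo (PushX S A B u v) n = PushX S A B u v"
| "expo (InlX T a) n = InlX T a"
| "expo (InrX T a) n = InrX T a"
| "expo (GlueX T a) n = GlueX T a"
| "expo (IndPushX T C l r s e) n = IndPushX T C l r s e"
| "expo (GlueCompX T C l r s e) n = GlueCompX T C l r s e"
| "expo (K d ts) n = (if dab d then if length ts = dar d then xsub 0 n ts (expod d) else K d ts else K d ts)"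
| "expod (Decl nm ps T b ab io rl) = expob b (length ps)"
| "expob (Prim t) m = TY"
| "expob (Def t) m = expo t m"

definition conv :: "nat \<Rightarrow> xt \<Rightarrow> xt \<Rightarrow> bool" where
  "conv n T T' = (if T = T' then True else unf T n = unf T' n)"

text \<open>Shapes at which an eliminator has a judgemental computation rule. \<open>GlueX\<close>
  is not among them, because computation on it is only a path.\<close>

fun view :: "xt \<Rightarrow> (nat \<times> xt list) option" where
  "view (PairX T a b) = Some (0, [b, a])"
| "view (InlX T a) = Some (1, [a])"
| "view (InrX T a) = Some (2, [a])"
| "view (ReflX a) = Some (3, [a])"
| "view (V i) = None"
| "view U = None"
| "view TY = None"
| "view (PiX A B) = None"
| "view (LamX A b) = None"
| "view (AppX f a) = None"
| "view (SigX A B) = None"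
| "view (IndSigX A B C d p) = None"
| "view (PathX A a b) = None"
| "view (JX A C d a b p) = None"
| "view (PushX S A B u v) = None"
| "view (GlueX T a) = None"
| "view (IndPushX T C l r s e) = None"
| "view (GlueCompX T C l r s e) = None"
| "view (K d ts) = None"

definition canon :: "xt \<Rightarrow> bool" where "canon t = (case view t of None \<Rightarrow> False | Some _ \<Rightarrow> True)"

fun is_lam where "is_lam (LamX A b) = True" | "is_lam _ = False"

text \<open>A conjunction whose second argument is not evaluated when the first is false.\<close>

definition both :: "bool \<Rightarrow> bool \<Rightarrow> bool" where "both p q = (if p then q else False)"

fun canon_hd where "canon_hd [] = False" | "canon_hd (t # ts) = canon t"

text \<open>A pure optimisation: when the test succeeds, \<open>rnorm\<close> returns its input
  unchanged. Soundness therefore needs no property of this function.\<close>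

primrec nored :: "xt \<Rightarrow> bool" where
  "nored (V i) = True"
| "nored U = True"
| "nored TY = True"
| "nored (PiX A B) = (if nored A then nored B else False)"
| "nored (LamX A b) = (if nored A then nored b else False)"
| "nored (AppX f a) = (if is_lam f then False else if nored f then nored a else False)"
| "nored (SigX A B) = (if nored A then nored B else False)"
| "nored (PairX T a b) = (if nored T then if nored a then nored b else False else False)"
| "nored (IndSigX A B C d p) = (if canon p then False else if nored A then if nored B then
     if nored C then if nored d then nored p else False else False else False else False)"
| "nored (PathX A a b) = (if nored A then if nored a then nored b else False else False)"
| "nored (ReflX a) = nored a"
| "nored (JX A C d a b p) = (if canon p then False else if nored A then if nored C then if nored d then
     if nored a then if nored b then nored p else False else False else False else False else False)"
| "nored (PushX S A B u v) = (if nored S then if nored A then if nored B then if nored u then nored v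
      else False else False else False else False)"
| "nored (InlX T a) = (if nored T then nored a else False)"
| "nored (InrX T a) = (if nored T then nored a else False)"
| "nored (GlueX T a) = (if nored T then nored a else False)"
| "nored (IndPushX T C l r s e) = (if canon e then False else if nored T then if nored C then
     if nored l then if nored r then if nored s then nored e
      else False else False else False else False else False)"
| "nored (GlueCompX T C l r s e) = (if nored T then if nored C then
     if nored l then if nored r then if nored s then nored e
      else False else False else False else False else False)"
| "nored (K d ts) = (if diota d then if canon_hd ts then False else list_all (\<lambda>b. b) (map nored ts)
     else list_all (\<lambda>b. b) (map nored ts))"

type_synonym checker = "xt list \<Rightarrow> xt \<Rightarrow> (xt \<times> xt) option"

definition rty :: "checker \<Rightarrow> xt list \<Rightarrow> xt \<Rightarrow> (xt \<times> xt) option" where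
  "rty r \<Gamma> A = Option.bind (r \<Gamma> A) (\<lambda>(A', s). if s = U then Some (A', U) else if s = TY then Some (A', TY) else None)"

definition rck :: "checker \<Rightarrow> xt list \<Rightarrow> xt \<Rightarrow> xt \<Rightarrow> xt option" where
  "rck r \<Gamma> t T = Option.bind (r \<Gamma> t) (\<lambda>(t', T'). if T' = TY then None else if conv (length \<Gamma>) T' T then Some t' else None)"

definition rnorm :: "checker \<Rightarrow> xt list \<Rightarrow> xt \<Rightarrow> xt option" where
  "rnorm r \<Gamma> T = (if nored T then Some T else Option.bind (rty r \<Gamma> T) (\<lambda>(T', s). Some T'))"

definition reval :: "checker \<Rightarrow> xt list \<Rightarrow> xt \<Rightarrow> xt \<Rightarrow> (xt \<times> xt) option" where
  "reval r \<Gamma> t T = Option.bind (rck r \<Gamma> t T) (\<lambda>t'. Some (t', T))"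

text \<open>Telescopes are listed innermost first, so the tail is checked before the head and its
  normalised instance is substituted into the type of the head. The accumulator \<open>us\<close> is
  an instance of an outer telescope that has been checked already.\<close>

primrec ckt :: "checker \<Rightarrow> xt list \<Rightarrow> xt list \<Rightarrow> xt list \<Rightarrow> xt list \<Rightarrow> xt list option" where
  "ckt r \<Gamma> [] ts us = (case ts of [] \<Rightarrow> Some us | _ # _ \<Rightarrow> None)"
| "ckt r \<Gamma> (P # Ps) ts us = (case ts of [] \<Rightarrow> None | t # ts' \<Rightarrow>
     Option.bind (ckt r \<Gamma> Ps ts' us) (\<lambda>ss.
     Option.bind (rnorm r \<Gamma> (xsub 0 (length \<Gamma>) ss P)) (\<lambda>N.
     Option.bind (rck r \<Gamma> t N) (\<lambda>t'. Some (t' # ss)))))"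

definition inst1 :: "xt \<Rightarrow> xt \<Rightarrow> xt" where "inst1 a t = xsub 0 0 [a] t"

definition glueBranch :: "xt \<Rightarrow> xt \<Rightarrow> xt \<Rightarrow> xt \<Rightarrow> xt \<Rightarrow> xt \<Rightarrow> xt" where
  "glueBranch T u v C l r =
     PathX (xsub 0 1 [InrX (lift 1 0 T) (AppX (lift 1 0 v) (V 0))] C)
       (JX (lift 1 0 T) (lift 1 0 (lift 1 1 C)) (xsub 0 1 [AppX (lift 1 0 u) (V 0)] l)
         (InlX (lift 1 0 T) (AppX (lift 1 0 u) (V 0))) (InrX (lift 1 0 T) (AppX (lift 1 0 v) (V 0)))
         (GlueX (lift 1 0 T) (V 0)))
       (xsub 0 1 [AppX (lift 1 0 v) (V 0)] r)"

definition apdX :: "xt \<Rightarrow> xt \<Rightarrow> xt \<Rightarrow> xt \<Rightarrow> xt \<Rightarrow> xt \<Rightarrow> xt" where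
  "apdX T C F a b p = JX T
     (PathX (lift 1 0 C)
       (JX (lift 2 0 T) (lift 1 0 (lift 2 1 C)) (lift 2 0 (inst1 a F)) (lift 2 0 a) (V 1) (V 0))
       (lift 1 0 F))
     (ReflX (inst1 a F)) a b p"

definition smax :: "xt \<Rightarrow> xt \<Rightarrow> xt" where
  "smax s s' = (if s = U then s' else TY)"

fun look :: "(nat \<times> xt list \<times> xt) list \<Rightarrow> nat \<Rightarrow> (xt list \<times> xt) option" where
  "look [] g = None"
| "look ((h, v) # rl) g = (if h = g then Some v else look rl g)"

text \<open>
  The hypotheses of the theorem, from the outside in: \<open>A\<close>, \<open>B\<close>, \<open>X\<close>, \<open>f\<close>, \<open>g\<close>, \<open>x\<close>.
\<close>

definition base :: ctx where
  "base = [Var 2, Arr (Var 2) (Var 1), Arr (Var 2) (Var 0), Univ, Univ, Univ]"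

primrec trc :: "xt list \<Rightarrow> ctx" where
  "trc [] = base"
| "trc (A # \<Gamma>) = tr A (length \<Gamma>) # trc \<Gamma>"

definition pat :: "nat \<Rightarrow> xt" where
  "pat g = (if g = 0 then PairX U (V 1) (V 0) else if g = 1 then InlX U (V 0)
     else if g = 2 then InrX U (V 0) else ReflX (V 0))"

text \<open>Arguments on the left of a computation rule: the canonical form built from its
  \<open>m\<close> components, then the remaining \<open>k\<close> parameters as variables beyond
  those components.\<close>

definition lhs :: "nat \<Rightarrow> nat \<Rightarrow> nat \<Rightarrow> xt list" where
  "lhs g m k = pat g # map (\<lambda>i. V (m + i)) [0..<k]"

text \<open>In the context the components of the canonical form replace the last parameter. The
  contractum is on the left, in agreement with the orientation of results of the checker.\<close>

definition valid_rule :: "decl \<Rightarrow> nat \<Rightarrow> xt list \<Rightarrow> xt \<Rightarrow> bool" where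
  "valid_rule d g ar rhs \<longleftrightarrow> (let us = lhs g (length ar) (length (dpar d) - 1); k = length ar + (length (dpar d) - 1) in
     trc (ar @ tl (dpar d)) \<turnstile> tr rhs k \<doteq> tr (K d us) k \<Ztypecolon> tr (xsub 0 k us (dty d)) k)"

text \<open>
  Validity is a semantic property which the checker does not compute: it is rewritten to \<open>True\<close> by
  the theorems about the individual constants, so that a constant can only be used after it has been
  checked.
\<close>

definition valid :: "decl \<Rightarrow> bool" where
  "valid d \<longleftrightarrow> trc (dpar d) \<turnstile> trd d \<Ztypecolon> tr (dty d) (length (dpar d)) \<and>
     (\<forall>g ar rhs. look (drules d) g = Some (ar, rhs) \<longrightarrow> dpar d \<noteq> [] \<and> valid_rule d g ar rhs)"

text \<open>A derived rule leads directly to the contractum and so avoids inferring the unfolded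
  body again. The test \<open>ss = as @ us\<close> demands that the components be normal already;
  they then form an instance of the rule's telescope as they stand.\<close>

definition kfin :: "checker \<Rightarrow> xt list \<Rightarrow> decl \<Rightarrow> xt list \<Rightarrow> xt \<Rightarrow> (xt \<times> xt) option" where
  "kfin r \<Gamma> d ts T = (if diota d then (case ts of [] \<Rightarrow> Some (K d ts, T) | t # us \<Rightarrow>
     (case view t of None \<Rightarrow> Some (K d ts, T) | Some (g, as) \<Rightarrow>
       (case look (drules d) g of
          None \<Rightarrow> reval r \<Gamma> (xsub 0 (length \<Gamma>) ts (dbd d)) T
        | Some (ar, rhs) \<Rightarrow> Option.bind (ckt r \<Gamma> ar as us) (\<lambda>ss.
            if ss = as @ us then reval r \<Gamma> (xsub 0 (length \<Gamma>) ss rhs) T else None)))) else Some (K d ts, T))"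

text \<open>
  One layer of a checker that normalises while it infers: a result \<open>(t', T)\<close> for \<open>t\<close> means that \<open>t'\<close>
  and \<open>t\<close> are judgementally equal at \<open>T\<close>.  No inversion principle for typing (injectivity of \<open>Pi\<close>,
  subject reduction) is available, hence the parts of every redex are inferred again before it is
  contracted.
\<close>

fun step :: "checker \<Rightarrow> checker" where
  "step r \<Gamma> (V i) = (if i < length \<Gamma> then Some (V i, lift (Suc i) 0 (\<Gamma> ! i)) else None)"
| "step r \<Gamma> U = Some (U, TY)"
| "step r \<Gamma> TY = None"
| "step r \<Gamma> (PiX A B) = Option.bind (rty r \<Gamma> A) (\<lambda>(A', s).
     Option.bind (rty r (A' # \<Gamma>) B) (\<lambda>(B', s'). Some (PiX A' B', smax s s')))"
| "step r \<Gamma> (SigX A B) = Option.bind (rty r \<Gamma> A) (\<lambda>(A', s).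
     Option.bind (rty r (A' # \<Gamma>) B) (\<lambda>(B', s'). Some (SigX A' B', smax s s')))"
| "step r \<Gamma> (LamX A b) = Option.bind (rty r \<Gamma> A) (\<lambda>(A', s).
     Option.bind (r (A' # \<Gamma>) b) (\<lambda>(b', B). if B = TY then None else Some (LamX A' b', PiX A' B)))"
| "step r \<Gamma> (AppX f a) = Option.bind (r \<Gamma> f) (\<lambda>(f', F).
     (case expo F (length \<Gamma>) of PiX A B \<Rightarrow>
        Option.bind (rck r \<Gamma> a A) (\<lambda>a'.
        Option.bind (rnorm r \<Gamma> (inst1 a' B)) (\<lambda>T.
        (case f' of LamX A2 b \<Rightarrow>
           Option.bind (rty r \<Gamma> A2) (\<lambda>(A3, s).
           if conv (length \<Gamma>) A2 A then
           Option.bind (rck r (A2 # \<Gamma>) b B) (\<lambda>b'. reval r \<Gamma> (inst1 a' b) T)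
           else None)
         | _ \<Rightarrow> Some (AppX f' a', T))))
      | _ \<Rightarrow> None))"
| "step r \<Gamma> (PairX T a b) = Option.bind (rty r \<Gamma> T) (\<lambda>(T', s).
     (case expo T' (length \<Gamma>) of SigX A B \<Rightarrow>
        Option.bind (rty r \<Gamma> A) (\<lambda>_.
        Option.bind (rty r (A # \<Gamma>) B) (\<lambda>_.
        Option.bind (rck r \<Gamma> a A) (\<lambda>a'.
        Option.bind (rnorm r \<Gamma> (inst1 a' B)) (\<lambda>N.
        Option.bind (rck r \<Gamma> b N) (\<lambda>b'. Some (PairX T' a' b', T'))))))
      | _ \<Rightarrow> None))"
| "step r \<Gamma> (IndSigX A B C d p) = Option.bind (rty r \<Gamma> A) (\<lambda>(A', s1).
     Option.bind (rty r (A' # \<Gamma>) B) (\<lambda>(B', s2).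
     Option.bind (rty r (SigX A' B' # \<Gamma>) C) (\<lambda>(C', s3).
     Option.bind (rnorm r (B' # A' # \<Gamma>) (xsub 0 2 [PairX (lift 2 0 (SigX A' B')) (V 1) (V 0)] C')) (\<lambda>D.
     Option.bind (rck r (B' # A' # \<Gamma>) d D) (\<lambda>d'.
     Option.bind (rck r \<Gamma> p (SigX A' B')) (\<lambda>p'.
     Option.bind (rnorm r \<Gamma> (inst1 p' C')) (\<lambda>T.
     (case p' of PairX T2 a b \<Rightarrow>
        Option.bind (rck r \<Gamma> a A') (\<lambda>_.
        Option.bind (rnorm r \<Gamma> (inst1 a B')) (\<lambda>N.
        Option.bind (rck r \<Gamma> b N) (\<lambda>_. reval r \<Gamma> (xsub 0 0 [b, a] d') T)))
      | _ \<Rightarrow> Some (IndSigX A' B' C' d' p', T)))))))))"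
| "step r \<Gamma> (PathX A a b) = Option.bind (rty r \<Gamma> A) (\<lambda>(A', s).
     Option.bind (rck r \<Gamma> a A') (\<lambda>a'. Option.bind (rck r \<Gamma> b A') (\<lambda>b'. Some (PathX A' a' b', s))))"
| "step r \<Gamma> (ReflX a) = Option.bind (r \<Gamma> a) (\<lambda>(a', A). if A = TY then None else Some (ReflX a', PathX A a' a'))"
| "step r \<Gamma> (JX A C d a b p) = Option.bind (rty r \<Gamma> A) (\<lambda>(A', s).
     Option.bind (rck r \<Gamma> a A') (\<lambda>a'.
     Option.bind (rty r (PathX (lift 1 0 A') (lift 1 0 a') (V 0) # A' # \<Gamma>) C) (\<lambda>(C', s').
     Option.bind (rnorm r \<Gamma> (xsub 0 0 [ReflX a', a'] C')) (\<lambda>D.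
     Option.bind (rck r \<Gamma> d D) (\<lambda>d'.
     Option.bind (rck r \<Gamma> b A') (\<lambda>b'.
     Option.bind (rck r \<Gamma> p (PathX A' a' b')) (\<lambda>p'.
     Option.bind (rnorm r \<Gamma> (xsub 0 0 [p', b'] C')) (\<lambda>T.
     (case p' of ReflX a1 \<Rightarrow>
         if both (conv (length \<Gamma>) a1 a') (conv (length \<Gamma>) b' a') then Some (d', T)
         else Some (JX A' C' d' a' b' p', T)
      | _ \<Rightarrow> Some (JX A' C' d' a' b' p', T))))))))))"
| "step r \<Gamma> (PushX S A B u v) = Option.bind (rck r \<Gamma> S U) (\<lambda>S'.
     Option.bind (rck r \<Gamma> A U) (\<lambda>A'. Option.bind (rck r \<Gamma> B U) (\<lambda>B'.
     Option.bind (rck r \<Gamma> u (PiX S' (lift 1 0 A'))) (\<lambda>u'.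
     Option.bind (rck r \<Gamma> v (PiX S' (lift 1 0 B'))) (\<lambda>v'. Some (PushX S' A' B' u' v', U))))))"
| "step r \<Gamma> (InlX T a) = Option.bind (rck r \<Gamma> T U) (\<lambda>T'.
     (case expo T' (length \<Gamma>) of PushX S A B u v \<Rightarrow>
        Option.bind (rck r \<Gamma> a A) (\<lambda>a'. Some (InlX T' a', T')) | _ \<Rightarrow> None))"
| "step r \<Gamma> (InrX T a) = Option.bind (rck r \<Gamma> T U) (\<lambda>T'.
     (case expo T' (length \<Gamma>) of PushX S A B u v \<Rightarrow>
        Option.bind (rck r \<Gamma> a B) (\<lambda>a'. Some (InrX T' a', T')) | _ \<Rightarrow> None))"
| "step r \<Gamma> (GlueX T a) = Option.bind (rck r \<Gamma> T U) (\<lambda>T'.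
     (case expo T' (length \<Gamma>) of PushX S A B u v \<Rightarrow>
        Option.bind (rck r \<Gamma> a S) (\<lambda>a'.
        Option.bind (rnorm r \<Gamma> (PathX T' (InlX T' (AppX u a')) (InrX T' (AppX v a')))) (\<lambda>R.
          Some (GlueX T' a', R))) | _ \<Rightarrow> None))"
| "step r \<Gamma> (IndPushX T C l rr s e) = Option.bind (rck r \<Gamma> T U) (\<lambda>T'.
     (case expo T' (length \<Gamma>) of PushX S A B u v \<Rightarrow>
        Option.bind (rck r \<Gamma> S U) (\<lambda>S'. Option.bind (rck r \<Gamma> A U) (\<lambda>A'. Option.bind (rck r \<Gamma> B U) (\<lambda>B'.
        Option.bind (rty r (T' # \<Gamma>) C) (\<lambda>(C', s1).
        Option.bind (rnorm r (A # \<Gamma>) (xsub 0 1 [InlX (lift 1 0 T') (V 0)] C')) (\<lambda>L.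
        Option.bind (rck r (A # \<Gamma>) l L) (\<lambda>l'.
        Option.bind (rnorm r (B # \<Gamma>) (xsub 0 1 [InrX (lift 1 0 T') (V 0)] C')) (\<lambda>R.
        Option.bind (rck r (B # \<Gamma>) rr R) (\<lambda>r'.
        Option.bind (rnorm r (S # \<Gamma>) (glueBranch T' u v C' l' r')) (\<lambda>G.
        Option.bind (rck r (S # \<Gamma>) s G) (\<lambda>s'.
        Option.bind (rck r \<Gamma> e T') (\<lambda>e'.
        Option.bind (rnorm r \<Gamma> (inst1 e' C')) (\<lambda>N.
        (case e' of
           InlX T2 a \<Rightarrow> Option.bind (rck r \<Gamma> a A) (\<lambda>_. reval r \<Gamma> (inst1 a l') N)
         | InrX T2 a \<Rightarrow> Option.bind (rck r \<Gamma> a B) (\<lambda>_. reval r \<Gamma> (inst1 a r') N)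
         | _ \<Rightarrow> Some (IndPushX T' C' l' r' s' e', N))))))))))))))
      | _ \<Rightarrow> None))"
| "step r \<Gamma> (GlueCompX T C l rr s c) = Option.bind (rck r \<Gamma> T U) (\<lambda>T'.
     (case expo T' (length \<Gamma>) of PushX S A B u v \<Rightarrow>
        Option.bind (rck r \<Gamma> S U) (\<lambda>S'. Option.bind (rck r \<Gamma> A U) (\<lambda>A'. Option.bind (rck r \<Gamma> B U) (\<lambda>B'.
        Option.bind (rty r (T' # \<Gamma>) C) (\<lambda>(C', s1).
        Option.bind (rnorm r (A # \<Gamma>) (xsub 0 1 [InlX (lift 1 0 T') (V 0)] C')) (\<lambda>L.
        Option.bind (rck r (A # \<Gamma>) l L) (\<lambda>l'.
        Option.bind (rnorm r (B # \<Gamma>) (xsub 0 1 [InrX (lift 1 0 T') (V 0)] C')) (\<lambda>R.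
        Option.bind (rck r (B # \<Gamma>) rr R) (\<lambda>r'.
        Option.bind (rnorm r (S # \<Gamma>) (glueBranch T' u v C' l' r')) (\<lambda>G.
        Option.bind (rck r (S # \<Gamma>) s G) (\<lambda>s'.
        Option.bind (rck r \<Gamma> c S) (\<lambda>c'.
        Option.bind (rnorm r \<Gamma> (PathX (inst1 c' (glueBranch T' u v C' l' r'))
            (apdX T' C' (IndPushX (lift 1 0 T') (lift 1 1 C') (lift 1 1 l') (lift 1 1 r') (lift 1 1 s') (V 0))
              (InlX T' (AppX u c')) (InrX T' (AppX v c')) (GlueX T' c'))
            (inst1 c' s'))) (\<lambda>N. Some (GlueCompX T' C' l' r' s' c', N)))))))))))))
      | _ \<Rightarrow> None))"
| "step r \<Gamma> (K d ts) = (if valid d then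
     Option.bind (ckt r \<Gamma> (dpar d) ts []) (\<lambda>ts'.
     Option.bind (rnorm r \<Gamma> (xsub 0 (length \<Gamma>) ts' (dty d))) (\<lambda>T. kfin r \<Gamma> d ts' T)) else None)"

text \<open>A contractum is not a subterm of its redex, so the recursion is bounded by fuel instead
  of by structure.\<close>

primrec red :: "nat \<Rightarrow> checker" where
  "red 0 = (\<lambda>\<Gamma> t. None)"
| "red (Suc k) = step (red k)"

section \<open>Soundness of the type checker\<close>

lemma wk_0 [simp]: "wk 0 t = t"
  using sub_Var_ren[of "\<lambda>i. i" t] by (simp add: wk_def)

lemma sbs_env: "sbs 0 e us = env e us"
  by (auto simp: sbs_def env_def)

lemma tr_xsub0: "e \<le> p \<Longrightarrow> tr (xsub 0 e us t) p = sub (env e (map (\<lambda>u. tr u p) us)) (tr t (p - e + length us))"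
  by (simp add: tr_xsub sbs_env)

lemma tr_unf_mutual:
  "(\<forall>n. tr (unf t n) n = tr t n) \<and> (dab d \<longrightarrow> tr (unfd d) (dar d) = trd d)
    \<and> (case b of Prim _ \<Rightarrow> True | Def t \<Rightarrow> \<forall>m. tr (unf t m) m = tr t m)"
proof (rule xt_decl_dbody.induct[of "\<lambda>t. \<forall>n. tr (unf t n) n = tr t n"
      "\<lambda>d. dab d \<longrightarrow> tr (unfd d) (dar d) = trd d"
      "\<lambda>b. case b of Prim _ \<Rightarrow> True | Def t \<Rightarrow> \<forall>m. tr (unf t m) m = tr t m"], goal_cases)
  case (19 d ts)
  then show ?case
    by (auto simp: tr_xsub0 intro!: arg_cong[where f="\<lambda>us. sub (env _ us) _"])
next
  case 20
  then show ?case by (auto split: dbody.splits)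
qed simp_all

lemma tr_unf: "tr (unf t n) n = tr t n"
  using tr_unf_mutual by blast

lemma tr_expo_mutual:
  "(\<forall>n. tr (expo t n) n = tr t n) \<and> (dab d \<longrightarrow> tr (expod d) (dar d) = trd d)
    \<and> (case b of Prim _ \<Rightarrow> True | Def t \<Rightarrow> \<forall>m. tr (expo t m) m = tr t m)"
proof (rule xt_decl_dbody.induct[of "\<lambda>t. \<forall>n. tr (expo t n) n = tr t n"
      "\<lambda>d. dab d \<longrightarrow> tr (expod d) (dar d) = trd d"
      "\<lambda>b. case b of Prim _ \<Rightarrow> True | Def t \<Rightarrow> \<forall>m. tr (expo t m) m = tr t m"], goal_cases)
  case (19 d ts)
  then show ?case
    by (auto simp: tr_xsub0 intro!: arg_cong[where f="\<lambda>us. sub (env _ us) _"])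
next
  case 20
  then show ?case by (auto split: dbody.splits)
qed simp_all

lemma tr_expo: "tr (expo t n) n = tr t n"
  using tr_expo_mutual by blast

lemma tr_inst1: "tr (inst1 a B) n = inst 0 (tr a n) (tr B (Suc n))"
  by (auto simp: inst1_def tr_xsub0 inst_def env_def split: nat.split intro!: arg_cong[where f="\<lambda>\<sigma>. sub \<sigma> _"])
lemma tr_xsub_1: "tr (xsub 0 (Suc 0) [t] C) (Suc n) = inst 1 (tr t (Suc n)) (tr C (Suc n))"
  by (auto simp: tr_xsub0 inst_def env_def split: nat.split intro!: arg_cong[where f="\<lambda>\<sigma>. sub \<sigma> _"])
lemma tr_xsub_2: "tr (xsub 0 2 [t] C) (Suc (Suc n)) = inst 2 (tr t (Suc (Suc n))) (tr C (Suc n))"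
  by (auto simp: tr_xsub0 inst_def env_def split: nat.split intro!: arg_cong[where f="\<lambda>\<sigma>. sub \<sigma> _"])
lemma tr_xsub2: "tr (xsub 0 0 [b, a] C) n = inst2 (tr a n) (tr b n) (tr C (Suc (Suc n)))"
  by (auto simp: tr_xsub0 inst2_def env_def split: nat.split intro!: arg_cong[where f="\<lambda>\<sigma>. sub \<sigma> _"])
lemma tr_lift1: "tr (lift (Suc 0) 0 t) (Suc n) = wk 1 (tr t n)"
  by (simp add: tr_lift wk_def)
lemma tr_lift2: "tr (lift 2 0 t) (Suc (Suc n)) = wk 2 (tr t n)"
  by (simp add: tr_lift wk_def)
lemma tr_lift11: "tr (lift (Suc 0) (Suc 0) t) (Suc (Suc n)) = wkb 1 (tr t (Suc n))"
  by (simp add: tr_lift wkb_def upr_def) (auto intro!: arg_cong[where f="\<lambda>\<sigma>. ren \<sigma> _"] split: nat.split)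
lemma tr_lift21: "tr (lift 2 (Suc 0) t) (Suc (Suc (Suc n))) = wkb 2 (tr t (Suc n))"
  by (simp add: tr_lift wkb_def upr_def) (auto intro!: arg_cong[where f="\<lambda>\<sigma>. ren \<sigma> _"] split: nat.split)

lemmas tr_subst = tr_inst1 tr_xsub_1 tr_xsub_2 tr_xsub2 tr_lift1 tr_lift2 tr_lift11 tr_lift21

lemma tr_glueBranch: "tr (glueBranch T u v C l r) (Suc n)
    = GlueBranch (tr u n) (tr v n) (tr C (Suc n)) (tr l (Suc n)) (tr r (Suc n))"
  by (simp add: glueBranch_def GlueBranch_def Let_def transp_def tr_subst)

lemma tr_apdX: "tr (apdX T C F a b p) n = apd (tr C (Suc n)) (tr F (Suc n)) (tr a n) (tr b n) (tr p n)"
  by (simp add: apdX_def apd_def transp_def tr_subst)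

section \<open>Reflexivity of both sides of a judgement, and weakening\<close>

lemma eq_refl_l: "\<Gamma> \<turnstile> a \<doteq> b \<Ztypecolon> A \<Longrightarrow> \<Gamma> \<turnstile> a \<Ztypecolon> A"
  by (blast intro: tm_trans tm_sym)

lemma eq_refl_r: "\<Gamma> \<turnstile> a \<doteq> b \<Ztypecolon> A \<Longrightarrow> \<Gamma> \<turnstile> b \<Ztypecolon> A"
  by (blast intro: tm_trans tm_sym)

lemma ty_refl_l: "\<Gamma> \<turnstile> A \<doteq> B type \<Longrightarrow> \<Gamma> \<turnstile> A type"
  by (blast intro: ty_trans ty_sym)

lemma ty_refl_r: "\<Gamma> \<turnstile> A \<doteq> B type \<Longrightarrow> \<Gamma> \<turnstile> B type"
  by (blast intro: ty_trans ty_sym)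

text \<open>The shape of every reduction step: \<open>l\<close> is the redex with normalised parts,
  \<open>m\<close> its contractum, \<open>t\<close> the normal form of the contractum, and
  \<open>r\<close> the original term.\<close>

lemma tm_join:
  "\<Gamma> \<turnstile> t \<doteq> m \<Ztypecolon> A \<Longrightarrow> \<Gamma> \<turnstile> l \<doteq> m \<Ztypecolon> A \<Longrightarrow> \<Gamma> \<turnstile> l \<doteq> r \<Ztypecolon> A \<Longrightarrow> \<Gamma> \<turnstile> t \<doteq> r \<Ztypecolon> A"
  by (blast intro: tm_trans tm_sym)

lemma wk_as_sub: "wk k t = sub (\<lambda>i. Var (i + k)) t"
  by (simp add: wk_def sub_Var_ren)

text \<open>Weakening is the substitution rule for the shift; this supplies its premise on
  variables.\<close>

lemma weaken_hyp:
  assumes "wf_ctx (B # \<Gamma>)"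
  shows "\<forall>i<length \<Gamma>. B # \<Gamma> \<turnstile> Var (i + 1) \<doteq> Var (i + 1) \<Ztypecolon> sub (\<lambda>i. Var (i + 1)) (wk (Suc i) (\<Gamma> ! i))"
proof (intro allI impI)
  fix i assume "i < length \<Gamma>"
  then have "B # \<Gamma> \<turnstile> Var (Suc i) \<Ztypecolon> wk (Suc (Suc i)) ((B # \<Gamma>) ! Suc i)"
    by (intro var assms) simp
  then show "B # \<Gamma> \<turnstile> Var (i + 1) \<doteq> Var (i + 1) \<Ztypecolon> sub (\<lambda>i. Var (i + 1)) (wk (Suc i) (\<Gamma> ! i))"
    unfolding wk_as_sub[of 1, symmetric] wk_wk by simp
qed

lemma weaken_tm: "\<Gamma> \<turnstile> a \<doteq> b \<Ztypecolon> A \<Longrightarrow> wf_ctx (B # \<Gamma>) \<Longrightarrow> B # \<Gamma> \<turnstile> wk 1 a \<doteq> wk 1 b \<Ztypecolon> wk 1 A"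
  unfolding wk_as_sub by (rule tm_subst) (use weaken_hyp in auto)

lemma weaken_ty: "\<Gamma> \<turnstile> A \<doteq> A' type \<Longrightarrow> wf_ctx (B # \<Gamma>) \<Longrightarrow> B # \<Gamma> \<turnstile> wk 1 A \<doteq> wk 1 A' type"
  unfolding wk_as_sub by (rule ty_subst) (use weaken_hyp in auto)

text \<open>
  The normal form is the left-hand side, because the congruence rules state their types in terms of
  the left-hand side and the inferred types are built from normal forms.
\<close>

definition jd :: "xt list \<Rightarrow> xt \<Rightarrow> xt \<Rightarrow> xt \<Rightarrow> bool" where
  "jd \<Gamma> t' t T \<longleftrightarrow> (if T = TY then trc \<Gamma> \<turnstile> tr t' (length \<Gamma>) \<doteq> tr t (length \<Gamma>) type
     else trc \<Gamma> \<turnstile> tr t' (length \<Gamma>) \<doteq> tr t (length \<Gamma>) \<Ztypecolon> tr T (length \<Gamma>))"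

definition sound :: "checker \<Rightarrow> bool" where
  "sound r \<longleftrightarrow> (\<forall>\<Gamma> t t' T. wf_ctx (trc \<Gamma>) \<longrightarrow> r \<Gamma> t = Some (t', T) \<longrightarrow> jd \<Gamma> t' t T)"

lemma jdI: "trc \<Gamma> \<turnstile> tr t' (length \<Gamma>) \<doteq> tr t (length \<Gamma>) \<Ztypecolon> tr T (length \<Gamma>) \<Longrightarrow> jd \<Gamma> t' t T"
  by (auto simp: jd_def intro: univ_el)

lemma conv_sound: "conv n T T' \<Longrightarrow> tr T n = tr T' n"
  by (metis conv_def tr_unf)

lemma rtyD:
  assumes "rty r \<Gamma> A = Some (A', s)" "sound r" "wf_ctx (trc \<Gamma>)"
  shows "trc \<Gamma> \<turnstile> tr A' (length \<Gamma>) \<doteq> tr A (length \<Gamma>) type" "wf_ctx (trc (A' # \<Gamma>))"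
    "s = U \<Longrightarrow> trc \<Gamma> \<turnstile> tr A' (length \<Gamma>) \<doteq> tr A (length \<Gamma>) \<Ztypecolon> Univ" "s = U \<or> s = TY"
    "wf_ctx (trc (A # \<Gamma>))"
proof -
  from assms(1) have s: "r \<Gamma> A = Some (A', s)" and u: "s = U \<or> s = TY"
    by (auto simp: rty_def bind_eq_Some_conv split: if_splits)
  then have j: "jd \<Gamma> A' A s" using assms by (auto simp: sound_def)
  show "s = U \<or> s = TY" by (fact u)
  show "s = U \<Longrightarrow> trc \<Gamma> \<turnstile> tr A' (length \<Gamma>) \<doteq> tr A (length \<Gamma>) \<Ztypecolon> Univ"
    using j by (auto simp: jd_def)
  show *: "trc \<Gamma> \<turnstile> tr A' (length \<Gamma>) \<doteq> tr A (length \<Gamma>) type"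
    using u j by (auto simp: jd_def intro: univ_el)
  show "wf_ctx (trc (A' # \<Gamma>))" "wf_ctx (trc (A # \<Gamma>))"
    using * by (auto intro: ctx_cons ty_refl_l ty_refl_r)
qed

lemma rckD:
  assumes "rck r \<Gamma> t T = Some t'" "sound r" "wf_ctx (trc \<Gamma>)"
  shows "trc \<Gamma> \<turnstile> tr t' (length \<Gamma>) \<doteq> tr t (length \<Gamma>) \<Ztypecolon> tr T (length \<Gamma>)"
proof -
  from assms(1) obtain T' where "r \<Gamma> t = Some (t', T')" "T' \<noteq> TY" "conv (length \<Gamma>) T' T"
    by (auto simp: rck_def bind_eq_Some_conv split: if_splits)
  moreover from this assms have "jd \<Gamma> t' t T'" unfolding sound_def by blast
  ultimately show ?thesis using conv_sound by (simp add: jd_def)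
qed

text \<open>An equivalence, so that a type and its normal form can be exchanged by
  rewriting.\<close>

lemma rnormD:
  assumes "rnorm r \<Gamma> T = Some N" "sound r" "wf_ctx (trc \<Gamma>)"
  shows "trc \<Gamma> \<turnstile> a \<doteq> b \<Ztypecolon> tr N (length \<Gamma>) \<longleftrightarrow> trc \<Gamma> \<turnstile> a \<doteq> b \<Ztypecolon> tr T (length \<Gamma>)"
proof (cases "nored T")
  case True
  then show ?thesis using assms(1) by (simp add: rnorm_def)
next
  case False
  with assms(1) obtain s where "rty r \<Gamma> T = Some (N, s)"
    by (auto simp: rnorm_def bind_eq_Some_conv)
  from rtyD(1)[OF this assms(2,3)] show ?thesis by (blast intro: conv ty_sym)
qed

lemma revalD:
  assumes "reval r \<Gamma> t T = Some (t', T')" "sound r" "wf_ctx (trc \<Gamma>)"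
  shows "trc \<Gamma> \<turnstile> tr t' (length \<Gamma>) \<doteq> tr t (length \<Gamma>) \<Ztypecolon> tr T (length \<Gamma>)" "T' = T"
  using rckD[OF _ assms(2,3)] assms(1) by (auto simp: reval_def bind_eq_Some_conv)

lemma expo_eq: "expo T n = T' \<Longrightarrow> tr T n = tr T' n"
  using tr_expo by metis

lemma length_trc: "length (trc \<Gamma>) = length \<Gamma> + length base"
  by (induction \<Gamma>) auto

lemma nth_trc:
  "i < length \<Gamma> \<Longrightarrow> trc \<Gamma> ! i = tr (\<Gamma> ! i) (length \<Gamma> - Suc i)"
  "length \<Gamma> \<le> i \<Longrightarrow> trc \<Gamma> ! i = base ! (i - length \<Gamma>)"
  by (induction \<Gamma> arbitrary: i) (auto simp: nth_Cons split: nat.splits)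

lemma step_V:
  assumes "step r \<Gamma> (V i) = Some (t', T)" "wf_ctx (trc \<Gamma>)"
  shows "jd \<Gamma> t' (V i) T"
proof -
  from assms(1) have i: "i < length \<Gamma>" and t: "t' = V i" "T = lift (Suc i) 0 (\<Gamma> ! i)"
    by (auto split: if_splits)
  have "trc \<Gamma> \<turnstile> Var i \<Ztypecolon> wk (Suc i) (trc \<Gamma> ! i)"
    using assms(2) i by (intro var) (auto simp: length_trc)
  then show ?thesis using i by (intro jdI) (simp add: t nth_trc tr_lift wk_def)
qed

lemma case_shape:
  "(case x of PiX A B \<Rightarrow> F A B | _ \<Rightarrow> None) = Some z \<longleftrightarrow> (\<exists>A B. x = PiX A B \<and> F A B = Some z)"
  "(case x of SigX A B \<Rightarrow> F A B | _ \<Rightarrow> None) = Some z \<longleftrightarrow> (\<exists>A B. x = SigX A B \<and> F A B = Some z)"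
  "(case x of PushX S A B u v \<Rightarrow> G S A B u v | _ \<Rightarrow> None) = Some z
     \<longleftrightarrow> (\<exists>S A B u v. x = PushX S A B u v \<and> G S A B u v = Some z)"
  by (cases x; auto)+

lemma step_Pi:
  assumes "step r \<Gamma> (PiX A B) = Some (t', T)" "sound r" "wf_ctx (trc \<Gamma>)"
  shows "jd \<Gamma> t' (PiX A B) T"
proof -
  from assms(1) obtain A' s B' s' where
    A: "rty r \<Gamma> A = Some (A', s)" and B: "rty r (A' # \<Gamma>) B = Some (B', s')"
    and t: "t' = PiX A' B'" "T = smax s s'"
    by (auto simp: bind_eq_Some_conv)
  note A = rtyD[OF A assms(2,3)]
  note B = rtyD[OF B assms(2) A(2)]
  show ?thesis
  proof (cases "T = U")
    case True
    then show ?thesis using A B by (auto simp: t smax_def intro!: jdI pi_univ split: if_splits)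
  next
    case False
    then have "T = TY" using A B by (auto simp: t smax_def)
    then show ?thesis using A B by (auto simp: t jd_def intro!: pi_ty)
  qed
qed

lemma step_Sig:
  assumes "step r \<Gamma> (SigX A B) = Some (t', T)" "sound r" "wf_ctx (trc \<Gamma>)"
  shows "jd \<Gamma> t' (SigX A B) T"
proof -
  from assms(1) obtain A' s B' s' where
    A: "rty r \<Gamma> A = Some (A', s)" and B: "rty r (A' # \<Gamma>) B = Some (B', s')"
    and t: "t' = SigX A' B'" "T = smax s s'"
    by (auto simp: bind_eq_Some_conv)
  note A = rtyD[OF A assms(2,3)]
  note B = rtyD[OF B assms(2) A(2)]
  show ?thesis
  proof (cases "T = U")
    case True
    then show ?thesis using A B by (auto simp: t smax_def intro!: jdI sig_univ split: if_splits)
  next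
    case False
    then have "T = TY" using A B by (auto simp: t smax_def)
    then show ?thesis using A B by (auto simp: t jd_def intro!: sig_ty)
  qed
qed

lemma step_Lam:
  assumes "step r \<Gamma> (LamX A b) = Some (t', T)" "sound r" "wf_ctx (trc \<Gamma>)"
  shows "jd \<Gamma> t' (LamX A b) T"
proof -
  from assms(1) obtain A' s b' B where
    A: "rty r \<Gamma> A = Some (A', s)" and b: "r (A' # \<Gamma>) b = Some (b', B)" "B \<noteq> TY"
    and t: "t' = LamX A' b'" "T = PiX A' B"
    by (auto simp: bind_eq_Some_conv split: if_splits)
  note A = rtyD[OF A assms(2,3)]
  have "jd (A' # \<Gamma>) b' b B" using b A(2) assms(2) by (auto simp: sound_def)
  then show ?thesis using A b(2) by (auto simp: t jd_def intro!: lam)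
qed

lemma step_App:
  assumes "step r \<Gamma> (AppX f a) = Some (t', T)" "sound r" "wf_ctx (trc \<Gamma>)"
  shows "jd \<Gamma> t' (AppX f a) T"
proof -
  let ?n = "length \<Gamma>"
  from assms(1) obtain f' F A B a' N where
    f: "r \<Gamma> f = Some (f', F)" and F: "expo F ?n = PiX A B" and a: "rck r \<Gamma> a A = Some a'"
    and N: "rnorm r \<Gamma> (inst1 a' B) = Some N"
    and c: "(case f' of LamX A2 b \<Rightarrow>
           Option.bind (rty r \<Gamma> A2) (\<lambda>(A3, s).
           if conv (length \<Gamma>) A2 A then
           Option.bind (rck r (A2 # \<Gamma>) b B) (\<lambda>b'. reval r \<Gamma> (inst1 a' b) N)
           else None)
         | _ \<Rightarrow> Some (AppX f' a', N)) = Some (t', T)"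
    by (auto simp: bind_eq_Some_conv case_shape)
  have "jd \<Gamma> f' f F" using f assms by (auto simp: sound_def)
  moreover have "F \<noteq> TY" using F by auto
  ultimately have f: "trc \<Gamma> \<turnstile> tr f' ?n \<doteq> tr f ?n \<Ztypecolon> Pi (tr A ?n) (tr B (Suc ?n))"
    using expo_eq[OF F] by (simp add: jd_def)
  note a = rckD[OF a assms(2,3)]
  note N = rnormD[OF N assms(2,3)]
  have app: "trc \<Gamma> \<turnstile> App (tr f' ?n) (tr a' ?n) \<doteq> App (tr f ?n) (tr a ?n) \<Ztypecolon> tr N ?n"
    using app[OF f a] by (simp add: N tr_subst)
  show ?thesis
  proof (cases "is_lam f'")
    case False
    then have "t' = AppX f' a'" "T = N" using c by (cases f'; simp)+
    then show ?thesis using app by (auto intro!: jdI)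
  next
    case True
    then obtain A2 b where f': "f' = LamX A2 b" by (cases f') auto
    with c obtain A3 s b' where A2: "rty r \<Gamma> A2 = Some (A3, s)" and cv: "conv ?n A2 A"
      and b: "rck r (A2 # \<Gamma>) b B = Some b'" and e: "reval r \<Gamma> (inst1 a' b) N = Some (t', T)"
      by (auto simp: bind_eq_Some_conv split: if_splits)
    note A2 = rtyD[OF A2 assms(2,3)]
    note b = eq_refl_r[OF rckD[OF b assms(2) A2(5)]]
    \<comment> \<open>\<open>pi_beta\<close> needs one and the same domain in the abstraction and
      for the argument. \<open>conv\<close> provides it as an equality of raw terms, where
      injectivity of \<open>Pi\<close> is not at hand.\<close>
    have "trc \<Gamma> \<turnstile> App (Lam (tr A2 ?n) (tr b (Suc ?n))) (tr a' ?n) \<doteq> inst 0 (tr a' ?n) (tr b (Suc ?n))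
        \<Ztypecolon> inst 0 (tr a' ?n) (tr B (Suc ?n))"
      using b eq_refl_l[OF a] conv_sound[OF cv] by (intro pi_beta) auto
    then have b: "trc \<Gamma> \<turnstile> App (tr f' ?n) (tr a' ?n) \<doteq> tr (inst1 a' b) ?n \<Ztypecolon> tr N ?n"
      by (simp add: f' N tr_subst)
    show ?thesis
      using tm_join[OF revalD(1)[OF e assms(2,3)] b app] revalD(2)[OF e assms(2,3)] by (auto intro!: jdI)
  qed
qed

lemma step_Pair:
  assumes "step r \<Gamma> (PairX T0 a b) = Some (t', T)" "sound r" "wf_ctx (trc \<Gamma>)"
  shows "jd \<Gamma> t' (PairX T0 a b) T"
proof -
  let ?n = "length \<Gamma>"
  from assms(1) obtain T' s A B x y a' N b' where
    T: "rty r \<Gamma> T0 = Some (T', s)" and F: "expo T' ?n = SigX A B" and A: "rty r \<Gamma> A = Some x"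
    and B: "rty r (A # \<Gamma>) B = Some y" and a: "rck r \<Gamma> a A = Some a'"
    and N: "rnorm r \<Gamma> (inst1 a' B) = Some N" and b: "rck r \<Gamma> b N = Some b'"
    and t: "t' = PairX T' a' b'" "T = T'"
    by (auto simp: bind_eq_Some_conv case_shape)
  obtain A' s1 B' s2 where x: "x = (A', s1)" "y = (B', s2)" by fastforce
  note A = rtyD[OF A[unfolded x] assms(2,3)]
  note B = ty_refl_r[OF rtyD(1)[OF B[unfolded x] assms(2) A(5)]]
  note a = rckD[OF a assms(2,3)]
  note b = rckD[OF b assms(2,3), unfolded rnormD[OF N assms(2,3)] tr_subst]
  show ?thesis using pair[OF _ a b] B expo_eq[OF F] by (auto intro!: jdI simp: t)
qed

lemma step_Path:
  assumes "step r \<Gamma> (PathX A a b) = Some (t', T)" "sound r" "wf_ctx (trc \<Gamma>)"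
  shows "jd \<Gamma> t' (PathX A a b) T"
proof -
  from assms(1) obtain A' a' b' where A: "rty r \<Gamma> A = Some (A', T)" and a: "rck r \<Gamma> a A' = Some a'"
    and b: "rck r \<Gamma> b A' = Some b'" and t: "t' = PathX A' a' b'"
    by (auto simp: bind_eq_Some_conv)
  note A = rtyD[OF A assms(2,3)]
  note ab = a[THEN rckD, OF assms(2,3)] b[THEN rckD, OF assms(2,3)]
  from A(4) show ?thesis
  proof
    assume "T = U"
    then show ?thesis using A ab by (auto intro!: jdI path_univ simp: t)
  next
    assume "T = TY"
    then show ?thesis using A ab by (auto intro!: path_ty simp: t jd_def)
  qed
qed

lemma step_Refl:
  assumes "step r \<Gamma> (ReflX a) = Some (t', T)" "sound r" "wf_ctx (trc \<Gamma>)"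
  shows "jd \<Gamma> t' (ReflX a) T"
proof -
  from assms(1) obtain a' A where a: "r \<Gamma> a = Some (a', A)" "A \<noteq> TY"
    and t: "t' = ReflX a'" "T = PathX A a' a'"
    by (auto simp: bind_eq_Some_conv split: if_splits)
  have "jd \<Gamma> a' a A" using a assms by (auto simp: sound_def)
  then show ?thesis using a(2) by (auto intro!: jdI refl simp: t jd_def)
qed

lemma step_Push:
  assumes "step r \<Gamma> (PushX S A B u v) = Some (t', T)" "sound r" "wf_ctx (trc \<Gamma>)"
  shows "jd \<Gamma> t' (PushX S A B u v) T"
proof -
  from assms(1) obtain S' A' B' u' v' where h: "rck r \<Gamma> S U = Some S'" "rck r \<Gamma> A U = Some A'"
    "rck r \<Gamma> B U = Some B'" "rck r \<Gamma> u (PiX S' (lift 1 0 A')) = Some u'"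
    "rck r \<Gamma> v (PiX S' (lift 1 0 B')) = Some v'" and t: "t' = PushX S' A' B' u' v'" "T = U"
    by (auto simp: bind_eq_Some_conv)
  note h = h[THEN rckD, OF assms(2,3)]
  show ?thesis unfolding t by (rule jdI) (use h in \<open>auto intro!: push_univ simp: Arr_def tr_subst\<close>)
qed

lemma case_pair: "(case x of PairX T a b \<Rightarrow> F T a b | _ \<Rightarrow> z) = Some y \<Longrightarrow>
   (\<exists>T a b. x = PairX T a b \<and> F T a b = Some y) \<or> z = Some y"
  by (cases x) auto

lemma case_refl: "(case x of ReflX a \<Rightarrow> F a | _ \<Rightarrow> z) = Some y \<Longrightarrow>
   (\<exists>a. x = ReflX a \<and> F a = Some y) \<or> z = Some y"
  by (cases x) auto

lemma case_in: "(case x of InlX T a \<Rightarrow> F T a | InrX T a \<Rightarrow> G T a | _ \<Rightarrow> z) = Some y \<Longrightarrow>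
   (\<exists>T a. x = InlX T a \<and> F T a = Some y) \<or> (\<exists>T a. x = InrX T a \<and> G T a = Some y) \<or> z = Some y"
  by (cases x) auto

lemma step_IndSig:
  assumes "step r \<Gamma> (IndSigX A B C d p) = Some (t', T)" "sound r" "wf_ctx (trc \<Gamma>)"
  shows "jd \<Gamma> t' (IndSigX A B C d p) T"
proof -
  let ?n = "length \<Gamma>"
  from assms(1) obtain A' s1 B' s2 C' s3 D d' p' N where
    A: "rty r \<Gamma> A = Some (A', s1)" and B: "rty r (A' # \<Gamma>) B = Some (B', s2)"
    and C: "rty r (SigX A' B' # \<Gamma>) C = Some (C', s3)"
    and D: "rnorm r (B' # A' # \<Gamma>) (xsub 0 2 [PairX (lift 2 0 (SigX A' B')) (V 1) (V 0)] C') = Some D"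
    and d: "rck r (B' # A' # \<Gamma>) d D = Some d'"
    and p: "rck r \<Gamma> p (SigX A' B') = Some p'"
    and N: "rnorm r \<Gamma> (inst1 p' C') = Some N"
    and c: "(case p' of PairX T2 a b \<Rightarrow>
        Option.bind (rck r \<Gamma> a A') (\<lambda>_.
        Option.bind (rnorm r \<Gamma> (inst1 a B')) (\<lambda>N'.
        Option.bind (rck r \<Gamma> b N') (\<lambda>_. reval r \<Gamma> (xsub 0 0 [b, a] d') N)))
      | _ \<Rightarrow> Some (IndSigX A' B' C' d' p', N)) = Some (t', T)"
    unfolding step.simps by (auto simp only: bind_eq_Some_conv case_prod_conv split_paired_all split_paired_Ex)
  note A = rtyD[OF A assms(2,3)]
  note B = rtyD[OF B assms(2) A(2)]
  have "wf_ctx (trc (SigX A' B' # \<Gamma>))"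
    using ctx_cons[OF sig_ty] A(1) B(1) ty_refl_l by simp
  note C = rtyD[OF C assms(2) this]
  note d = rckD[OF d assms(2) B(2), unfolded rnormD[OF D assms(2) B(2)]]
  note p = rckD[OF p assms(2,3)]
  note N = rnormD[OF N assms(2,3)]
  have ind: "trc \<Gamma> \<turnstile> IndSig (tr C' (Suc ?n)) (tr d' (Suc (Suc ?n))) (tr p' ?n)
      \<doteq> IndSig (tr C (Suc ?n)) (tr d (Suc (Suc ?n))) (tr p ?n) \<Ztypecolon> tr N ?n"
    unfolding N tr_subst using C(1) d p by (intro sig_ind) (auto simp: tr_subst)
  from case_pair[OF c] show ?thesis
  proof (elim disjE exE conjE)
    fix T2 a b
    assume p': "p' = PairX T2 a b" and e: "Option.bind (rck r \<Gamma> a A') (\<lambda>_.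
        Option.bind (rnorm r \<Gamma> (inst1 a B')) (\<lambda>N'.
        Option.bind (rck r \<Gamma> b N') (\<lambda>_. reval r \<Gamma> (xsub 0 0 [b, a] d') N))) = Some (t', T)"
    from e obtain a' N' b' where a: "rck r \<Gamma> a A' = Some a'"
      and N': "rnorm r \<Gamma> (inst1 a B') = Some N'" and b: "rck r \<Gamma> b N' = Some b'"
      and e: "reval r \<Gamma> (xsub 0 0 [b, a] d') N = Some (t', T)"
      by (auto simp: bind_eq_Some_conv)
    note a = eq_refl_r[OF rckD[OF a assms(2,3)]]
    note b = eq_refl_r[OF rckD[OF b assms(2,3), unfolded rnormD[OF N' assms(2,3)] tr_subst]]
    have "trc \<Gamma> \<turnstile> IndSig (tr C' (Suc ?n)) (tr d' (Suc (Suc ?n))) (tr p' ?n)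
        \<doteq> tr (xsub 0 0 [b, a] d') ?n \<Ztypecolon> tr N ?n"
      unfolding N tr_subst using ty_refl_l[OF C(1)] eq_refl_l[OF d] a b
      by (auto simp: p' tr_subst intro!: sig_beta)
    from tm_join[OF revalD(1)[OF e assms(2,3)] this ind] revalD(2)[OF e assms(2,3)]
    show ?thesis by (auto intro!: jdI)
  next
    assume "Some (IndSigX A' B' C' d' p', N) = Some (t', T)"
    with ind show ?thesis by (auto intro!: jdI)
  qed
qed

lemma step_J:
  assumes "step r \<Gamma> (JX A C d a b p) = Some (t', T)" "sound r" "wf_ctx (trc \<Gamma>)"
  shows "jd \<Gamma> t' (JX A C d a b p) T"
proof -
  let ?n = "length \<Gamma>"
  from assms(1) obtain A' s a' C' s' D d' b' p' N where
    A: "rty r \<Gamma> A = Some (A', s)" and a: "rck r \<Gamma> a A' = Some a'"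
    and C: "rty r (PathX (lift 1 0 A') (lift 1 0 a') (V 0) # A' # \<Gamma>) C = Some (C', s')"
    and D: "rnorm r \<Gamma> (xsub 0 0 [ReflX a', a'] C') = Some D"
    and d: "rck r \<Gamma> d D = Some d'" and b: "rck r \<Gamma> b A' = Some b'"
    and p: "rck r \<Gamma> p (PathX A' a' b') = Some p'"
    and N: "rnorm r \<Gamma> (xsub 0 0 [p', b'] C') = Some N"
    and c: "(case p' of ReflX a1 \<Rightarrow>
         if both (conv (length \<Gamma>) a1 a') (conv (length \<Gamma>) b' a') then Some (d', N)
         else Some (JX A' C' d' a' b' p', N)
      | _ \<Rightarrow> Some (JX A' C' d' a' b' p', N)) = Some (t', T)"
    unfolding step.simps by (auto simp only: bind_eq_Some_conv case_prod_conv split_paired_all split_paired_Ex)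
  note A = rtyD[OF A assms(2,3)]
  note a = rckD[OF a assms(2,3)] and b = rckD[OF b assms(2,3)] and p = rckD[OF p assms(2,3)]
  have "trc (A' # \<Gamma>) \<turnstile> Path (wk 1 (tr A' ?n)) (wk 1 (tr a' ?n)) (Var 0) type"
  proof (rule path_ty)
    show "trc (A' # \<Gamma>) \<turnstile> wk 1 (tr A' ?n) type"
      using weaken_ty[OF ty_refl_l[OF A(1)]] A(2) by simp
    show "trc (A' # \<Gamma>) \<turnstile> wk 1 (tr a' ?n) \<Ztypecolon> wk 1 (tr A' ?n)"
      using weaken_tm[OF eq_refl_l[OF a]] A(2) by simp
    show "trc (A' # \<Gamma>) \<turnstile> Var 0 \<Ztypecolon> wk 1 (tr A' ?n)"
      using var[OF A(2), of 0] by simp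
  qed
  then have "wf_ctx (trc (PathX (lift 1 0 A') (lift 1 0 a') (V 0) # A' # \<Gamma>))"
    by (auto intro: ctx_cons simp: tr_subst)
  note C = rtyD(1)[OF C assms(2) this]
  note d = rckD[OF d assms(2,3), unfolded rnormD[OF D assms(2,3)]]
  note N = rnormD[OF N assms(2,3)]
  have ind: "trc \<Gamma> \<turnstile> J (tr C' (Suc (Suc ?n))) (tr d' ?n) (tr a' ?n) (tr b' ?n) (tr p' ?n)
     \<doteq> J (tr C (Suc (Suc ?n))) (tr d ?n) (tr a ?n) (tr b ?n) (tr p ?n) \<Ztypecolon> tr N ?n"
    unfolding N tr_subst using a C d b p by (intro path_ind) (auto simp: tr_subst)
  from case_refl[OF c] show ?thesis
  proof (elim disjE exE conjE)
    fix a1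
    assume p': "p' = ReflX a1" and e: "(if both (conv (length \<Gamma>) a1 a') (conv (length \<Gamma>) b' a') then Some (d', N)
         else Some (JX A' C' d' a' b' p', N)) = Some (t', T)"
    show ?thesis
    proof (cases "both (conv (length \<Gamma>) a1 a') (conv (length \<Gamma>) b' a')")
      case True
      \<comment> \<open>After erasure the path is reflexivity at the very base point
        \<open>a'\<close>, and the end point is \<open>a'\<close> as well, so the type of
        \<open>path_beta\<close> is literally the one required.\<close>
      then have eq: "tr a1 ?n = tr a' ?n" "tr b' ?n = tr a' ?n"
        by (auto simp: both_def dest: conv_sound split: if_splits)
      have "trc \<Gamma> \<turnstile> J (tr C' (Suc (Suc ?n))) (tr d' ?n) (tr a' ?n) (tr b' ?n) (tr p' ?n) \<doteq> tr d' ?n \<Ztypecolon> tr N ?n"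
        unfolding N tr_subst using eq_refl_l[OF a] ty_refl_l[OF C] eq_refl_l[OF d]
        by (auto simp: eq p' tr_subst intro!: path_beta)
      from tm_trans[OF tm_sym[OF this] ind] e True show ?thesis by (auto intro!: jdI)
    qed (use e ind in \<open>auto intro!: jdI\<close>)
  qed (use ind in \<open>auto intro!: jdI\<close>)
qed

lemma step_Inl:
  assumes "step r \<Gamma> (InlX T0 a) = Some (t', T)" "sound r" "wf_ctx (trc \<Gamma>)"
  shows "jd \<Gamma> t' (InlX T0 a) T"
proof -
  from assms(1) obtain T' S A B u v a' where T: "rck r \<Gamma> T0 U = Some T'"
    and e: "expo T' (length \<Gamma>) = PushX S A B u v" and a: "rck r \<Gamma> a A = Some a'"
    and t: "t' = InlX T' a'" "T = T'"
    by (auto simp: bind_eq_Some_conv case_shape)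
  show ?thesis unfolding t
    using push_inl[OF _ rckD[OF a assms(2,3)]] eq_refl_l[OF rckD[OF T assms(2,3)]] expo_eq[OF e]
    by (intro jdI) simp
qed

lemma step_Inr:
  assumes "step r \<Gamma> (InrX T0 a) = Some (t', T)" "sound r" "wf_ctx (trc \<Gamma>)"
  shows "jd \<Gamma> t' (InrX T0 a) T"
proof -
  from assms(1) obtain T' S A B u v a' where T: "rck r \<Gamma> T0 U = Some T'"
    and e: "expo T' (length \<Gamma>) = PushX S A B u v" and a: "rck r \<Gamma> a B = Some a'"
    and t: "t' = InrX T' a'" "T = T'"
    by (auto simp: bind_eq_Some_conv case_shape)
  show ?thesis unfolding t
    using push_inr[OF _ rckD[OF a assms(2,3)]] eq_refl_l[OF rckD[OF T assms(2,3)]] expo_eq[OF e]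
    by (intro jdI) simp
qed

lemma step_Glue:
  assumes "step r \<Gamma> (GlueX T0 a) = Some (t', T)" "sound r" "wf_ctx (trc \<Gamma>)"
  shows "jd \<Gamma> t' (GlueX T0 a) T"
proof -
  from assms(1) obtain T' S A B u v a' R where T: "rck r \<Gamma> T0 U = Some T'"
    and e: "expo T' (length \<Gamma>) = PushX S A B u v" and a: "rck r \<Gamma> a S = Some a'"
    and R: "rnorm r \<Gamma> (PathX T' (InlX T' (AppX u a')) (InrX T' (AppX v a'))) = Some R"
    and t: "t' = GlueX T' a'" "T = R"
    by (auto simp: bind_eq_Some_conv case_shape)
  show ?thesis unfolding t
    using push_glue[OF _ rckD[OF a assms(2,3)]] eq_refl_l[OF rckD[OF T assms(2,3)]] expo_eq[OF e]
    by (intro jdI) (simp add: rnormD[OF R assms(2,3)])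
qed

text \<open>Shared by the eliminator and its path of computation. The components \<open>S\<close>,
  \<open>A\<close>, \<open>B\<close> exposed in \<open>T'\<close> are checked separately because no
  inversion yields their typing from that of the pushout; the branches live over these components
  themselves, not over their normal forms.\<close>

lemma pushout_branches:
  assumes "sound r" "wf_ctx (trc \<Gamma>)"
    and "rck r \<Gamma> T U = Some T'" and e: "expo T' (length \<Gamma>) = PushX S A B u v"
    and "rck r \<Gamma> S U = Some S'" "rck r \<Gamma> A U = Some A'" "rck r \<Gamma> B U = Some B'"
    and C: "rty r (T' # \<Gamma>) C = Some (C', s1)"
    and L: "rnorm r (A # \<Gamma>) (xsub 0 1 [InlX (lift 1 0 T') (V 0)] C') = Some L"
    and l: "rck r (A # \<Gamma>) l L = Some l'"
    and R: "rnorm r (B # \<Gamma>) (xsub 0 1 [InrX (lift 1 0 T') (V 0)] C') = Some R"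
    and rr: "rck r (B # \<Gamma>) rr R = Some r'"
    and G: "rnorm r (S # \<Gamma>) (glueBranch T' u v C' l' r') = Some G"
    and s: "rck r (S # \<Gamma>) s G = Some s'"
  defines "n \<equiv> length \<Gamma>"
  shows "tr T' n = Pushout (tr S n) (tr A n) (tr B n) (tr u n) (tr v n)"
    "Pushout (tr S n) (tr A n) (tr B n) (tr u n) (tr v n) # trc \<Gamma> \<turnstile> tr C' (Suc n) \<doteq> tr C (Suc n) type"
    "tr A n # trc \<Gamma> \<turnstile> tr l' (Suc n) \<doteq> tr l (Suc n) \<Ztypecolon> inst 1 (PInl (Var 0)) (tr C' (Suc n))"
    "tr B n # trc \<Gamma> \<turnstile> tr r' (Suc n) \<doteq> tr rr (Suc n) \<Ztypecolon> inst 1 (PInr (Var 0)) (tr C' (Suc n))"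
    "tr S n # trc \<Gamma> \<turnstile> tr s' (Suc n) \<doteq> tr s (Suc n)
       \<Ztypecolon> GlueBranch (tr u n) (tr v n) (tr C' (Suc n)) (tr l' (Suc n)) (tr r' (Suc n))"
proof -
  note h = assms(3,5-7)[THEN rckD, OF assms(1,2)]
  have wf: "wf_ctx (trc (T' # \<Gamma>))" "wf_ctx (trc (S # \<Gamma>))" "wf_ctx (trc (A # \<Gamma>))" "wf_ctx (trc (B # \<Gamma>))"
    using h[THEN eq_refl_l] h[THEN eq_refl_r] by (auto intro!: ctx_cons univ_el)
  show T: "tr T' n = Pushout (tr S n) (tr A n) (tr B n) (tr u n) (tr v n)"
    using expo_eq[OF e] by (simp add: n_def)
  show "Pushout (tr S n) (tr A n) (tr B n) (tr u n) (tr v n) # trc \<Gamma> \<turnstile> tr C' (Suc n) \<doteq> tr C (Suc n) type"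
    using rtyD(1)[OF C assms(1) wf(1)] T by (simp add: n_def)
  show "tr A n # trc \<Gamma> \<turnstile> tr l' (Suc n) \<doteq> tr l (Suc n) \<Ztypecolon> inst 1 (PInl (Var 0)) (tr C' (Suc n))"
    using rckD[OF l assms(1) wf(3), unfolded rnormD[OF L assms(1) wf(3)]] by (simp add: n_def tr_subst)
  show "tr B n # trc \<Gamma> \<turnstile> tr r' (Suc n) \<doteq> tr rr (Suc n) \<Ztypecolon> inst 1 (PInr (Var 0)) (tr C' (Suc n))"
    using rckD[OF rr assms(1) wf(4), unfolded rnormD[OF R assms(1) wf(4)]] by (simp add: n_def tr_subst)
  show "tr S n # trc \<Gamma> \<turnstile> tr s' (Suc n) \<doteq> tr s (Suc n)
       \<Ztypecolon> GlueBranch (tr u n) (tr v n) (tr C' (Suc n)) (tr l' (Suc n)) (tr r' (Suc n))"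
    using rckD[OF s assms(1) wf(2), unfolded rnormD[OF G assms(1) wf(2)]] by (simp add: n_def tr_glueBranch)
qed

lemma step_IndPush:
  assumes "step r \<Gamma> (IndPushX T0 C l rr s e) = Some (t', T)" "sound r" "wf_ctx (trc \<Gamma>)"
  shows "jd \<Gamma> t' (IndPushX T0 C l rr s e) T"
proof -
  let ?n = "length \<Gamma>"
  from assms(1) obtain T' S A B u v S' A' B' C' s1 L l' R r' G s' e' N where
    h: "rck r \<Gamma> T0 U = Some T'" "expo T' (length \<Gamma>) = PushX S A B u v"
    "rck r \<Gamma> S U = Some S'" "rck r \<Gamma> A U = Some A'" "rck r \<Gamma> B U = Some B'"
    "rty r (T' # \<Gamma>) C = Some (C', s1)"
    "rnorm r (A # \<Gamma>) (xsub 0 1 [InlX (lift 1 0 T') (V 0)] C') = Some L"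
    "rck r (A # \<Gamma>) l L = Some l'"
    "rnorm r (B # \<Gamma>) (xsub 0 1 [InrX (lift 1 0 T') (V 0)] C') = Some R"
    "rck r (B # \<Gamma>) rr R = Some r'"
    "rnorm r (S # \<Gamma>) (glueBranch T' u v C' l' r') = Some G"
    "rck r (S # \<Gamma>) s G = Some s'"
    and e: "rck r \<Gamma> e T' = Some e'" and N: "rnorm r \<Gamma> (inst1 e' C') = Some N"
    and c: "(case e' of
           InlX T2 a \<Rightarrow> Option.bind (rck r \<Gamma> a A) (\<lambda>_. reval r \<Gamma> (inst1 a l') N)
         | InrX T2 a \<Rightarrow> Option.bind (rck r \<Gamma> a B) (\<lambda>_. reval r \<Gamma> (inst1 a r') N)
         | _ \<Rightarrow> Some (IndPushX T' C' l' r' s' e', N)) = Some (t', T)"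
    unfolding step.simps
    by (auto simp only: bind_eq_Some_conv case_prod_conv split_paired_all split_paired_Ex case_shape)
  note b = pushout_branches[OF assms(2,3) h]
  note e = rckD[OF e assms(2,3), unfolded b(1)]
  note N = rnormD[OF N assms(2,3), unfolded tr_subst]
  have ind: "trc \<Gamma> \<turnstile> tr (IndPushX T' C' l' r' s' e') ?n \<doteq> tr (IndPushX T0 C l rr s e) ?n \<Ztypecolon> tr N ?n"
    unfolding N tr.simps by (rule push_ind[OF b(2-5) e])
  from case_in[OF c] show ?thesis
  proof (elim disjE exE conjE)
    fix T2 a
    assume e': "e' = InlX T2 a" and "Option.bind (rck r \<Gamma> a A) (\<lambda>_. reval r \<Gamma> (inst1 a l') N) = Some (t', T)"
    then obtain a' where a: "rck r \<Gamma> a A = Some a'" and ev: "reval r \<Gamma> (inst1 a l') N = Some (t', T)"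
      by (auto simp: bind_eq_Some_conv)
    have "trc \<Gamma> \<turnstile> tr (IndPushX T' C' l' r' s' e') ?n \<doteq> tr (inst1 a l') ?n \<Ztypecolon> tr N ?n"
      unfolding N e' tr.simps tr_subst
      by (rule push_beta_inl[OF ty_refl_l[OF b(2)] b(3-5)[THEN eq_refl_l] eq_refl_r[OF rckD[OF a assms(2,3)]]])
    from tm_join[OF revalD(1)[OF ev assms(2,3)] this ind] revalD(2)[OF ev assms(2,3)]
    show ?thesis by (auto intro!: jdI simp del: tr.simps)
  next
    fix T2 a
    assume e': "e' = InrX T2 a" and "Option.bind (rck r \<Gamma> a B) (\<lambda>_. reval r \<Gamma> (inst1 a r') N) = Some (t', T)"
    then obtain a' where a: "rck r \<Gamma> a B = Some a'" and ev: "reval r \<Gamma> (inst1 a r') N = Some (t', T)"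
      by (auto simp: bind_eq_Some_conv)
    have "trc \<Gamma> \<turnstile> tr (IndPushX T' C' l' r' s' e') ?n \<doteq> tr (inst1 a r') ?n \<Ztypecolon> tr N ?n"
      unfolding N e' tr.simps tr_subst
      by (rule push_beta_inr[OF ty_refl_l[OF b(2)] b(3-5)[THEN eq_refl_l] eq_refl_r[OF rckD[OF a assms(2,3)]]])
    from tm_join[OF revalD(1)[OF ev assms(2,3)] this ind] revalD(2)[OF ev assms(2,3)]
    show ?thesis by (auto intro!: jdI simp del: tr.simps)
  qed (use ind in \<open>auto intro!: jdI simp del: tr.simps\<close>)
qed

lemma step_GlueComp:
  assumes "step r \<Gamma> (GlueCompX T0 C l rr s c) = Some (t', T)" "sound r" "wf_ctx (trc \<Gamma>)"
  shows "jd \<Gamma> t' (GlueCompX T0 C l rr s c) T"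
proof -
  let ?n = "length \<Gamma>"
  from assms(1) obtain T' S A B u v S' A' B' C' s1 L l' R r' G s' c' N where
    h: "rck r \<Gamma> T0 U = Some T'" "expo T' (length \<Gamma>) = PushX S A B u v"
    "rck r \<Gamma> S U = Some S'" "rck r \<Gamma> A U = Some A'" "rck r \<Gamma> B U = Some B'"
    "rty r (T' # \<Gamma>) C = Some (C', s1)"
    "rnorm r (A # \<Gamma>) (xsub 0 1 [InlX (lift 1 0 T') (V 0)] C') = Some L"
    "rck r (A # \<Gamma>) l L = Some l'"
    "rnorm r (B # \<Gamma>) (xsub 0 1 [InrX (lift 1 0 T') (V 0)] C') = Some R"
    "rck r (B # \<Gamma>) rr R = Some r'"
    "rnorm r (S # \<Gamma>) (glueBranch T' u v C' l' r') = Some G"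
    "rck r (S # \<Gamma>) s G = Some s'"
    and c: "rck r \<Gamma> c S = Some c'"
    and N: "rnorm r \<Gamma> (PathX (inst1 c' (glueBranch T' u v C' l' r'))
            (apdX T' C' (IndPushX (lift 1 0 T') (lift 1 1 C') (lift 1 1 l') (lift 1 1 r') (lift 1 1 s') (V 0))
              (InlX T' (AppX u c')) (InrX T' (AppX v c')) (GlueX T' c'))
            (inst1 c' s')) = Some N"
    and t: "Some (GlueCompX T' C' l' r' s' c', N) = Some (t', T)"
    unfolding step.simps
    by (auto simp only: bind_eq_Some_conv case_prod_conv split_paired_all split_paired_Ex case_shape)
  note b = pushout_branches[OF assms(2,3) h]
  note c = rckD[OF c assms(2,3)]
  note N = rnormD[OF N assms(2,3)]
  have "trc \<Gamma> \<turnstile> tr (GlueCompX T' C' l' r' s' c') ?n \<doteq> tr (GlueCompX T0 C l rr s c) ?n \<Ztypecolon> tr N ?n"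
    unfolding N using push_comp_glue[OF b(2-5) c]
    by (simp add: tr_subst tr_glueBranch tr_apdX)
  with t show ?thesis by (auto intro!: jdI simp del: tr.simps)
qed

text \<open>
  \<open>ss\<close> and \<open>ts\<close> are judgementally equal instances of the telescope \<open>\<Theta>\<close>.
\<close>

definition telok :: "xt list \<Rightarrow> xt list \<Rightarrow> xt list \<Rightarrow> xt list \<Rightarrow> bool" where
  "telok \<Gamma> \<Theta> ss ts \<longleftrightarrow> length ss = length \<Theta> \<and> length ts = length \<Theta> \<and>
     (\<forall>i<length \<Theta>. trc \<Gamma> \<turnstile> tr (ss ! i) (length \<Gamma>) \<doteq> tr (ts ! i) (length \<Gamma>)
        \<Ztypecolon> tr (xsub 0 (length \<Gamma>) (drop (Suc i) ss) (\<Theta> ! i)) (length \<Gamma>))"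

lemma telok_Nil: "telok \<Gamma> [] [] []"
  by (simp add: telok_def)

lemma all_less_Suc_shift: "(\<forall>i<Suc n. P i) \<longleftrightarrow> P 0 \<and> (\<forall>i<n. P (Suc i))"
  by (auto simp: less_Suc_eq_0_disj)

lemma telok_Cons:
  "telok \<Gamma> (P # \<Theta>) (s # ss) (t # ts) \<longleftrightarrow> telok \<Gamma> \<Theta> ss ts \<and>
     trc \<Gamma> \<turnstile> tr s (length \<Gamma>) \<doteq> tr t (length \<Gamma>) \<Ztypecolon> tr (xsub 0 (length \<Gamma>) ss P) (length \<Gamma>)"
  unfolding telok_def length_Cons all_less_Suc_shift by auto

lemma telok_refl: "telok \<Gamma> \<Theta> ss ts \<Longrightarrow> telok \<Gamma> \<Theta> ss ss"
  unfolding telok_def by (metis eq_refl_l)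

text \<open>The suffix \<open>us\<close> is kept general for derived rules, where the components of
  a canonical argument are checked on top of parameters known to be correct.\<close>

lemma ckt_sound:
  assumes "sound r" "wf_ctx (trc \<Gamma>)" "telok \<Gamma> \<Theta> us us"
  shows "ckt r \<Gamma> Ps ts us = Some ss \<Longrightarrow> telok \<Gamma> (Ps @ \<Theta>) ss (ts @ us)"
proof (induction Ps arbitrary: ts ss)
  case Nil
  then show ?case using assms by (auto split: list.splits)
next
  case (Cons P Ps)
  then obtain t ts' ss' N t' where ts: "ts = t # ts'" and 1: "ckt r \<Gamma> Ps ts' us = Some ss'"
    and N: "rnorm r \<Gamma> (xsub 0 (length \<Gamma>) ss' P) = Some N" and t: "rck r \<Gamma> t N = Some t'"
    and ss: "ss = t' # ss'"
    by (auto simp: bind_eq_Some_conv split: list.splits)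
  show ?case using Cons.IH[OF 1] rckD[OF t assms(1,2), unfolded rnormD[OF N assms(1,2)]]
    by (simp add: ts ss telok_Cons)
qed

abbreviation envx :: "nat \<Rightarrow> xt list \<Rightarrow> nat \<Rightarrow> tm" where
  "envx n ss \<equiv> env n (map (\<lambda>u. tr u n) ss)"

lemma sub_envx: "length ss = m \<Longrightarrow> sub (envx n ss) (tr T m) = tr (xsub 0 n ss T) n"
  by (simp add: tr_xsub0)

text \<open>This is the premise of \<open>tm_subst\<close> and \<open>ty_subst\<close>: equal
  instances of a telescope are equal substitutions out of its context.\<close>

lemma telok_subst:
  assumes "telok \<Gamma> \<Theta> ss ts" "wf_ctx (trc \<Gamma>)"
  defines "n \<equiv> length \<Gamma>"
  shows "\<forall>i<length (trc \<Theta>). trc \<Gamma> \<turnstile> envx n ss i \<doteq> envx n ts i \<Ztypecolon> sub (envx n ss) (wk (Suc i) (trc \<Theta> ! i))"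
proof (intro allI impI)
  fix i assume i: "i < length (trc \<Theta>)"
  have len: "length ss = length \<Theta>" "length ts = length \<Theta>" using assms(1) by (auto simp: telok_def)
  show "trc \<Gamma> \<turnstile> envx n ss i \<doteq> envx n ts i \<Ztypecolon> sub (envx n ss) (wk (Suc i) (trc \<Theta> ! i))"
  proof (cases "i < length \<Theta>")
    case True
    have "(\<lambda>j. envx n ss (j + Suc i)) = envx n (drop (Suc i) ss)"
      by (rule ext) (use len True in \<open>auto simp: env_def add.commute\<close>)
    then have "sub (envx n ss) (wk (Suc i) (trc \<Theta> ! i)) = tr (xsub 0 n (drop (Suc i) ss) (\<Theta> ! i)) n"
      using True len by (simp add: wk_def sub_ren nth_trc tr_xsub0)
    then show ?thesis using assms(1) True len by (simp add: telok_def env_def n_def)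
  next
    case False
    \<comment> \<open>A variable of \<open>base\<close>: both substitutions send it to the same
      variable, now beneath the whole of \<open>\<Gamma>\<close>.\<close>
    let ?j = "i - length \<Theta> + n"
    have "trc \<Gamma> \<turnstile> Var ?j \<Ztypecolon> wk (Suc ?j) (trc \<Gamma> ! ?j)"
      using False i assms(2) by (intro var) (auto simp: length_trc n_def)
    moreover have "sub (envx n ss) (wk (Suc i) u) = wk (Suc ?j) u" for u
      using False len by (simp add: wk_as_sub sub_sub env_def add.assoc Suc_diff_le)
    ultimately show ?thesis using False len by (simp add: nth_trc env_def n_def)
  qed
qed

lemma tr_K: "tr (K d ts) n = sub (envx n ts) (trd d)"
  by (simp add: o_def)

text \<open>One derivation for the body serves all uses of a constant, since each use is a
  substitution instance of it.\<close>

lemma valid_K: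
  assumes "valid d" "telok \<Gamma> (dpar d) ss ts" "wf_ctx (trc \<Gamma>)"
  shows "trc \<Gamma> \<turnstile> tr (K d ss) (length \<Gamma>) \<doteq> tr (K d ts) (length \<Gamma>)
    \<Ztypecolon> tr (xsub 0 (length \<Gamma>) ss (dty d)) (length \<Gamma>)"
proof -
  have "trc (dpar d) \<turnstile> trd d \<Ztypecolon> tr (dty d) (length (dpar d))"
    using assms(1) by (simp add: valid_def)
  from tm_subst[OF this assms(3) telok_subst[OF assms(2,3)]]
  show ?thesis using assms(2) by (simp add: tr_K telok_def sub_envx del: tr.simps)
qed

lemma view_pat:
  assumes "view t = Some (g, as)" "length as = m"
  shows "sub (envx n (as @ us)) (tr (pat g) k) = tr t n"
  using assms by (cases t) (auto simp: pat_def env_def nth_append)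

text \<open>Instantiating the generic left-hand side of a rule at the components found by
  \<open>view\<close> recovers the actual arguments.\<close>

lemma env_lhs:
  assumes "view t = Some (g, as)" "length as = m"
  shows "(\<lambda>i. sub (envx n (as @ us)) (envx (m + length us) (lhs g m (length us)) i)) = envx n (t # us)"
proof
  fix i
  show "sub (envx n (as @ us)) (envx (m + length us) (lhs g m (length us)) i) = envx n (t # us) i"
  proof (cases i)
    case 0
    then show ?thesis using view_pat[OF assms] by (simp add: env_def lhs_def)
  next
    case (Suc j)
    then show ?thesis using assms by (auto simp: env_def lhs_def nth_append)
  qed
qed

lemma valid_rule_K:
  assumes d: "valid d" "look (drules d) g = Some (ar, rhs)"
    and t: "view t = Some (g, as)"
    and ok: "telok \<Gamma> (ar @ tl (dpar d)) (as @ us) (as @ us)" "length as = length ar"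
    and wf: "wf_ctx (trc \<Gamma>)"
  shows "trc \<Gamma> \<turnstile> tr (xsub 0 (length \<Gamma>) (as @ us) rhs) (length \<Gamma>) \<doteq> tr (K d (t # us)) (length \<Gamma>)
    \<Ztypecolon> tr (xsub 0 (length \<Gamma>) (t # us) (dty d)) (length \<Gamma>)"
proof -
  let ?n = "length \<Gamma>" and ?m = "length ar"
  have us: "length us = length (dpar d) - 1" using ok by (auto simp: telok_def)
  let ?us = "lhs g ?m (length us)" and ?k = "?m + length us"
  have dp: "dpar d \<noteq> []" and "trc (ar @ tl (dpar d)) \<turnstile> tr rhs ?k \<doteq> tr (K d ?us) ?k \<Ztypecolon> tr (xsub 0 ?k ?us (dty d)) ?k"
    using d by (auto simp: valid_def valid_rule_def Let_def us simp del: tr.simps)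
  from tm_subst[OF this(2) wf telok_subst[OF ok(1) wf]]
  have "trc \<Gamma> \<turnstile> sub (envx ?n (as @ us)) (tr rhs ?k) \<doteq> sub (envx ?n (as @ us)) (tr (K d ?us) ?k)
     \<Ztypecolon> sub (envx ?n (as @ us)) (tr (xsub 0 ?k ?us (dty d)) ?k)" .
  moreover have "sub (envx ?n (as @ us)) (tr (K d ?us) ?k) = tr (K d (t # us)) ?n"
    unfolding tr_K sub_sub env_lhs[OF t ok(2)] ..
  moreover have "sub (envx ?n (as @ us)) (tr (xsub 0 ?k ?us (dty d)) ?k) = tr (xsub 0 ?n (t # us) (dty d)) ?n"
    using env_lhs[OF t ok(2), of ?n us] by (simp add: tr_xsub0 sub_sub lhs_def del: map_append list.map)
  moreover have "sub (envx ?n (as @ us)) (tr rhs ?k) = tr (xsub 0 ?n (as @ us) rhs) ?n"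
    by (rule sub_envx) (simp add: ok(2))
  ultimately show ?thesis by (simp only:)
qed

lemma dbody_tr: "diota d \<Longrightarrow> length ts = length (dpar d) \<Longrightarrow> tr (xsub 0 n ts (dbd d)) n = tr (K d ts) n"
  by (cases d) (auto simp: tr_xsub0 tr_K simp del: tr.simps split: dbody.splits)

lemma kfin_sound:
  assumes "kfin r \<Gamma> d ts T = Some (t', T')" "sound r" "wf_ctx (trc \<Gamma>)" "valid d"
    and ok: "telok \<Gamma> (dpar d) ts ts0"
    and T: "rnorm r \<Gamma> (xsub 0 (length \<Gamma>) ts (dty d)) = Some T"
  shows "trc \<Gamma> \<turnstile> tr t' (length \<Gamma>) \<doteq> tr (K d ts) (length \<Gamma>) \<Ztypecolon> tr T (length \<Gamma>)" "T' = T"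
proof -
  let ?n = "length \<Gamma>"
  have triv: "trc \<Gamma> \<turnstile> tr (K d ts) ?n \<doteq> tr (K d ts) ?n \<Ztypecolon> tr T ?n"
    using valid_K[OF assms(4) telok_refl[OF ok] assms(3)] by (simp only: rnormD[OF T assms(2,3)])
  have "trc \<Gamma> \<turnstile> tr t' ?n \<doteq> tr (K d ts) ?n \<Ztypecolon> tr T ?n \<and> T' = T"
  proof (cases "t' = K d ts \<and> T' = T")
    case True
    then show ?thesis using triv by simp
  next
    case False
    with assms(1) obtain t us g as where io: "diota d" and ts: "ts = t # us" and v: "view t = Some (g, as)"
      and c: "(case look (drules d) g of
          None \<Rightarrow> reval r \<Gamma> (xsub 0 (length \<Gamma>) ts (dbd d)) T
        | Some (ar, rhs) \<Rightarrow> Option.bind (ckt r \<Gamma> ar as us) (\<lambda>ss.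
            if ss = as @ us then reval r \<Gamma> (xsub 0 (length \<Gamma>) ss rhs) T else None)) = Some (t', T')"
      by (auto simp: kfin_def split: if_splits list.splits option.splits)
    show ?thesis
    proof (cases "look (drules d) g")
      case None
      with c have e: "reval r \<Gamma> (xsub 0 (length \<Gamma>) ts (dbd d)) T = Some (t', T')" by simp
      show ?thesis
        using revalD[OF e assms(2,3)] dbody_tr[OF io, of ts] ok by (simp add: telok_def del: tr.simps)
    next
      case (Some p)
      then obtain ar rhs where l: "look (drules d) g = Some (ar, rhs)" by (cases p) auto
      with c have ck: "ckt r \<Gamma> ar as us = Some (as @ us)"
        and e: "reval r \<Gamma> (xsub 0 (length \<Gamma>) (as @ us) rhs) T = Some (t', T')"
        by (auto simp: bind_eq_Some_conv split: if_splits)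
      obtain P Ps where dp: "dpar d = P # Ps" using ok by (cases "dpar d") (auto simp: telok_def ts)
      obtain t0 us0 where ts0: "ts0 = t0 # us0" using ok by (cases ts0) (auto simp: telok_def ts)
      have us: "telok \<Gamma> Ps us us" using ok telok_refl by (auto simp: dp ts ts0 telok_Cons)
      have ok': "telok \<Gamma> (ar @ Ps) (as @ us) (as @ us)"
        by (rule ckt_sound[OF assms(2,3) us ck])
      have len: "length as = length ar" using ok' us by (auto simp: telok_def)
      have "trc \<Gamma> \<turnstile> tr (xsub 0 ?n (as @ us) rhs) ?n \<doteq> tr (K d ts) ?n \<Ztypecolon> tr T ?n"
        using valid_rule_K[OF assms(4) l v _ len assms(3), of us] ok'
        by (simp add: dp ts rnormD[OF T[unfolded ts] assms(2,3)] del: tr.simps)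
      from tm_trans[OF revalD(1)[OF e assms(2,3)] this] revalD(2)[OF e assms(2,3)]
      show ?thesis by simp
    qed
  qed
  then show "trc \<Gamma> \<turnstile> tr t' ?n \<doteq> tr (K d ts) ?n \<Ztypecolon> tr T ?n" "T' = T" by auto
qed

lemma step_K:
  assumes "step r \<Gamma> (K d ts) = Some (t', T)" "sound r" "wf_ctx (trc \<Gamma>)"
  shows "jd \<Gamma> t' (K d ts) T"
proof -
  from assms(1) obtain ss N where d: "valid d" and c: "ckt r \<Gamma> (dpar d) ts [] = Some ss"
    and N: "rnorm r \<Gamma> (xsub 0 (length \<Gamma>) ss (dty d)) = Some N" and k: "kfin r \<Gamma> d ss N = Some (t', T)"
    by (auto simp: bind_eq_Some_conv split: if_splits)
  have ok: "telok \<Gamma> (dpar d) ss ts"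
    using ckt_sound[OF assms(2,3) telok_Nil c] by simp
  note k = kfin_sound[OF k assms(2,3) d ok N]
  show ?thesis
    using tm_trans[OF k(1)] valid_K[OF d ok assms(3)] k(2)
    by (intro jdI) (simp add: rnormD[OF N assms(2,3)] del: tr.simps)
qed

lemma sound_step: "sound r \<Longrightarrow> sound (step r)"
  unfolding sound_def[of "step r"]
proof (intro allI impI)
  fix \<Gamma> t t' T assume h: "sound r" "wf_ctx (trc \<Gamma>)" "step r \<Gamma> t = Some (t', T)"
  from h show "jd \<Gamma> t' t T"
  proof (cases t)
    case U
    with h univ[OF h(2)] show ?thesis by (auto simp: jd_def)
  next
    case TY
    with h show ?thesis by simp
  qed (hypsubst, rule step_V step_Pi step_Lam step_App step_Sig step_Pair step_IndSig step_Path
      step_Refl step_J step_Push step_Inl step_Inr step_Glue step_IndPush step_GlueComp step_K; assumption)+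
qed

lemma sound_red: "sound (red k)"
  by (induction k) (auto simp: sound_def[of "\<lambda>\<Gamma> t. None"] intro: sound_step)

section \<open>Checking the declaration of a constant\<close>

primrec tel_ok :: "checker \<Rightarrow> xt list \<Rightarrow> bool" where
  "tel_ok r [] = True"
| "tel_ok r (P # Ps) = (if tel_ok r Ps then rty r Ps P \<noteq> None else False)"

lemma base_ty:
  "[Univ] \<turnstile> Univ type" "wf_ctx [Univ, Univ, Univ]" 
  "[Univ, Univ, Univ] \<turnstile> Arr (Var 2) (Var 0) type"
  "[Arr (Var 2) (Var 0), Univ, Univ, Univ] \<turnstile> Arr (Var 2) (Var 1) type"
  "[Arr (Var 2) (Var 1), Arr (Var 2) (Var 0), Univ, Univ, Univ] \<turnstile> Var 2 type"
proof -
  have el: "wf_ctx G \<Longrightarrow> i < length G \<Longrightarrow> G ! i = Univ \<Longrightarrow> G \<turnstile> Var i type" for G i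
    using univ_el[of G "Var i" "Var i"] var[of G i] by (simp add: wk_def)
  have arr: "G \<turnstile> A type \<Longrightarrow> G \<turnstile> B type \<Longrightarrow> G \<turnstile> Arr A B type" for G A B
    unfolding Arr_def by (intro pi_ty weaken_ty ctx_cons)
  have w1: "wf_ctx [Univ]" by (intro ctx_cons univ ctx_nil)
  then show "[Univ] \<turnstile> Univ type" by (rule univ)
  show w3: "wf_ctx [Univ, Univ, Univ]" by (intro ctx_cons univ w1)
  show a: "[Univ, Univ, Univ] \<turnstile> Arr (Var 2) (Var 0) type" by (intro arr el w3) simp_all
  then have w4: "wf_ctx [Arr (Var 2) (Var 0), Univ, Univ, Univ]" by (rule ctx_cons)
  show b: "[Arr (Var 2) (Var 0), Univ, Univ, Univ] \<turnstile> Arr (Var 2) (Var 1) type"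
    by (intro arr el w4) simp_all
  show "[Arr (Var 2) (Var 1), Arr (Var 2) (Var 0), Univ, Univ, Univ] \<turnstile> Var 2 type"
    by (intro el ctx_cons b) simp_all
qed

lemma wf_base: "wf_ctx base"
  unfolding base_def by (intro ctx_cons base_ty)

lemma tel_ok_wf: "sound r \<Longrightarrow> tel_ok r \<Theta> \<Longrightarrow> wf_ctx (trc \<Theta>)"
proof (induction \<Theta>)
  case (Cons P Ps)
  then have "tel_ok r Ps" "rty r Ps P \<noteq> None" by (auto split: if_splits)
  with Cons show ?case using rtyD(5) by fastforce
qed (simp add: wf_base)

definition chk_body :: "checker \<Rightarrow> decl \<Rightarrow> bool" where
  "chk_body r d = (if tel_ok r (dpar d) then
     (case rnorm r (dpar d) (dty d) of None \<Rightarrow> False | Some N \<Rightarrow> rck r (dpar d) (dbd d) N \<noteq> None)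
     else False)"

text \<open>The erasure is that of \<open>pat\<close>, but the checker can infer a type only if the
  annotation is the actual type of the last parameter.\<close>

definition apat :: "xt \<Rightarrow> nat \<Rightarrow> xt" where
  "apat T g = (if g = 0 then PairX T (V 1) (V 0) else if g = 1 then InlX T (V 0)
     else if g = 2 then InrX T (V 0) else ReflX (V 0))"

lemma tr_apat: "tr (apat T g) n = tr (pat g) n"
  by (simp add: apat_def pat_def)

text \<open>A computation rule is established by confluence: its right-hand side and the body at the
  canonical argument must reach the same normal form \<open>c\<close> at the same type.\<close>

definition chk_rule :: "checker \<Rightarrow> decl \<Rightarrow> nat \<Rightarrow> xt list \<Rightarrow> xt \<Rightarrow> bool" where
  "chk_rule r d g ar rhs = (let \<Xi> = ar @ tl (dpar d);
      us = apat (lift (length ar) 0 (hd (dpar d))) g # tl (lhs g (length ar) (length (tl (dpar d))));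
      k = length \<Xi> in
    if tel_ok r \<Xi> then
      (case rnorm r \<Xi> (xsub 0 k us (dty d)) of None \<Rightarrow> False | Some N \<Rightarrow>
      (case rck r \<Xi> rhs N of None \<Rightarrow> False | Some c \<Rightarrow>
       rck r \<Xi> (xsub 0 k us (dbd d)) N = Some c)) else False)"

primrec chk_rules :: "checker \<Rightarrow> decl \<Rightarrow> (nat \<times> xt list \<times> xt) list \<Rightarrow> bool" where
  "chk_rules r d [] = True"
| "chk_rules r d (p # rl) = (if chk_rule r d (fst p) (fst (snd p)) (snd (snd p)) then chk_rules r d rl else False)"

fun is_def where "is_def (Decl nm ps T (Def t) ab io rl) = True" | "is_def _ = False"

lemma trd_dbody: "is_def d \<Longrightarrow> trd d = tr (dbd d) (length (dpar d))"
  by (cases d rule: is_def.cases) auto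

lemma chk_rule_sound:
  assumes "chk_rule r d g ar rhs" "sound r" "is_def d" "dpar d \<noteq> []"
  shows "valid_rule d g ar rhs"
proof -
  define k where "k = length ar + (length (dpar d) - 1)"
  define us where "us = lhs g (length ar) (length (dpar d) - 1)"
  define us' where "us' = apat (lift (length ar) 0 (hd (dpar d))) g # tl us"
  let ?X = "ar @ tl (dpar d)"
  have k: "length ?X = k" by (simp add: k_def)
  from assms(1) obtain N c where t: "tel_ok r ?X" and N: "rnorm r ?X (xsub 0 k us' (dty d)) = Some N"
    and a: "rck r ?X rhs N = Some c" and b: "rck r ?X (xsub 0 k us' (dbd d)) N = Some c"
    by (auto simp: chk_rule_def Let_def k_def us_def us'_def split: if_splits option.splits)
  note wf = tel_ok_wf[OF assms(2) t]
  note ab = tm_trans[OF tm_sym[OF rckD[OF a assms(2) wf]] rckD[OF b assms(2) wf],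
      unfolded rnormD[OF N assms(2) wf], unfolded k]
  have us: "tr (xsub 0 k us' T) k = tr (xsub 0 k us T) k" for T
    by (simp add: tr_xsub0 us'_def us_def lhs_def tr_apat)
  have "length us = length (dpar d)" using assms(4) by (simp add: us_def lhs_def)
  then have "tr (xsub 0 k us (dbd d)) k = tr (K d us) k"
    by (simp add: tr_xsub0 tr_K trd_dbody[OF assms(3)] del: tr.simps)
  with ab show ?thesis
    unfolding valid_rule_def Let_def us_def[symmetric] k_def[symmetric] by (simp only: us)
qed

lemma chk_rules_look: "chk_rules r d rl \<Longrightarrow> look rl g = Some (ar, rhs) \<Longrightarrow> chk_rule r d g ar rhs"
  by (induction rl) (auto split: if_splits)

lemma validI:
  assumes "is_def d" "chk_body (red k) d" "drules d = [] \<or> dpar d \<noteq> []" "chk_rules (red k) d (drules d)"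
  shows "valid d"
proof -
  from assms(2) obtain N b where t: "tel_ok (red k) (dpar d)" and N: "rnorm (red k) (dpar d) (dty d) = Some N"
    and b: "rck (red k) (dpar d) (dbd d) N = Some b"
    by (auto simp: chk_body_def split: if_splits option.splits)
  note wf = tel_ok_wf[OF sound_red t]
  have "trc (dpar d) \<turnstile> trd d \<Ztypecolon> tr (dty d) (length (dpar d))"
    using eq_refl_r[OF rckD[OF b sound_red wf]] by (simp add: trd_dbody[OF assms(1)] rnormD[OF N sound_red wf])
  moreover have "dpar d \<noteq> [] \<and> valid_rule d g ar rhs" if "look (drules d) g = Some (ar, rhs)" for g ar rhs
  proof -
    have "dpar d \<noteq> []" using assms(3) that by auto
    with chk_rule_sound[OF chk_rules_look[OF assms(4) that] sound_red assms(1)] show ?thesis by simp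
  qed
  ultimately show ?thesis by (simp add: valid_def)
qed

section \<open>Evaluation\<close>

text \<open>
  The checker is run by the simplifier: \<open>ev\<close> holds the evaluation rules together with the facts about
  the constants declared so far, and \<open>lazy_cong\<close> keeps branches and continuations unevaluated until
  their scrutinee is known.  The bound 64 is the fuel.
\<close>

named_theorems ev

text \<open>A form of the variable list in \<open>lhs\<close> that unfolds by its own equations
  during evaluation.\<close>

primrec vars :: "nat \<Rightarrow> nat \<Rightarrow> xt list" where
  "vars m 0 = []"
| "vars m (Suc k) = V m # vars (Suc m) k"

lemma lhs_vars: "lhs g m k = pat g # vars m k"
proof -
  have "vars m k = map (\<lambda>i. V (m + i)) [0..<k]"
    by (induction k arbitrary: m) (simp_all add: upt_conv_Cons map_Suc_upt[symmetric] del: upt_Suc)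
  then show ?thesis by (simp add: lhs_def)
qed

lemma chk_valid:
  assumes "is_def d = True" "chk_body (red 64) d = True" "(drules d = [] \<or> dpar d \<noteq> []) = True"
    "chk_rules (red 64) d (drules d) = True"
  shows "valid d = True"
  using validI assms by blast

text \<open>Comparing tags first separates different constants without looking into their
  declarations.\<close>

lemma K_eq: "(K d ts = K d' ts') = (if dname d = dname d' then d = d' \<and> ts = ts' else False)"
  by auto

lemma ne_None: "(None \<noteq> None) = False" "(Some x \<noteq> None) = True"
  by auto

lemma red_numeral: "red (numeral k) = step (red (pred_numeral k))"
  by (simp add: numeral_eq_Suc)

lemmas lazy_cong = if_weak_cong option.case_cong_weak prod.case_cong_weak list.case_cong_weak
  xt.case_cong_weak arg_cong[of m m' "\<lambda>m. Option.bind m f" for m m' f]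

lemmas [ev] = red_numeral red.simps step.simps kfin_def look.simps smax_def apdX_def glueBranch_def
  inst1_def ckt.simps reval_def rnorm_def rck_def rty_def nored.simps canon_hd.simps canon_def both_def
  is_lam.simps view.simps conv_def expo.simps unf.simps xsub.simps lift.simps chk_body_def chk_rule_def
  chk_rules.simps tel_ok.simps lhs_vars vars.simps pat_def apat_def

lemmas [ev] = if_True if_False simp_thms xt.inject(1-16) xt.distinct K_eq nat.inject nat.distinct
  One_nat_def numeral_2_eq_2 numeral_3_eq_3 numeral_One pred_numeral_simps Num.BitM.simps
  numeral_eq_iff eq_num_simps prod.sel Let_def
  zero_less_Suc Suc_less_eq not_less_zero diff_Suc_Suc diff_0_eq_0 minus_nat.diff_0 add_Suc add_0
  list.size(3,4) list.case list.map list.sel append.simps list.pred_inject Option.bind.simps option.case option.inject option.distinct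
  xt.case prod.case nth_Cons_0 nth_Cons_Suc ne_None list.inject list.distinct o_def

named_theorems hoas

text \<open>
  Terms with binders as functions: an \<open>ht\<close> maps the current depth to a term, and \<open>bv d\<close> is the
  variable bound at depth \<open>d\<close>.
\<close>

type_synonym ht = "nat \<Rightarrow> xt"

definition bv :: "nat \<Rightarrow> ht" where [hoas]: "bv d n = V (n - Suc d)"
definition UU :: ht where [hoas]: "UU n = U"
definition PI :: "ht \<Rightarrow> (ht \<Rightarrow> ht) \<Rightarrow> ht" where [hoas]: "PI A F n = PiX (A n) (F (bv n) (Suc n))"
definition LAM :: "ht \<Rightarrow> (ht \<Rightarrow> ht) \<Rightarrow> ht" where [hoas]: "LAM A F n = LamX (A n) (F (bv n) (Suc n))"
definition SIG :: "ht \<Rightarrow> (ht \<Rightarrow> ht) \<Rightarrow> ht" where [hoas]: "SIG A F n = SigX (A n) (F (bv n) (Suc n))"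
definition app :: "ht \<Rightarrow> ht \<Rightarrow> ht" (infixl "\<cdot>" 95) where [hoas]: "(f \<cdot> a) n = AppX (f n) (a n)"
definition PAIR :: "ht \<Rightarrow> ht \<Rightarrow> ht \<Rightarrow> ht" where [hoas]: "PAIR T a b n = PairX (T n) (a n) (b n)"
definition PATH :: "ht \<Rightarrow> ht \<Rightarrow> ht \<Rightarrow> ht" where [hoas]: "PATH A a b n = PathX (A n) (a n) (b n)"
definition REFL :: "ht \<Rightarrow> ht" where [hoas]: "REFL a n = ReflX (a n)"
definition PUSH :: "ht \<Rightarrow> ht \<Rightarrow> ht \<Rightarrow> ht \<Rightarrow> ht \<Rightarrow> ht" where
  [hoas]: "PUSH S A B u v n = PushX (S n) (A n) (B n) (u n) (v n)"
definition INL :: "ht \<Rightarrow> ht \<Rightarrow> ht" where [hoas]: "INL T a n = InlX (T n) (a n)"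
definition INR :: "ht \<Rightarrow> ht \<Rightarrow> ht" where [hoas]: "INR T a n = InrX (T n) (a n)"
definition GLUE :: "ht \<Rightarrow> ht \<Rightarrow> ht" where [hoas]: "GLUE T a n = GlueX (T n) (a n)"
definition INDSIG :: "ht \<Rightarrow> (ht \<Rightarrow> ht) \<Rightarrow> (ht \<Rightarrow> ht) \<Rightarrow> (ht \<Rightarrow> ht \<Rightarrow> ht) \<Rightarrow> ht \<Rightarrow> ht" where
  [hoas]: "INDSIG A B C d p n = IndSigX (A n) (B (bv n) (Suc n)) (C (bv n) (Suc n))
     (d (bv n) (bv (Suc n)) (Suc (Suc n))) (p n)"
definition JJ :: "ht \<Rightarrow> (ht \<Rightarrow> ht \<Rightarrow> ht) \<Rightarrow> ht \<Rightarrow> ht \<Rightarrow> ht \<Rightarrow> ht \<Rightarrow> ht" where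
  [hoas]: "JJ A C d a b p n = JX (A n) (C (bv n) (bv (Suc n)) (Suc (Suc n))) (d n) (a n) (b n) (p n)"
definition INDPUSH :: "ht \<Rightarrow> (ht \<Rightarrow> ht) \<Rightarrow> (ht \<Rightarrow> ht) \<Rightarrow> (ht \<Rightarrow> ht) \<Rightarrow> (ht \<Rightarrow> ht) \<Rightarrow> ht \<Rightarrow> ht" where
  [hoas]: "INDPUSH T C l r s e n = IndPushX (T n) (C (bv n) (Suc n)) (l (bv n) (Suc n))
     (r (bv n) (Suc n)) (s (bv n) (Suc n)) (e n)"
definition GLUECOMP :: "ht \<Rightarrow> (ht \<Rightarrow> ht) \<Rightarrow> (ht \<Rightarrow> ht) \<Rightarrow> (ht \<Rightarrow> ht) \<Rightarrow> (ht \<Rightarrow> ht) \<Rightarrow> ht \<Rightarrow> ht" where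
  [hoas]: "GLUECOMP T C l r s c n = GlueCompX (T n) (C (bv n) (Suc n)) (l (bv n) (Suc n))
     (r (bv n) (Suc n)) (s (bv n) (Suc n)) (c n)"
definition con :: "decl \<Rightarrow> ht list \<Rightarrow> ht" where [hoas]: "con d xs n = K d (map (\<lambda>x. x n) xs)"

definition ARR :: "ht \<Rightarrow> ht \<Rightarrow> ht" where [hoas]: "ARR A B = PI A (\<lambda>_. B)"
definition PRD :: "ht \<Rightarrow> ht \<Rightarrow> ht" where [hoas]: "PRD A B = SIG A (\<lambda>_. B)"
definition FST :: "ht \<Rightarrow> (ht \<Rightarrow> ht) \<Rightarrow> ht \<Rightarrow> ht" where
  [hoas]: "FST A B p = INDSIG A B (\<lambda>_. A) (\<lambda>a b. a) p"
definition SND :: "ht \<Rightarrow> (ht \<Rightarrow> ht) \<Rightarrow> ht \<Rightarrow> ht" where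
  [hoas]: "SND A B p = INDSIG A B (\<lambda>q. B (FST A B q)) (\<lambda>a b. b) p"
definition TRANSP :: "ht \<Rightarrow> (ht \<Rightarrow> ht) \<Rightarrow> ht \<Rightarrow> ht \<Rightarrow> ht \<Rightarrow> ht \<Rightarrow> ht" where
  [hoas]: "TRANSP A C u a b p = JJ A (\<lambda>y _. C y) u a b p"

type_synonym telescope = "nat \<Rightarrow> xt list \<times> xt \<times> xt"

definition PAR :: "ht \<Rightarrow> (ht \<Rightarrow> telescope) \<Rightarrow> telescope" where
  [hoas]: "PAR A k n = (case k (bv n) (Suc n) of (ps, T, b) \<Rightarrow> (ps @ [A n], T, b))"
definition FIN :: "ht \<Rightarrow> ht \<Rightarrow> telescope" where [hoas]: "FIN T b n = ([], T n, b n)"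
text \<open>
  \<open>p\<close> is the telescope of all parameters but the last one, followed by the \<open>m\<close> components of the
  canonical last argument, and ends in the right-hand side.
\<close>

definition RULE :: "nat \<Rightarrow> nat \<Rightarrow> telescope \<Rightarrow> nat \<times> xt list \<times> xt" where
  [hoas]: "RULE g m p = (case p 0 of (ps, rhs, b) \<Rightarrow> (g, take m ps, rhs))"
definition mkd :: "nat \<Rightarrow> bool \<Rightarrow> bool \<Rightarrow> (nat \<times> xt list \<times> xt) list \<Rightarrow> telescope \<Rightarrow> decl" where
  [hoas]: "mkd nm ab io rl p = (case p 0 of (ps, T, b) \<Rightarrow> Decl nm ps T (Def b) ab io rl)"
definition mkp :: "nat \<Rightarrow> tm \<Rightarrow> telescope \<Rightarrow> decl" where
  [hoas]: "mkp nm t p = (case p 0 of (ps, T, b) \<Rightarrow> Decl nm ps T (Prim t) False False [])"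

lemmas [hoas] = Let_def prod.case append.simps take_0 take_Suc_Cons list.map One_nat_def numeral_2_eq_2
  diff_Suc_Suc diff_0_eq_0 minus_nat.diff_0

text \<open>All access to a constant goes through these equations, so its name stays folded in the
  terms that are evaluated.\<close>

lemma def_sel:
  assumes "d = Decl nm ps T (Def b) ab io rl"
  shows "dname d = nm \<and> dpar d = ps \<and> dty d = T \<and> dbd d = b \<and> dab d = ab \<and> diota d = io \<and>
    drules d = rl \<and> dar d = length ps \<and> unfd d = unf b (length ps) \<and> expod d = expo b (length ps) \<and>
    is_def d = True \<and> trd d = tr b (length ps)"
  using assms by simp

lemma prim_sel:
  assumes "d = Decl nm ps T (Prim t) ab io rl"
  shows "dname d = nm \<and> dpar d = ps \<and> dty d = T \<and> dab d = False \<and> diota d = False \<and> trd d = t \<and> drules d = rl"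
  using assms by simp

lemma valid_baseI:
  assumes "i < 6" "dpar d = []" "trd d = Var i" "drules d = []" "tr (dty d) 0 = wk (Suc i) (base ! i)"
  shows "valid d = True"
  using assms var[OF wf_base, of i] by (simp add: valid_def base_def)

section \<open>The six variables of \<open>base\<close> as constants\<close>

definition tyA_d where
  "tyA_d = mkp 10 (Var 5) (FIN UU UU)"
abbreviation "tyA \<equiv> con tyA_d []"
lemmas tyA_sel [ev] = prim_sel[OF tyA_d_def[unfolded hoas], unfolded ev]
lemma tyA_valid [ev]: "valid tyA_d = True"
  by (rule valid_baseI[of 5]) (simp_all add: tyA_sel base_def Arr_def wk_def env_def)

definition tyB_d where
  "tyB_d = mkp 11 (Var 4) (FIN UU UU)"
abbreviation "tyB \<equiv> con tyB_d []"
lemmas tyB_sel [ev] = prim_sel[OF tyB_d_def[unfolded hoas], unfolded ev]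
lemma tyB_valid [ev]: "valid tyB_d = True"
  by (rule valid_baseI[of 4]) (simp_all add: tyB_sel base_def Arr_def wk_def env_def)

definition tyX_d where
  "tyX_d = mkp 12 (Var 3) (FIN UU UU)"
abbreviation "tyX \<equiv> con tyX_d []"
lemmas tyX_sel [ev] = prim_sel[OF tyX_d_def[unfolded hoas], unfolded ev]
lemma tyX_valid [ev]: "valid tyX_d = True"
  by (rule valid_baseI[of 3]) (simp_all add: tyX_sel base_def Arr_def wk_def env_def)

definition mapf_d where
  "mapf_d = mkp 13 (Var 2) (FIN (ARR tyA tyX) UU)"
abbreviation "mapf \<equiv> con mapf_d []"
lemmas mapf_sel [ev] = prim_sel[OF mapf_d_def[unfolded hoas], unfolded ev]
lemma mapf_valid [ev]: "valid mapf_d = True"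
  by (rule valid_baseI[of 2]) (simp_all add: tyA_sel tyX_sel mapf_sel base_def Arr_def wk_def env_def)

definition mapg_d where
  "mapg_d = mkp 14 (Var 1) (FIN (ARR tyB tyX) UU)"
abbreviation "mapg \<equiv> con mapg_d []"
lemmas mapg_sel [ev] = prim_sel[OF mapg_d_def[unfolded hoas], unfolded ev]
lemma mapg_valid [ev]: "valid mapg_d = True"
  by (rule valid_baseI[of 1]) (simp_all add: tyB_sel tyX_sel mapg_sel base_def Arr_def wk_def env_def)

definition ptx_d where
  "ptx_d = mkp 15 (Var 0) (FIN tyX UU)"
abbreviation "ptx \<equiv> con ptx_d []"
lemmas ptx_sel [ev] = prim_sel[OF ptx_d_def[unfolded hoas], unfolded ev]
lemma ptx_valid [ev]: "valid ptx_d = True"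
  by (rule valid_baseI[of 0]) (simp_all add: tyX_sel ptx_sel base_def Arr_def wk_def env_def)

section \<open>Paths\<close>

text \<open>Induction on the second path makes composition with reflexivity on the right compute; on
  the left it holds only by \<open>lunit\<close>.\<close>

definition pcat_d where
  "pcat_d = mkd 16 False True []
   (PAR UU (\<lambda>A. PAR A (\<lambda>a. PAR A (\<lambda>b. PAR A (\<lambda>c. PAR (PATH A a b) (\<lambda>p. PAR (PATH A b c) (\<lambda>q.
      FIN (PATH A a c)
      (JJ A (\<lambda>y _. PATH A a y) p b c q))))))))"
abbreviation "pcat A a b c p q \<equiv> con pcat_d [q, p, c, b, a, A]"
lemmas pcat_sel [ev] = def_sel[OF pcat_d_def[unfolded hoas], unfolded ev]
lemma pcat_valid [ev]: "valid pcat_d = True"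
  by (rule chk_valid; simp only: ev cong: lazy_cong)

definition psym_d where
  "psym_d = mkd 17 False True []
   (PAR UU (\<lambda>A. PAR A (\<lambda>a. PAR A (\<lambda>b. PAR (PATH A a b) (\<lambda>p.
      FIN (PATH A b a)
      (JJ A (\<lambda>y _. PATH A y a) (REFL a) a b p))))))"
abbreviation "psym A a b p \<equiv> con psym_d [p, b, a, A]"
lemmas psym_sel [ev] = def_sel[OF psym_d_def[unfolded hoas], unfolded ev]
lemma psym_valid [ev]: "valid psym_d = True"
  by (rule chk_valid; simp only: ev cong: lazy_cong)

definition ap_d where
  "ap_d = mkd 18 False True []
   (PAR UU (\<lambda>A. PAR UU (\<lambda>B. PAR (ARR A B) (\<lambda>f. PAR A (\<lambda>a. PAR A (\<lambda>b. PAR (PATH A a b) (\<lambda>p.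
      FIN (PATH B (f \<cdot> a) (f \<cdot> b))
      (JJ A (\<lambda>y _. PATH B (f \<cdot> a) (f \<cdot> y)) (REFL (f \<cdot> a)) a b p))))))))"
abbreviation "ap A B f a b p \<equiv> con ap_d [p, b, a, f, B, A]"
lemmas ap_sel [ev] = def_sel[OF ap_d_def[unfolded hoas], unfolded ev]
lemma ap_valid [ev]: "valid ap_d = True"
  by (rule chk_valid; simp only: ev cong: lazy_cong)

definition lunit_d where
  "lunit_d = mkd 19 False False []
   (PAR UU (\<lambda>A. PAR A (\<lambda>a. PAR A (\<lambda>b. PAR (PATH A a b) (\<lambda>p.
      FIN (PATH (PATH A a b) (pcat A a a b (REFL a) p) p)
      (JJ A (\<lambda>y q. PATH (PATH A a y) (pcat A a a y (REFL a) q) q) (REFL (REFL a)) a b p))))))"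
abbreviation "lunit A a b p \<equiv> con lunit_d [p, b, a, A]"
lemmas lunit_sel [ev] = def_sel[OF lunit_d_def[unfolded hoas], unfolded ev]
lemma lunit_valid [ev]: "valid lunit_d = True"
  by (rule chk_valid; simp only: ev cong: lazy_cong)

definition apid_d where
  "apid_d = mkd 20 False False []
   (PAR UU (\<lambda>A. PAR A (\<lambda>a. PAR A (\<lambda>b. PAR (PATH A a b) (\<lambda>p.
      FIN (PATH (PATH A a b) (ap A A (LAM A (\<lambda>x. x)) a b p) p)
      (JJ A (\<lambda>y q. PATH (PATH A a y) (ap A A (LAM A (\<lambda>x. x)) a y q) q) (REFL (REFL a)) a b
        p))))))"
abbreviation "apid A a b p \<equiv> con apid_d [p, b, a, A]"
lemmas apid_sel [ev] = def_sel[OF apid_d_def[unfolded hoas], unfolded ev]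
lemma apid_valid [ev]: "valid apid_d = True"
  by (rule chk_valid; simp only: ev cong: lazy_cong)

definition apcomp_d where
  "apcomp_d = mkd 21 False False []
   (PAR UU (\<lambda>A. PAR UU (\<lambda>B. PAR UU (\<lambda>C. PAR (ARR A B) (\<lambda>f. PAR (ARR B C) (\<lambda>g. PAR A (\<lambda>a.
     PAR A (\<lambda>b. PAR (PATH A a b) (\<lambda>p.
      FIN (PATH (PATH C (g \<cdot> (f \<cdot> a)) (g \<cdot> (f \<cdot> b))) (ap A C (LAM A (\<lambda>x. g \<cdot> (f \<cdot> x))) a b p) (ap B C g (f \<cdot> a)
        (f \<cdot> b) (ap A B f a b p)))
      (JJ A (\<lambda>y q. PATH (PATH C (g \<cdot> (f \<cdot> a)) (g \<cdot> (f \<cdot> y))) (ap A C (LAM A (\<lambda>x. g \<cdot> (f \<cdot> x))) a y q) (ap B C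
        g (f \<cdot> a) (f \<cdot> y) (ap A B f a y q))) (REFL (REFL (g \<cdot> (f \<cdot> a)))) a b p))))))))))"
abbreviation "apcomp A B C f g a b p \<equiv>
  con apcomp_d [p, b, a, g, f, C, B, A]"
lemmas apcomp_sel [ev] = def_sel[OF apcomp_d_def[unfolded hoas], unfolded ev]
lemma apcomp_valid [ev]: "valid apcomp_d = True"
  by (rule chk_valid; simp only: ev cong: lazy_cong)

text \<open>Both flags are off here and in the longer chains: a composite is checked once and
  afterwards never opened, which keeps the proofs built from it small.\<close>

definition chain3_d where
  "chain3_d = mkd 22 False False []
   (PAR UU (\<lambda>A. PAR A (\<lambda>x0. PAR A (\<lambda>x1. PAR A (\<lambda>x2. PAR A (\<lambda>x3. PAR (PATH A x0 x1) (\<lambda>p1.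
     PAR (PATH A x1 x2) (\<lambda>p2. PAR (PATH A x2 x3) (\<lambda>p3.
      FIN (PATH A x0 x3)
      (pcat A x0 x2 x3 (pcat A x0 x1 x2 p1 p2) p3))))))))))"
abbreviation "chain3 A x0 x1 x2 x3 p1 p2 p3 \<equiv>
  con chain3_d [p3, p2, p1, x3, x2, x1, x0, A]"
lemmas chain3_sel [ev] = def_sel[OF chain3_d_def[unfolded hoas], unfolded ev]
lemma chain3_valid [ev]: "valid chain3_d = True"
  by (rule chk_valid; simp only: ev cong: lazy_cong)

definition chain4_d where
  "chain4_d = mkd 23 False False []
   (PAR UU (\<lambda>A. PAR A (\<lambda>x0. PAR A (\<lambda>x1. PAR A (\<lambda>x2. PAR A (\<lambda>x3. PAR A (\<lambda>x4.
     PAR (PATH A x0 x1) (\<lambda>p1. PAR (PATH A x1 x2) (\<lambda>p2. PAR (PATH A x2 x3) (\<lambda>p3.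
     PAR (PATH A x3 x4) (\<lambda>p4.
      FIN (PATH A x0 x4)
      (pcat A x0 x3 x4 (pcat A x0 x2 x3 (pcat A x0 x1 x2 p1 p2) p3) p4))))))))))))"
abbreviation "chain4 A x0 x1 x2 x3 x4 p1 p2 p3 p4 \<equiv>
  con chain4_d [p4, p3, p2, p1, x4, x3, x2, x1, x0, A]"
lemmas chain4_sel [ev] = def_sel[OF chain4_d_def[unfolded hoas], unfolded ev]
lemma chain4_valid [ev]: "valid chain4_d = True"
  by (rule chk_valid; simp only: ev cong: lazy_cong)

definition chain5_d where
  "chain5_d = mkd 24 False False []
   (PAR UU (\<lambda>A. PAR A (\<lambda>x0. PAR A (\<lambda>x1. PAR A (\<lambda>x2. PAR A (\<lambda>x3. PAR A (\<lambda>x4. PAR A (\<lambda>x5.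
     PAR (PATH A x0 x1) (\<lambda>p1. PAR (PATH A x1 x2) (\<lambda>p2. PAR (PATH A x2 x3) (\<lambda>p3.
     PAR (PATH A x3 x4) (\<lambda>p4. PAR (PATH A x4 x5) (\<lambda>p5.
      FIN (PATH A x0 x5)
      (pcat A x0 x4 x5 (pcat A x0 x3 x4 (pcat A x0 x2 x3 (pcat A x0 x1 x2 p1 p2) p3) p4)
        p5))))))))))))))"
abbreviation "chain5 A x0 x1 x2 x3 x4 x5 p1 p2 p3 p4 p5 \<equiv>
  con chain5_d [p5, p4, p3, p2, p1, x5, x4, x3, x2, x1, x0, A]"
lemmas chain5_sel [ev] = def_sel[OF chain5_d_def[unfolded hoas], unfolded ev]
lemma chain5_valid [ev]: "valid chain5_d = True"
  by (rule chk_valid; simp only: ev cong: lazy_cong)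

section \<open>Recursion out of a pushout\<close>

text \<open>
  A commuting square yields the transport required by pushout induction; at reflexivity this is
  the left unit law.
\<close>

definition square_d where
  "square_d = mkd 25 False False []
   (PAR UU (\<lambda>W. PAR UU (\<lambda>Z. PAR (ARR W Z) (\<lambda>m. PAR (ARR W Z) (\<lambda>n. PAR W (\<lambda>w. PAR W (\<lambda>w2.
     PAR (PATH W w w2) (\<lambda>e. PAR (PATH Z (m \<cdot> w) (n \<cdot> w)) (\<lambda>al. PAR (PATH Z (m \<cdot> w2) (n \<cdot> w2)) (\<lambda>be. PAR
     (PATH (PATH Z (m \<cdot> w) (n \<cdot> w2)) (pcat Z (m \<cdot> w) (n \<cdot> w) (n \<cdot> w2) al (ap W Z n w w2 e)) (pcat Z (m \<cdot> w)
     (m \<cdot> w2) (n \<cdot> w2) (ap W Z m w w2 e) be)) (\<lambda>sq.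
      FIN (PATH (PATH Z (m \<cdot> w2) (n \<cdot> w2)) (TRANSP W (\<lambda>y. PATH Z (m \<cdot> y) (n \<cdot> y)) al w w2 e) be)
      (JJ W (\<lambda>y e. PI (PATH Z (m \<cdot> y) (n \<cdot> y)) (\<lambda>be. ARR (PATH (PATH Z (m \<cdot> w) (n \<cdot> y)) (pcat Z (m \<cdot> w)
        (n \<cdot> w) (n \<cdot> y) al (ap W Z n w y e)) (pcat Z (m \<cdot> w) (m \<cdot> y) (n \<cdot> y) (ap W Z m w y e) be)) (PATH
        (PATH Z (m \<cdot> y) (n \<cdot> y)) (TRANSP W (\<lambda>y. PATH Z (m \<cdot> y) (n \<cdot> y)) al w y e) be)))
     (LAM (PATH Z (m \<cdot> w) (n \<cdot> w)) (\<lambda>be. LAM (PATH (PATH Z (m \<cdot> w) (n \<cdot> w)) al (pcat Z (m \<cdot> w) (m \<cdot> w) (n \<cdot> w)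
       (REFL (m \<cdot> w)) be))
       (\<lambda>h. pcat (PATH Z (m \<cdot> w) (n \<cdot> w)) al (pcat Z (m \<cdot> w) (m \<cdot> w) (n \<cdot> w) (REFL (m \<cdot> w)) be) be h (lunit Z
         (m \<cdot> w) (n \<cdot> w) be))))
     w w2 e \<cdot> be \<cdot> sq))))))))))))"
abbreviation "square W Z m n w w2 e al be sq \<equiv>
  con square_d [sq, be, al, e, w2, w, n, m, Z, W]"
lemmas square_sel [ev] = def_sel[OF square_d_def[unfolded hoas], unfolded ev]
lemma square_valid [ev]: "valid square_d = True"
  by (rule chk_valid; simp only: ev cong: lazy_cong)

definition psquare where [hoas]:
  "psquare W u v Z m n hl hr s = (let i = INL W (u \<cdot> s); j = INR W (v \<cdot> s); e = GLUE W s in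
  PATH (PATH Z (m \<cdot> i) (n \<cdot> j)) (pcat Z (m \<cdot> i) (n \<cdot> i) (n \<cdot> j) (hl \<cdot> (u \<cdot> s)) (ap W Z n i j e))
    (pcat Z (m \<cdot> i) (m \<cdot> j) (n \<cdot> j) (ap W Z m i j e) (hr \<cdot> (v \<cdot> s))))"

text \<open>The motive is a family of path types, for which \<open>square\<close> turns a commuting
  square into the required glue branch. A homotopy between maps out of a pushout thus amounts to
  homotopies on both kinds of points and a naturality square for each \<open>Glue s\<close>.\<close>

definition pushhtpy_d where
  "pushhtpy_d = mkd 26 False False []
   (PAR UU (\<lambda>S. PAR UU (\<lambda>A. PAR UU (\<lambda>B. PAR (ARR S A) (\<lambda>u. PAR (ARR S B) (\<lambda>v. PAR UU (\<lambda>Z.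
     PAR (ARR (PUSH S A B u v) Z) (\<lambda>m. PAR (ARR (PUSH S A B u v) Z) (\<lambda>n. PAR (PI A (\<lambda>a. PATH Z
     (m \<cdot> INL (PUSH S A B u v) a) (n \<cdot> INL (PUSH S A B u v) a))) (\<lambda>hl. PAR (PI B (\<lambda>b. PATH Z (m \<cdot> INR
     (PUSH S A B u v) b) (n \<cdot> INR (PUSH S A B u v) b))) (\<lambda>hr.
     PAR (PI S (\<lambda>s. psquare (PUSH S A B u v) u v Z m n hl hr s)) (\<lambda>sq. PAR (PUSH S A B u v) (\<lambda>w.
      FIN (PATH Z (m \<cdot> w) (n \<cdot> w))
      (let W = PUSH S A B u v in INDPUSH W (\<lambda>w. PATH Z (m \<cdot> w) (n \<cdot> w)) (\<lambda>a. hl \<cdot> a) (\<lambda>b. hr \<cdot> b)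
    (\<lambda>s. square W Z m n (INL W (u \<cdot> s)) (INR W (v \<cdot> s)) (GLUE W s) (hl \<cdot> (u \<cdot> s)) (hr \<cdot> (v \<cdot> s)) (sq \<cdot> s))
      w))))))))))))))"
abbreviation "pushhtpy S A B u v Z m n hl hr sq w \<equiv>
  con pushhtpy_d [w, sq, hr, hl, n, m, Z, v, u, B, A, S]"
lemmas pushhtpy_sel [ev] = def_sel[OF pushhtpy_d_def[unfolded hoas], unfolded ev]
lemma pushhtpy_valid [ev]: "valid pushhtpy_d = True"
  by (rule chk_valid; simp only: ev cong: lazy_cong)

definition recglue where [hoas]:
  "recglue W u v X l r h c = (JJ W (\<lambda>y q. PATH X (TRANSP W (\<lambda>_. X) (l \<cdot> (u \<cdot> c)) (INL W (u \<cdot> c)) y q)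
    (r \<cdot> (v \<cdot> c))) (h \<cdot> c)
    (INL W (u \<cdot> c)) (INR W (v \<cdot> c)) (GLUE W c))"

text \<open>The body is \<open>RecPush\<close> with its correction of constant transport. The two
  derived rules let the recursor compute on points without inferring the glue branch again.\<close>

definition prec_d where
  "prec_d = mkd 27 True True [RULE 1 1 (PAR UU (\<lambda>S. PAR UU (\<lambda>A. PAR UU (\<lambda>B. PAR (ARR S A) (\<lambda>u.
    PAR (ARR S B) (\<lambda>v. PAR UU (\<lambda>X. PAR (ARR A X) (\<lambda>l. PAR (ARR B X) (\<lambda>r.
    PAR (PI S (\<lambda>c. PATH X (l \<cdot> (u \<cdot> c)) (r \<cdot> (v \<cdot> c)))) (\<lambda>h. PAR A (\<lambda>a. FIN (l \<cdot> a) UU))))))))))),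
     RULE 2 1 (PAR UU (\<lambda>S. PAR UU (\<lambda>A. PAR UU (\<lambda>B. PAR (ARR S A) (\<lambda>u. PAR (ARR S B) (\<lambda>v.
       PAR UU (\<lambda>X. PAR (ARR A X) (\<lambda>l. PAR (ARR B X) (\<lambda>r.
       PAR (PI S (\<lambda>c. PATH X (l \<cdot> (u \<cdot> c)) (r \<cdot> (v \<cdot> c)))) (\<lambda>h. PAR B (\<lambda>b. FIN (r \<cdot> b) UU)))))))))))]
   (PAR UU (\<lambda>S. PAR UU (\<lambda>A. PAR UU (\<lambda>B. PAR (ARR S A) (\<lambda>u. PAR (ARR S B) (\<lambda>v. PAR UU (\<lambda>X.
     PAR (ARR A X) (\<lambda>l. PAR (ARR B X) (\<lambda>r. PAR (PI S (\<lambda>c. PATH X (l \<cdot> (u \<cdot> c)) (r \<cdot> (v \<cdot> c)))) (\<lambda>h.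
     PAR (PUSH S A B u v) (\<lambda>e.
      FIN X
      (let W = PUSH S A B u v in INDPUSH W (\<lambda>_. X) (\<lambda>a. l \<cdot> a) (\<lambda>b. r \<cdot> b) (\<lambda>c. recglue W u v X l r h
        c) e))))))))))))"
abbreviation "prec S A B u v X l r h e \<equiv>
  con prec_d [e, h, r, l, X, v, u, B, A, S]"
lemmas prec_sel [ev] = def_sel[OF prec_d_def[unfolded hoas], unfolded ev]
lemma prec_valid [ev]: "valid prec_d = True"
  by (rule chk_valid; simp only: ev cong: lazy_cong)

text \<open>
  \<open>GlueComp\<close> computes the dependent action on \<open>Glue\<close> up to the path with which \<open>RecPush\<close> corrects
  transport in the constant family.  Path induction on \<open>Glue\<close> removes this correction: at
  reflexivity, hypothesis and conclusion of the motive agree.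
\<close>

definition recbeta_d where
  "recbeta_d = mkd 28 False False []
   (PAR UU (\<lambda>S. PAR UU (\<lambda>A. PAR UU (\<lambda>B. PAR (ARR S A) (\<lambda>u. PAR (ARR S B) (\<lambda>v. PAR UU (\<lambda>X.
     PAR (ARR A X) (\<lambda>l. PAR (ARR B X) (\<lambda>r. PAR (PI S (\<lambda>c. PATH X (l \<cdot> (u \<cdot> c)) (r \<cdot> (v \<cdot> c)))) (\<lambda>h.
     PAR S (\<lambda>c.
      FIN (PATH (PATH X (l \<cdot> (u \<cdot> c)) (r \<cdot> (v \<cdot> c)))
      (ap (PUSH S A B u v) X (LAM (PUSH S A B u v) (\<lambda>w. prec S A B u v X l r h w)) (INL (PUSH S A
        B u v) (u \<cdot> c)) (INR (PUSH S A B u v) (v \<cdot> c)) (GLUE (PUSH S A B u v) c)) (h \<cdot> c))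
      (let W = PUSH S A B u v; F = LAM W (\<lambda>w. prec S A B u v X l r h w); a = u \<cdot> c; i = INL W a; j
        = INR W (v \<cdot> c); y0 = r \<cdot> (v \<cdot> c) in
    JJ W (\<lambda>w q. PI (PATH X (prec S A B u v X l r h w) y0) (\<lambda>de. ARR
        (PATH (PATH X (TRANSP W (\<lambda>_. X) (l \<cdot> a) i w q) y0)
          (pcat X (TRANSP W (\<lambda>_. X) (l \<cdot> a) i w q) (F \<cdot> w) y0
            (JJ W (\<lambda>w q. PATH X (TRANSP W (\<lambda>_. X) (l \<cdot> a) i w q) (F \<cdot> w)) (REFL (l \<cdot> a)) i w q) de)
          (JJ W (\<lambda>w q. PATH X (TRANSP W (\<lambda>_. X) (l \<cdot> a) i w q) y0) (h \<cdot> c) i w q))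
        (PATH (PATH X (l \<cdot> a) y0) (pcat X (l \<cdot> a) (F \<cdot> w) y0 (ap W X F i w q) de) (h \<cdot> c))))
      (LAM (PATH X (l \<cdot> a) y0) (\<lambda>de. LAM (PATH (PATH X (l \<cdot> a) y0) (pcat X (l \<cdot> a) (l \<cdot> a) y0 (REFL
        (l \<cdot> a)) de) (h \<cdot> c)) (\<lambda>z. z)))
      i j (GLUE W c) \<cdot> REFL y0 \<cdot> 
      GLUECOMP W (\<lambda>_. X) (\<lambda>a. l \<cdot> a) (\<lambda>b. r \<cdot> b) (\<lambda>c. recglue W u v X l r h c) c))))))))))))"
abbreviation "recbeta S A B u v X l r h c \<equiv>
  con recbeta_d [c, h, r, l, X, v, u, B, A, S]"
lemmas recbeta_sel [ev] = def_sel[OF recbeta_d_def[unfolded hoas], unfolded ev]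
lemma recbeta_valid [ev]: "valid recbeta_d = True"
  by (rule chk_valid; simp only: ev cong: lazy_cong)

section \<open>The two total spaces\<close>

definition fib_d where
  "fib_d = mkd 29 True False []
   (PAR UU (\<lambda>A. PAR UU (\<lambda>X. PAR (ARR A X) (\<lambda>h. PAR X (\<lambda>x.
      FIN UU
      (SIG A (\<lambda>a. PATH X (h \<cdot> a) x)))))))"
abbreviation "fib A X h x \<equiv> con fib_d [x, h, X, A]"
lemmas fib_sel [ev] = def_sel[OF fib_d_def[unfolded hoas], unfolded ev]
lemma fib_valid [ev]: "valid fib_d = True"
  by (rule chk_valid; simp only: ev cong: lazy_cong)

definition join_d where
  "join_d = mkd 30 True False []
   (PAR UU (\<lambda>P. PAR UU (\<lambda>Q.
      FIN UU
      (PUSH (PRD P Q) P Q (LAM (PRD P Q) (\<lambda>c. FST P (\<lambda>_. Q) c)) (LAM (PRD P Q) (\<lambda>c. SND P (\<lambda>_. Q)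
        c))))))"
abbreviation "join P Q \<equiv> con join_d [Q, P]"
lemmas join_sel [ev] = def_sel[OF join_d_def[unfolded hoas], unfolded ev]
lemma join_valid [ev]: "valid join_d = True"
  by (rule chk_valid; simp only: ev cong: lazy_cong)

definition ovr where [hoas]:
  "ovr a = (\<lambda>b. PATH tyX (mapf \<cdot> a) (mapg \<cdot> b))"

definition tail where [hoas]:
  "tail a = (SIG tyB (ovr a))"

definition pb_d where
  "pb_d = mkd 31 True False []
   (FIN UU
      (SIG tyA tail))"
abbreviation "pb \<equiv> con pb_d []"
lemmas pb_sel [ev] = def_sel[OF pb_d_def[unfolded hoas], unfolded ev]
lemma pb_valid [ev]: "valid pb_d = True"
  by (rule chk_valid; simp only: ev cong: lazy_cong)

definition pr1_d where
  "pr1_d = mkd 32 True True [RULE 0 2 (PAR tyA (\<lambda>a. PAR (tail a) (\<lambda>t. FIN a UU)))]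
   (PAR pb (\<lambda>s.
      FIN tyA
      (FST tyA tail s)))"
abbreviation "pr1 s \<equiv> con pr1_d [s]"
lemmas pr1_sel [ev] = def_sel[OF pr1_d_def[unfolded hoas], unfolded ev]
lemma pr1_valid [ev]: "valid pr1_d = True"
  by (rule chk_valid; simp only: ev cong: lazy_cong)

definition pr2_d where
  "pr2_d = mkd 33 True True [RULE 0 2 (PAR tyA (\<lambda>a. PAR (tail a) (\<lambda>t. FIN (FST tyB (ovr a) t)
    UU)))]
   (PAR pb (\<lambda>s.
      FIN tyB
      (FST tyB (ovr (pr1 s)) (SND tyA tail s))))"
abbreviation "pr2 s \<equiv> con pr2_d [s]"
lemmas pr2_sel [ev] = def_sel[OF pr2_d_def[unfolded hoas], unfolded ev]
lemma pr2_valid [ev]: "valid pr2_d = True"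
  by (rule chk_valid; simp only: ev cong: lazy_cong)

definition pbhom_d where
  "pbhom_d = mkd 34 False True []
   (PAR pb (\<lambda>s.
      FIN (PATH tyX (mapf \<cdot> pr1 s) (mapg \<cdot> pr2 s))
      (SND tyB (ovr (pr1 s)) (SND tyA tail s))))"
abbreviation "pbhom s \<equiv> con pbhom_d [s]"
lemmas pbhom_sel [ev] = def_sel[OF pbhom_d_def[unfolded hoas], unfolded ev]
lemma pbhom_valid [ev]: "valid pbhom_d = True"
  by (rule chk_valid; simp only: ev cong: lazy_cong)

definition pi1 where [hoas]:
  "pi1 = (LAM pb (\<lambda>s. pr1 s))"

definition pi2 where [hoas]:
  "pi2 = (LAM pb (\<lambda>s. pr2 s))"

definition homl where [hoas]:
  "homl = (LAM pb (\<lambda>s. pbhom s))"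

definition jo_d where
  "jo_d = mkd 35 True False []
   (FIN UU
      (PUSH pb tyA tyB pi1 pi2))"
abbreviation "jo \<equiv> con jo_d []"
lemmas jo_sel [ev] = def_sel[OF jo_d_def[unfolded hoas], unfolded ev]
lemma jo_valid [ev]: "valid jo_d = True"
  by (rule chk_valid; simp only: ev cong: lazy_cong)

definition jmap_d where
  "jmap_d = mkd 36 True True [RULE 1 1 (PAR tyA (\<lambda>a. FIN (mapf \<cdot> a) UU)),
     RULE 2 1 (PAR tyB (\<lambda>b. FIN (mapg \<cdot> b) UU))]
   (PAR jo (\<lambda>w.
      FIN tyX
      (prec pb tyA tyB pi1 pi2 tyX mapf mapg homl w)))"
abbreviation "jmap w \<equiv> con jmap_d [w]"
lemmas jmap_sel [ev] = def_sel[OF jmap_d_def[unfolded hoas], unfolded ev]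
lemma jmap_valid [ev]: "valid jmap_d = True"
  by (rule chk_valid; simp only: ev cong: lazy_cong)

definition fA_d where
  "fA_d = mkd 37 True False []
   (PAR tyX (\<lambda>y.
      FIN UU
      (fib tyA tyX mapf y)))"
abbreviation "fA y \<equiv> con fA_d [y]"
lemmas fA_sel [ev] = def_sel[OF fA_d_def[unfolded hoas], unfolded ev]
lemma fA_valid [ev]: "valid fA_d = True"
  by (rule chk_valid; simp only: ev cong: lazy_cong)

definition fB_d where
  "fB_d = mkd 38 True False []
   (PAR tyX (\<lambda>y.
      FIN UU
      (fib tyB tyX mapg y)))"
abbreviation "fB y \<equiv> con fB_d [y]"
lemmas fB_sel [ev] = def_sel[OF fB_d_def[unfolded hoas], unfolded ev]
lemma fB_valid [ev]: "valid fB_d = True"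
  by (rule chk_valid; simp only: ev cong: lazy_cong)

definition jf_d where
  "jf_d = mkd 39 True False []
   (PAR tyX (\<lambda>y.
      FIN UU
      (join (fA y) (fB y))))"
abbreviation "jf y \<equiv> con jf_d [y]"
lemmas jf_sel [ev] = def_sel[OF jf_d_def[unfolded hoas], unfolded ev]
lemma jf_valid [ev]: "valid jf_d = True"
  by (rule chk_valid; simp only: ev cong: lazy_cong)

definition tot_d where
  "tot_d = mkd 40 True False []
   (FIN UU
      (SIG tyX (\<lambda>y. jf y)))"
abbreviation "tot \<equiv> con tot_d []"
lemmas tot_sel [ev] = def_sel[OF tot_d_def[unfolded hoas], unfolded ev]
lemma tot_valid [ev]: "valid tot_d = True"
  by (rule chk_valid; simp only: ev cong: lazy_cong)

definition inlJ where [hoas]: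
  "inlJ y a q = (INL (jf y) (PAIR (fA y) a q))"

definition inrJ where [hoas]:
  "inrJ y b r = (INR (jf y) (PAIR (fB y) b r))"

definition il where [hoas]:
  "il y a q = (PAIR tot y (inlJ y a q))"

definition ir where [hoas]:
  "ir y b r = (PAIR tot y (inrJ y b r))"

definition fa where [hoas]:
  "fa a = (il (mapf \<cdot> a) a (REFL (mapf \<cdot> a)))"

definition gb where [hoas]:
  "gb b = (ir (mapg \<cdot> b) b (REFL (mapg \<cdot> b)))"

text \<open>
  \<open>slidel\<close> and \<open>slider\<close> move the base point of a canonical element along the path it carries.
\<close>

definition slidel_d where
  "slidel_d = mkd 41 False True []
   (PAR tyA (\<lambda>a. PAR tyX (\<lambda>y. PAR (PATH tyX (mapf \<cdot> a) y) (\<lambda>q.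
      FIN (PATH tot (fa a) (il y a q))
      (JJ tyX (\<lambda>y q. PATH tot (fa a) (il y a q)) (REFL (fa a)) (mapf \<cdot> a) y q)))))"
abbreviation "slidel a y q \<equiv> con slidel_d [q, y, a]"
lemmas slidel_sel [ev] = def_sel[OF slidel_d_def[unfolded hoas], unfolded ev]
lemma slidel_valid [ev]: "valid slidel_d = True"
  by (rule chk_valid; simp only: ev cong: lazy_cong)

definition slider_d where
  "slider_d = mkd 42 False True []
   (PAR tyB (\<lambda>b. PAR tyX (\<lambda>y. PAR (PATH tyX (mapg \<cdot> b) y) (\<lambda>r.
      FIN (PATH tot (gb b) (ir y b r))
      (JJ tyX (\<lambda>y r. PATH tot (gb b) (ir y b r)) (REFL (gb b)) (mapg \<cdot> b) y r)))))"
abbreviation "slider b y r \<equiv> con slider_d [r, y, b]"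
lemmas slider_sel [ev] = def_sel[OF slider_d_def[unfolded hoas], unfolded ev]
lemma slider_valid [ev]: "valid slider_d = True"
  by (rule chk_valid; simp only: ev cong: lazy_cong)

definition incl where [hoas]:
  "incl y = (LAM (jf y) (\<lambda>z. PAIR tot y z))"

definition fAB where [hoas]:
  "fAB y = (PRD (fA y) (fB y))"

definition pq where [hoas]:
  "pq a b y q r = (PAIR (fAB y) (PAIR (fA y) a q) (PAIR (fB y) b r))"

definition gl where [hoas]:
  "gl a b p = (GLUE (jf (mapg \<cdot> b)) (pq a b (mapg \<cdot> b) p (REFL (mapg \<cdot> b))))"

text \<open>
  \<open>meet\<close> is the image of \<open>Glue (a, b, p)\<close> under \<open>fwd\<close>: first slide from \<open>f a\<close> to \<open>g b\<close>, then glue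
  inside the join over \<open>g b\<close>.
\<close>

definition meet_d where
  "meet_d = mkd 43 True False []
   (PAR tyA (\<lambda>a. PAR tyB (\<lambda>b. PAR (PATH tyX (mapf \<cdot> a) (mapg \<cdot> b)) (\<lambda>p.
      FIN (PATH tot (fa a) (gb b))
      (let y = mapg \<cdot> b in pcat tot (fa a) (il y a p) (gb b) (slidel a y p)
      (ap (jf y) tot (incl y) (inlJ y a p) (inrJ y b (REFL y)) (gl a b p)))))))"
abbreviation "meet a b p \<equiv> con meet_d [p, b, a]"
lemmas meet_sel [ev] = def_sel[OF meet_d_def[unfolded hoas], unfolded ev]
lemma meet_valid [ev]: "valid meet_d = True"
  by (rule chk_valid; simp only: ev cong: lazy_cong)

definition fl where [hoas]:
  "fl = (LAM tyA fa)"

definition fr where [hoas]: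
  "fr = (LAM tyB gb)"

definition fh where [hoas]:
  "fh = (LAM pb (\<lambda>s. meet (pr1 s) (pr2 s) (pbhom s)))"

definition fwd_d where
  "fwd_d = mkd 44 True True [RULE 1 1 (PAR tyA (\<lambda>a. FIN (fa a) UU)),
     RULE 2 1 (PAR tyB (\<lambda>b. FIN (gb b) UU))]
   (PAR jo (\<lambda>w.
      FIN tot
      (prec pb tyA tyB pi1 pi2 tot fl fr fh w)))"
abbreviation "fwd w \<equiv> con fwd_d [w]"
lemmas fwd_sel [ev] = def_sel[OF fwd_d_def[unfolded hoas], unfolded ev]
lemma fwd_valid [ev]: "valid fwd_d = True"
  by (rule chk_valid; simp only: ev cong: lazy_cong)

definition pA where [hoas]:
  "pA y = (\<lambda>a. PATH tyX (mapf \<cdot> a) y)"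

definition pB where [hoas]:
  "pB y = (\<lambda>b. PATH tyX (mapg \<cdot> b) y)"

definition ptA_d where
  "ptA_d = mkd 45 True True []
   (PAR tyX (\<lambda>y. PAR (fA y) (\<lambda>t.
      FIN tyA
      (FST tyA (pA y) t))))"
abbreviation "ptA y t \<equiv> con ptA_d [t, y]"
lemmas ptA_sel [ev] = def_sel[OF ptA_d_def[unfolded hoas], unfolded ev]
lemma ptA_valid [ev]: "valid ptA_d = True"
  by (rule chk_valid; simp only: ev cong: lazy_cong)

definition ptB_d where
  "ptB_d = mkd 46 True True []
   (PAR tyX (\<lambda>y. PAR (fB y) (\<lambda>t.
      FIN tyB
      (FST tyB (pB y) t))))"
abbreviation "ptB y t \<equiv> con ptB_d [t, y]"
lemmas ptB_sel [ev] = def_sel[OF ptB_d_def[unfolded hoas], unfolded ev]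
lemma ptB_valid [ev]: "valid ptB_d = True"
  by (rule chk_valid; simp only: ev cong: lazy_cong)

definition mkS where [hoas]:
  "mkS a b p = (PAIR pb a (PAIR (tail a) b p))"

text \<open>
  The image of \<open>Glue ((a, q), (b, r))\<close> under \<open>backy\<close>.  Induction on \<open>r\<close> (rather than gluing along
  \<open>q\<close> followed by the inverse of \<open>r\<close>) makes it \<open>Glue (a, b, q)\<close> judgementally when \<open>r\<close> is reflexivity.
\<close>

definition tri_d where
  "tri_d = mkd 47 False True []
   (PAR tyA (\<lambda>a. PAR tyB (\<lambda>b. PAR tyX (\<lambda>y. PAR (PATH tyX (mapf \<cdot> a) y) (\<lambda>q.
     PAR (PATH tyX (mapg \<cdot> b) y) (\<lambda>r.
      FIN (PATH jo (INL jo a) (INR jo b))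
      (JJ tyX (\<lambda>y r. ARR (PATH tyX (mapf \<cdot> a) y) (PATH jo (INL jo a) (INR jo b)))
      (LAM (PATH tyX (mapf \<cdot> a) (mapg \<cdot> b)) (\<lambda>p. GLUE jo (mkS a b p))) (mapg \<cdot> b) y r \<cdot> q)))))))"
abbreviation "tri a b y q r \<equiv> con tri_d [r, q, y, b, a]"
lemmas tri_sel [ev] = def_sel[OF tri_d_def[unfolded hoas], unfolded ev]
lemma tri_valid [ev]: "valid tri_d = True"
  by (rule chk_valid; simp only: ev cong: lazy_cong)

definition jfst_d where
  "jfst_d = mkd 48 True True [RULE 0 2 (PAR tyX (\<lambda>y. PAR (fA y) (\<lambda>t. PAR (fB y) (\<lambda>u. FIN t UU))))]
   (PAR tyX (\<lambda>y. PAR (fAB y) (\<lambda>c.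
      FIN (fA y)
      (FST (fA y) (\<lambda>_. fB y) c))))"
abbreviation "jfst y c \<equiv> con jfst_d [c, y]"
lemmas jfst_sel [ev] = def_sel[OF jfst_d_def[unfolded hoas], unfolded ev]
lemma jfst_valid [ev]: "valid jfst_d = True"
  by (rule chk_valid; simp only: ev cong: lazy_cong)

definition jsnd_d where
  "jsnd_d = mkd 49 True True [RULE 0 2 (PAR tyX (\<lambda>y. PAR (fA y) (\<lambda>t. PAR (fB y) (\<lambda>u. FIN u UU))))]
   (PAR tyX (\<lambda>y. PAR (fAB y) (\<lambda>c.
      FIN (fB y)
      (SND (fA y) (\<lambda>_. fB y) c))))"
abbreviation "jsnd y c \<equiv> con jsnd_d [c, y]"
lemmas jsnd_sel [ev] = def_sel[OF jsnd_d_def[unfolded hoas], unfolded ev]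
lemma jsnd_valid [ev]: "valid jsnd_d = True"
  by (rule chk_valid; simp only: ev cong: lazy_cong)

definition jl where [hoas]:
  "jl y = (LAM (fAB y) (\<lambda>c. jfst y c))"

definition jr where [hoas]:
  "jr y = (LAM (fAB y) (\<lambda>c. jsnd y c))"

definition bh where [hoas]:
  "bh y = (LAM (fAB y) (\<lambda>c. tri (ptA y (jfst y c)) (ptB y (jsnd y c)) y
    (SND tyA (pA y) (jfst y c)) (SND tyB (pB y) (jsnd y c))))"

definition bl where [hoas]:
  "bl y = (LAM (fA y) (\<lambda>t. INL jo (ptA y t)))"

definition br where [hoas]:
  "br y = (LAM (fB y) (\<lambda>t. INR jo (ptB y t)))"

definition backy_d where
  "backy_d = mkd 50 True True [RULE 1 1 (PAR tyX (\<lambda>y. PAR (fA y) (\<lambda>t. FIN (INL jo (ptA y t))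
    UU))),
     RULE 2 1 (PAR tyX (\<lambda>y. PAR (fB y) (\<lambda>t. FIN (INR jo (ptB y t)) UU)))]
   (PAR tyX (\<lambda>y. PAR (jf y) (\<lambda>z.
      FIN jo
      (prec (fAB y) (fA y) (fB y) (jl y) (jr y) jo (bl y) (br y) (bh y) z))))"
abbreviation "backy y z \<equiv> con backy_d [z, y]"
lemmas backy_sel [ev] = def_sel[OF backy_d_def[unfolded hoas], unfolded ev]
lemma backy_valid [ev]: "valid backy_d = True"
  by (rule chk_valid; simp only: ev cong: lazy_cong)

definition back_d where
  "back_d = mkd 51 True True [RULE 0 2 (PAR tyX (\<lambda>y. PAR (jf y) (\<lambda>z. FIN (backy y z) UU)))]
   (PAR tot (\<lambda>v.
      FIN jo
      (INDSIG tyX (\<lambda>y. jf y) (\<lambda>_. jo) (\<lambda>y z. backy y z) v)))"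
abbreviation "back v \<equiv> con back_d [v]"
lemmas back_sel [ev] = def_sel[OF back_d_def[unfolded hoas], unfolded ev]
lemma back_valid [ev]: "valid back_d = True"
  by (rule chk_valid; simp only: ev cong: lazy_cong)

definition fwdL where [hoas]:
  "fwdL = (LAM jo (\<lambda>w. fwd w))"

definition hL where [hoas]:
  "hL = (LAM jo (\<lambda>w. jmap w))"

definition base_pt where [hoas]:
  "base_pt v = (FST tyX (\<lambda>y. jf y) v)"

definition prL where [hoas]:
  "prL = (LAM tot base_pt)"

definition backL where [hoas]:
  "backL = (LAM tot (\<lambda>v. back v))"

definition byL where [hoas]:
  "byL y = (LAM (jf y) (\<lambda>z. backy y z))"

section \<open>Compatibility with the maps to the base\<close>

text \<open>The path \<open>k\<close> with free end \<open>z\<close> stands for the glue part of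
  \<open>meet\<close>, so that path induction applies. It lies over the fixed point \<open>y\<close>
  and vanishes under the projection; what remains is the slide, which projects to \<open>p\<close>
  by induction on \<open>p\<close>.\<close>

definition prmeet_d where
  "prmeet_d = mkd 52 False False []
   (PAR tyA (\<lambda>a. PAR tyX (\<lambda>y. PAR (PATH tyX (mapf \<cdot> a) y) (\<lambda>p. PAR (jf y) (\<lambda>z.
     PAR (PATH (jf y) (inlJ y a p) z) (\<lambda>k.
      FIN (PATH (PATH tyX (mapf \<cdot> a) y) (ap tot tyX prL (fa a) (PAIR tot y z) (pcat tot (fa a) (il
        y a p) (PAIR tot y z) (slidel a y p) (ap (jf y) tot (incl y) (inlJ y a p) z k))) p)
      (JJ (jf y) (\<lambda>z k. PATH (PATH tyX (mapf \<cdot> a) y) (ap tot tyX prL (fa a) (PAIR tot y z) (pcat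
        tot (fa a) (il y a p) (PAIR tot y z) (slidel a y p) (ap (jf y) tot (incl y) (inlJ y a p)
        z k))) p)
      (JJ tyX (\<lambda>y p. PATH (PATH tyX (mapf \<cdot> a) y) (ap tot tyX prL (fa a) (il y a p) (slidel a y p))
        p)
        (REFL (REFL (mapf \<cdot> a))) (mapf \<cdot> a) y p) (inlJ y a p) z k)))))))"
abbreviation "prmeet a y p z k \<equiv> con prmeet_d [k, z, p, y, a]"
lemmas prmeet_sel [ev] = def_sel[OF prmeet_d_def[unfolded hoas], unfolded ev]
lemma prmeet_valid [ev]: "valid prmeet_d = True"
  by (rule chk_valid; simp only: ev cong: lazy_cong)

definition recw where [hoas]:
  "recw X l r H s = (recbeta pb tyA tyB pi1 pi2 X l r H s)"

definition Ipt where [hoas]: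
  "Ipt s = (INL jo (pr1 s))"

definition Jpt where [hoas]:
  "Jpt s = (INR jo (pr2 s))"

definition nL where [hoas]:
  "nL = (LAM jo (\<lambda>w. base_pt (fwd w)))"

text \<open>Both sides equal the path \<open>p\<close> stored in \<open>s\<close>: on one side by
  the computation rule of \<open>fwd\<close> on \<open>Glue\<close> followed by
  \<open>prmeet\<close>, on the other by the computation rule of \<open>jmap\<close>.\<close>

definition Hsq_d where
  "Hsq_d = mkd 53 False False []
   (PAR pb (\<lambda>s.
      FIN (let a = pr1 s; i = Ipt s; j = Jpt s; e = GLUE jo s in
    PATH (PATH tyX (mapf \<cdot> a) (mapg \<cdot> pr2 s)) (pcat tyX (mapf \<cdot> a) (mapf \<cdot> a) (mapg \<cdot> pr2 s) (REFL
      (mapf \<cdot> a)) (ap jo tyX nL i j e)) (ap jo tyX hL i j e))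
      (let a = pr1 s; b = pr2 s; p = pbhom s; T = PATH tyX (mapf \<cdot> a) (mapg \<cdot> b); i = Ipt s; j = Jpt
        s; e = GLUE jo s;
      t1 = ap jo tyX nL i j e; TW = PATH tot (fa a) (gb b); af = (\<lambda>q. ap tot tyX prL (fa a) (gb
        b) q);
      ef = ap jo tot fwdL i j e; t4 = ap jo tyX hL i j e in
    chain5 T (pcat tyX (mapf \<cdot> a) (mapf \<cdot> a) (mapg \<cdot> b) (REFL (mapf \<cdot> a)) t1) t1 (af ef) (af (meet a b
      p)) p t4
      (lunit tyX (mapf \<cdot> a) (mapg \<cdot> b) t1) (apcomp jo tot tyX fwdL prL i j e)
      (ap TW T (LAM TW af) ef (meet a b p) (recw tot fl fr fh s))
      (prmeet a (mapg \<cdot> b) p (inrJ (mapg \<cdot> b) b (REFL (mapg \<cdot> b))) (gl a b p))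
      (psym T t4 p (recw tyX mapf mapg homl s)))))"
abbreviation "Hsq s \<equiv> con Hsq_d [s]"
lemmas Hsq_sel [ev] = def_sel[OF Hsq_d_def[unfolded hoas], unfolded ev]
lemma Hsq_valid [ev]: "valid Hsq_d = True"
  by (rule chk_valid; simp only: ev cong: lazy_cong)

definition jmapfwd_d where
  "jmapfwd_d = mkd 54 False False []
   (PAR jo (\<lambda>w.
      FIN (PATH tyX (jmap w) (base_pt (fwd w)))
      (pushhtpy pb tyA tyB pi1 pi2 tyX hL nL (LAM tyA (\<lambda>a. REFL (mapf \<cdot> a))) (LAM tyB (\<lambda>b. REFL
        (mapg \<cdot> b))) (LAM pb (\<lambda>s. Hsq s)) w)))"
abbreviation "jmapfwd w \<equiv> con jmapfwd_d [w]"
lemmas jmapfwd_sel [ev] = def_sel[OF jmapfwd_d_def[unfolded hoas], unfolded ev]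
lemma jmapfwd_valid [ev]: "valid jmapfwd_d = True"
  by (rule chk_valid; simp only: ev cong: lazy_cong)

section \<open>The round trips\<close>

text \<open>The generality in \<open>z\<close> and \<open>k\<close> again serves path induction.
  \<open>back\<close> sends each \<open>il y a q\<close> to \<open>INL jo a\<close> whatever
  \<open>q\<close> is, hence it turns the slide into reflexivity and only the glue part
  survives.\<close>

definition backmeet_d where
  "backmeet_d = mkd 55 False False []
   (PAR tyA (\<lambda>a. PAR tyX (\<lambda>y. PAR (PATH tyX (mapf \<cdot> a) y) (\<lambda>p. PAR (jf y) (\<lambda>z.
     PAR (PATH (jf y) (inlJ y a p) z) (\<lambda>k.
      FIN (PATH (PATH jo (INL jo a) (backy y z)) (ap tot jo backL (fa a) (PAIR tot y z) (pcat tot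
        (fa a) (il y a p) (PAIR tot y z) (slidel a y p) (ap (jf y) tot (incl y) (inlJ y a p) z
        k))) (ap (jf y) jo (byL y) (inlJ y a p) z k))
      (JJ (jf y) (\<lambda>z k. PATH (PATH jo (INL jo a) (backy y z)) (ap tot jo backL (fa a) (PAIR tot y
        z) (pcat tot (fa a) (il y a p) (PAIR tot y z) (slidel a y p) (ap (jf y) tot (incl y)
        (inlJ y a p) z k))) (ap (jf y) jo (byL y) (inlJ y a p) z k))
      (JJ tyX (\<lambda>y p. PATH (PATH jo (INL jo a) (INL jo a)) (ap tot jo backL (fa a) (il y a p)
        (slidel a y p)) (REFL (INL jo a)))
        (REFL (REFL (INL jo a))) (mapf \<cdot> a) y p) (inlJ y a p) z k)))))))"
abbreviation "backmeet a y p z k \<equiv> con backmeet_d [k, z, p, y, a]"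
lemmas backmeet_sel [ev] = def_sel[OF backmeet_d_def[unfolded hoas], unfolded ev]
lemma backmeet_valid [ev]: "valid backmeet_d = True"
  by (rule chk_valid; simp only: ev cong: lazy_cong)

text \<open>Over \<open>g b\<close> the second path of the glued pair is reflexivity, where
  \<open>tri\<close> computes to the glue of the triple. The computation rule of the recursor
  therefore has the stated type already.\<close>

definition backglue_d where
  "backglue_d = mkd 56 False False []
   (PAR tyA (\<lambda>a. PAR tyB (\<lambda>b. PAR (PATH tyX (mapf \<cdot> a) (mapg \<cdot> b)) (\<lambda>p.
      FIN (let y = mapg \<cdot> b in PATH (PATH jo (INL jo a) (INR jo b))
      (ap (jf y) jo (byL y) (inlJ y a p) (inrJ y b (REFL y)) (gl a b p)) (GLUE jo (mkS a b p)))
      (let y = mapg \<cdot> b in recbeta (fAB y) (fA y) (fB y) (jl y) (jr y) jo (bl y) (br y) (bh y) (pq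
        a b y p (REFL y)))))))"
abbreviation "backglue a b p \<equiv> con backglue_d [p, b, a]"
lemmas backglue_sel [ev] = def_sel[OF backglue_d_def[unfolded hoas], unfolded ev]
lemma backglue_valid [ev]: "valid backglue_d = True"
  by (rule chk_valid; simp only: ev cong: lazy_cong)

definition fwdglue_d where
  "fwdglue_d = mkd 57 False False []
   (PAR tyA (\<lambda>a. PAR tyB (\<lambda>b. PAR (PATH tyX (mapf \<cdot> a) (mapg \<cdot> b)) (\<lambda>p.
      FIN (PATH (PATH tot (fa a) (gb b)) (ap jo tot fwdL (INL jo a) (INR jo b) (GLUE jo (mkS a b
        p))) (meet a b p))
      (recw tot fl fr fh (mkS a b p))))))"
abbreviation "fwdglue a b p \<equiv> con fwdglue_d [p, b, a]"
lemmas fwdglue_sel [ev] = def_sel[OF fwdglue_d_def[unfolded hoas], unfolded ev]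
lemma fwdglue_valid [ev]: "valid fwdglue_d = True"
  by (rule chk_valid; simp only: ev cong: lazy_cong)

definition idW where [hoas]:
  "idW = (LAM jo (\<lambda>w. w))"

definition bfL where [hoas]:
  "bfL = (LAM jo (\<lambda>w. back (fwd w)))"

definition sq1T where [hoas]:
  "sq1T i j e = (PATH (PATH jo i j) (pcat jo i i j (REFL i) (ap jo jo idW i j e)) (ap jo jo bfL i
    j e))"

text \<open>With reflexivity on points the square says that \<open>back\<close> after
  \<open>fwd\<close> fixes the glue path: \<open>fwd\<close> takes it to \<open>meet\<close>, and
  \<open>back\<close> returns it by \<open>backmeet\<close> and \<open>backglue\<close>.\<close>

definition sq1_d where
  "sq1_d = mkd 58 False False []
   (PAR tyA (\<lambda>a. PAR tyB (\<lambda>b. PAR (PATH tyX (mapf \<cdot> a) (mapg \<cdot> b)) (\<lambda>p.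
      FIN (sq1T (INL jo a) (INR jo b) (GLUE jo (mkS a b p)))
      (let i = INL jo a; j = INR jo b; e = GLUE jo (mkS a b p); T = PATH jo i j; y = mapg \<cdot> b; TW =
        PATH tot (fa a) (gb b);
      t1 = ap jo jo idW i j e; tm = ap jo jo bfL i j e; ef = ap jo tot fwdL i j e;
      ab = (\<lambda>q. ap tot jo backL (fa a) (gb b) q); t4 = ap (jf y) jo (byL y) (inlJ y a p) (inrJ y
        b (REFL y)) (gl a b p) in
    chain3 T (pcat jo i i j (REFL i) t1) t1 e tm (lunit jo i j t1) (apid jo i j e)
      (psym T tm e (chain4 T tm (ab ef) (ab (meet a b p)) t4 e
        (apcomp jo tot jo fwdL backL i j e) (ap TW T (LAM TW ab) ef (meet a b p) (fwdglue a b p))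
        (backmeet a y p (inrJ y b (REFL y)) (gl a b p)) (backglue a b p))))))))"
abbreviation "sq1 a b p \<equiv> con sq1_d [p, b, a]"
lemmas sq1_sel [ev] = def_sel[OF sq1_d_def[unfolded hoas], unfolded ev]
lemma sq1_valid [ev]: "valid sq1_d = True"
  by (rule chk_valid; simp only: ev cong: lazy_cong)

definition sq1S where [hoas]:
  "sq1S s = (sq1T (Ipt s) (Jpt s) (GLUE jo s))"

text \<open>Without eta a general \<open>s\<close> is not judgementally a triple, so the square is
  carried over by two Sigma inductions.\<close>

definition sq1s_d where
  "sq1s_d = mkd 59 False False []
   (PAR pb (\<lambda>s.
      FIN (sq1S s)
      (INDSIG tyA tail sq1S (\<lambda>a t. INDSIG tyB (ovr a) (\<lambda>t. sq1S (PAIR pb a t))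
      (\<lambda>b p. sq1 a b p) t) s)))"
abbreviation "sq1s s \<equiv> con sq1s_d [s]"
lemmas sq1s_sel [ev] = def_sel[OF sq1s_d_def[unfolded hoas], unfolded ev]
lemma sq1s_valid [ev]: "valid sq1s_d = True"
  by (rule chk_valid; simp only: ev cong: lazy_cong)

definition backfwd_d where
  "backfwd_d = mkd 60 False False []
   (PAR jo (\<lambda>w.
      FIN (PATH jo (back (fwd w)) w)
      (pushhtpy pb tyA tyB pi1 pi2 jo bfL idW (LAM tyA (\<lambda>a. REFL (INL jo a))) (LAM tyB (\<lambda>b. REFL
        (INR jo b))) (LAM pb (\<lambda>s. sq1s s)) w)))"
abbreviation "backfwd w \<equiv> con backfwd_d [w]"
lemmas backfwd_sel [ev] = def_sel[OF backfwd_d_def[unfolded hoas], unfolded ev]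
lemma backfwd_valid [ev]: "valid backfwd_d = True"
  by (rule chk_valid; simp only: ev cong: lazy_cong)

definition hlT where [hoas]:
  "hlT y t = (PATH tot (fa (ptA y t)) (PAIR tot y (INL (jf y) t)))"

definition hrT where [hoas]:
  "hrT y t = (PATH tot (gb (ptB y t)) (PAIR tot y (INR (jf y) t)))"

text \<open>On a literal pair this is the slide from the canonical point over \<open>f a\<close>; a
  variable of the fiber is first split.\<close>

definition hl_d where
  "hl_d = mkd 61 False True []
   (PAR tyX (\<lambda>y. PAR (fA y) (\<lambda>t.
      FIN (hlT y t)
      (INDSIG tyA (pA y) (\<lambda>t. hlT y t) (\<lambda>a q. slidel a y q) t))))"
abbreviation "hl y t \<equiv> con hl_d [t, y]"
lemmas hl_sel [ev] = def_sel[OF hl_d_def[unfolded hoas], unfolded ev]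
lemma hl_valid [ev]: "valid hl_d = True"
  by (rule chk_valid; simp only: ev cong: lazy_cong)

definition hr_d where
  "hr_d = mkd 62 False True []
   (PAR tyX (\<lambda>y. PAR (fB y) (\<lambda>t.
      FIN (hrT y t)
      (INDSIG tyB (pB y) (\<lambda>t. hrT y t) (\<lambda>b r. slider b y r) t))))"
abbreviation "hr y t \<equiv> con hr_d [t, y]"
lemmas hr_sel [ev] = def_sel[OF hr_d_def[unfolded hoas], unfolded ev]
lemma hr_valid [ev]: "valid hr_d = True"
  by (rule chk_valid; simp only: ev cong: lazy_cong)

definition mL where [hoas]:
  "mL y = (LAM (jf y) (\<lambda>z. fwd (backy y z)))"

text \<open>The only case of the second round trip that remains after path induction. With a trivial
  right slide, one side of the square is \<open>meet\<close> by definition, and the other follows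
  from the computation rules of \<open>backy\<close> and \<open>fwd\<close> on glue.\<close>

definition core_d where
  "core_d = mkd 63 False False []
   (PAR tyA (\<lambda>a. PAR tyB (\<lambda>b. PAR (PATH tyX (mapf \<cdot> a) (mapg \<cdot> b)) (\<lambda>p.
      FIN (let y = mapg \<cdot> b in PATH (PATH tot (fa a) (gb b)) (meet a b p)
      (ap (jf y) tot (mL y) (inlJ y a p) (inrJ y b (REFL y)) (gl a b p)))
      (let y = mapg \<cdot> b; s = mkS a b p; T = PATH tot (fa a) (gb b); i = inlJ y a p; j = inrJ y b
        (REFL y); k = gl a b p;
      tm = ap (jf y) tot (mL y) i j k; TW = PATH jo (INL jo a) (INR jo b); bk = ap (jf y) jo (byL
        y) i j k;
      af = (\<lambda>q. ap jo tot fwdL (INL jo a) (INR jo b) q) in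
    psym T tm (meet a b p) (chain3 T tm (af bk) (af (GLUE jo s)) (meet a b p)
      (apcomp (jf y) jo tot (byL y) fwdL i j k) (ap TW T (LAM TW af) bk (GLUE jo s) (backglue a b
        p)) (fwdglue a b p)))))))"
abbreviation "core a b p \<equiv> con core_d [p, b, a]"
lemmas core_sel [ev] = def_sel[OF core_d_def[unfolded hoas], unfolded ev]
lemma core_valid [ev]: "valid core_d = True"
  by (rule chk_valid; simp only: ev cong: lazy_cong)

definition sq2T where [hoas]:
  "sq2T v0 v1 y t u c sl sr = (let i = INL (jf y) t; j = INR (jf y) u; k = GLUE (jf y) c; w0 =
    PAIR tot y i; w1 = PAIR tot y j in
    PATH (PATH tot v0 w1) (pcat tot v0 w0 w1 sl (ap (jf y) tot (incl y) i j k))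
      (pcat tot v0 v1 w1 (ap (jf y) tot (mL y) i j k) sr))"

definition sq2C where [hoas]:
  "sq2C a b y q r = (sq2T (fa a) (gb b) y (PAIR (fA y) a q) (PAIR (fB y) b r) (pq a b y q r)
    (slidel a y q) (slider b y r))"

text \<open>Induction on \<open>r\<close> moves the base point to \<open>g b\<close>. The path
  \<open>q\<close> ends at that point too, so the motive quantifies over it.\<close>

definition sq2_d where
  "sq2_d = mkd 64 False False []
   (PAR tyA (\<lambda>a. PAR tyB (\<lambda>b. PAR tyX (\<lambda>y. PAR (PATH tyX (mapf \<cdot> a) y) (\<lambda>q.
     PAR (PATH tyX (mapg \<cdot> b) y) (\<lambda>r.
      FIN (sq2C a b y q r)
      (JJ tyX (\<lambda>y r. PI (PATH tyX (mapf \<cdot> a) y) (\<lambda>q. sq2C a b y q r))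
      (LAM (PATH tyX (mapf \<cdot> a) (mapg \<cdot> b)) (\<lambda>p. core a b p)) (mapg \<cdot> b) y r \<cdot> q)))))))"
abbreviation "sq2 a b y q r \<equiv> con sq2_d [r, q, y, b, a]"
lemmas sq2_sel [ev] = def_sel[OF sq2_d_def[unfolded hoas], unfolded ev]
lemma sq2_valid [ev]: "valid sq2_d = True"
  by (rule chk_valid; simp only: ev cong: lazy_cong)

definition sq2S where [hoas]:
  "sq2S y c = (sq2T (fa (ptA y (jfst y c))) (gb (ptB y (jsnd y c))) y (jfst y c) (jsnd y c) c (hl
    y (jfst y c)) (hr y (jsnd y c)))"

text \<open>Three splittings bring a general element of the product to a pair of literal pairs, for
  which \<open>sq2\<close> is stated.\<close>

definition sq2s_d where
  "sq2s_d = mkd 65 False False []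
   (PAR tyX (\<lambda>y. PAR (fAB y) (\<lambda>c.
      FIN (sq2S y c)
      (INDSIG (fA y) (\<lambda>_. fB y) (sq2S y) (\<lambda>t u.
      INDSIG tyA (pA y) (\<lambda>t. sq2S y (PAIR (fAB y) t u)) (\<lambda>a q.
        INDSIG tyB (pB y) (\<lambda>u. sq2S y (PAIR (fAB y) (PAIR (fA y) a q) u)) (\<lambda>b r. sq2 a b y q r)
          u) t) c))))"
abbreviation "sq2s y c \<equiv> con sq2s_d [c, y]"
lemmas sq2s_sel [ev] = def_sel[OF sq2s_d_def[unfolded hoas], unfolded ev]
lemma sq2s_valid [ev]: "valid sq2s_d = True"
  by (rule chk_valid; simp only: ev cong: lazy_cong)

definition fwdbacky_d where
  "fwdbacky_d = mkd 66 False False []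
   (PAR tyX (\<lambda>y. PAR (jf y) (\<lambda>z.
      FIN (PATH tot (fwd (backy y z)) (PAIR tot y z))
      (pushhtpy (fAB y) (fA y) (fB y) (jl y) (jr y) tot (mL y) (incl y) (LAM (fA y) (\<lambda>t. hl y t))
        (LAM (fB y) (\<lambda>t. hr y t))
      (LAM (fAB y) (\<lambda>c. sq2s y c)) z))))"
abbreviation "fwdbacky y z \<equiv> con fwdbacky_d [z, y]"
lemmas fwdbacky_sel [ev] = def_sel[OF fwdbacky_d_def[unfolded hoas], unfolded ev]
lemma fwdbacky_valid [ev]: "valid fwdbacky_d = True"
  by (rule chk_valid; simp only: ev cong: lazy_cong)

definition fwdback_d where
  "fwdback_d = mkd 67 False False []
   (PAR tot (\<lambda>v.
      FIN (PATH tot (fwd (back v)) v)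
      (INDSIG tyX (\<lambda>y. jf y) (\<lambda>v. PATH tot (fwd (back v)) v) (\<lambda>y z. fwdbacky y z) v)))"
abbreviation "fwdback v \<equiv> con fwdback_d [v]"
lemmas fwdback_sel [ev] = def_sel[OF fwdback_d_def[unfolded hoas], unfolded ev]
lemma fwdback_valid [ev]: "valid fwdback_d = True"
  by (rule chk_valid; simp only: ev cong: lazy_cong)

section \<open>Equivalences\<close>

definition SECT where [hoas]:
  "SECT A B f = (SIG (ARR B A) (\<lambda>k. PI B (\<lambda>x. PATH B (f (k \<cdot> x)) x)))"

definition RETR where [hoas]:
  "RETR A B f = (SIG (ARR B A) (\<lambda>k. PI A (\<lambda>x. PATH A (k \<cdot> f x) x)))"

text \<open>The beta-normal form of \<open>Equiv\<close>: the composites and identities in the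
  homotopies are already applied to their argument. It is the form in which inferred types
  appear.\<close>

definition eqv_d where
  "eqv_d = mkd 68 True False []
   (PAR UU (\<lambda>A. PAR UU (\<lambda>B.
      FIN UU
      (SIG (ARR A B) (\<lambda>f. PRD (SECT A B (app f)) (RETR A B (app f)))))))"
abbreviation "eqv A B \<equiv> con eqv_d [B, A]"
lemmas eqv_sel [ev] = def_sel[OF eqv_d_def[unfolded hoas], unfolded ev]
lemma eqv_valid [ev]: "valid eqv_d = True"
  by (rule chk_valid; simp only: ev cong: lazy_cong)

definition EQUIV where [hoas]:
  "EQUIV A B f k s r = (PAIR (eqv A B) (LAM A f)
    (PAIR (PRD (SECT A B f) (RETR A B f)) (PAIR (SECT A B f) k s) (PAIR (RETR A B f) k r)))"

definition fibpr_d where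
  "fibpr_d = mkd 69 True False []
   (PAR UU (\<lambda>X. PAR (ARR X UU) (\<lambda>D. PAR X (\<lambda>x.
      FIN UU
      (SIG (SIG X (\<lambda>y. D \<cdot> y)) (\<lambda>v. PATH X (FST X (\<lambda>y. D \<cdot> y) v) x))))))"
abbreviation "fibpr X D x \<equiv> con fibpr_d [x, D, X]"
lemmas fibpr_sel [ev] = def_sel[OF fibpr_d_def[unfolded hoas], unfolded ev]
lemma fibpr_valid [ev]: "valid fibpr_d = True"
  by (rule chk_valid; simp only: ev cong: lazy_cong)

text \<open>The map to \<open>D x\<close> is transport along the path of the fiber, and its inverse
  pairs \<open>z\<close> with reflexivity. One composite is the identity judgementally, since
  transport along reflexivity computes; the other needs path induction with the point
  \<open>x\<close> left free.\<close>

definition fibproj_d where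
  "fibproj_d = mkd 70 False False []
   (PAR UU (\<lambda>X. PAR (ARR X UU) (\<lambda>D. PAR X (\<lambda>x.
      FIN (eqv (SIG (SIG X (\<lambda>y. D \<cdot> y)) (\<lambda>v. PATH X (FST X (\<lambda>y. D \<cdot> y) v) x)) (D \<cdot> x))
      (let V = SIG X (\<lambda>y. D \<cdot> y); pr = (\<lambda>v. FST X (\<lambda>y. D \<cdot> y) v); F = (\<lambda>x. fibpr X D x);
      tp = (\<lambda>z y x p. TRANSP X (\<lambda>y. D \<cdot> y) z y x p);
      fw = (\<lambda>v. INDSIG V (\<lambda>v. PATH X (pr v) x) (\<lambda>_. D \<cdot> x) (\<lambda>w p. INDSIG X (\<lambda>y. D \<cdot> y) (\<lambda>w. ARR (PATH
        X (pr w) x) (D \<cdot> x))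
        (\<lambda>y z. LAM (PATH X y x) (\<lambda>p. tp z y x p)) w \<cdot> p) v);
      bw = (\<lambda>z. PAIR (F x) (PAIR V x z) (REFL x));
      eta = (\<lambda>v. INDSIG V (\<lambda>v. PATH X (pr v) x) (\<lambda>v. PATH (F x) (bw (fw v)) v) (\<lambda>w p. INDSIG X
        (\<lambda>y. D \<cdot> y)
        (\<lambda>w. PI (PATH X (pr w) x) (\<lambda>p. PATH (F x) (bw (fw (PAIR (F x) w p))) (PAIR (F x) w p)))
        (\<lambda>y z. LAM (PATH X y x) (\<lambda>p. JJ X (\<lambda>x' p. PATH (F x') (PAIR (F x') (PAIR V x' (tp z y x'
          p)) (REFL x')) (PAIR (F x') (PAIR V y z) p))
          (REFL (PAIR (F y) (PAIR V y z) (REFL y))) y x p)) w \<cdot> p) v)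
    in EQUIV (F x) (D \<cdot> x) fw (LAM (D \<cdot> x) bw) (LAM (D \<cdot> x) REFL) (LAM (F x) eta))))))"
abbreviation "fibproj X D x \<equiv> con fibproj_d [x, D, X]"
lemmas fibproj_sel [ev] = def_sel[OF fibproj_d_def[unfolded hoas], unfolded ev]
lemma fibproj_valid [ev]: "valid fibproj_d = True"
  by (rule chk_valid; simp only: ev cong: lazy_cong)

section \<open>Univalence and function extensionality as constants\<close>

definition IDF where [hoas]:
  "IDF A = (LAM A (\<lambda>x. x))"

definition COMP where [hoas]:
  "COMP A g f = (LAM A (\<lambda>x. g \<cdot> (f \<cdot> x)))"

definition HOMOT where [hoas]:
  "HOMOT A B f g = (PI A (\<lambda>x. PATH B (f \<cdot> x) (g \<cdot> x)))"

definition ISEQUIV where [hoas]: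
  "ISEQUIV A B f = (PRD (SIG (ARR B A) (\<lambda>k. HOMOT B B (COMP B f k) (IDF B)))
    (SIG (ARR B A) (\<lambda>k. HOMOT A A (COMP A k f) (IDF A))))"

definition EQUIV0 where [hoas]:
  "EQUIV0 A B = (SIG (ARR A B) (ISEQUIV A B))"

definition IDEQUIV where [hoas]:
  "IDEQUIV A = (let S = SIG (ARR A A) (\<lambda>k. PI A (\<lambda>x. PATH A (k \<cdot> x) x)); q = PAIR S (IDF A) (LAM A
    REFL) in
    PAIR (eqv A A) (IDF A) (PAIR (PRD S S) q q))"

definition idtoeqv_d where
  "idtoeqv_d = mkd 71 True True []
   (PAR UU (\<lambda>A. PAR UU (\<lambda>B. PAR (PATH UU A B) (\<lambda>p.
      FIN (eqv A B)
      (JJ UU (\<lambda>V _. eqv A V) (IDEQUIV A) A B p)))))"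
abbreviation "idtoeqv A B p \<equiv> con idtoeqv_d [p, B, A]"
lemmas idtoeqv_sel [ev] = def_sel[OF idtoeqv_d_def[unfolded hoas], unfolded ev]
lemma idtoeqv_valid [ev]: "valid idtoeqv_d = True"
  by (rule chk_valid; simp only: ev cong: lazy_cong)

definition univ_ax_d where
  "univ_ax_d = mkp 72 (Univalence (Var 1) (Var 0)) (PAR UU (\<lambda>A. PAR UU (\<lambda>B. FIN (ISEQUIV (PATH UU
    A B) (EQUIV0 A B) (LAM (PATH UU A B) (\<lambda>p. JJ UU (\<lambda>V _. EQUIV0 A V) (IDEQUIV A) A B p))) UU)))"
abbreviation "univ_ax A B \<equiv> con univ_ax_d [B, A]"
lemmas univ_ax_sel [ev] = prim_sel[OF univ_ax_d_def[unfolded hoas], unfolded ev]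

text \<open>A primitive constant has no body to check, so validity comes from the rule
  \<open>univalence\<close> at the two parameters, with the derived notions in its type
  unfolded.\<close>

lemma univ_ax_valid [ev]: "valid univ_ax_d = True"
proof -
  have wf: "wf_ctx (Univ # Univ # base)" by (intro ctx_cons univ wf_base)
  have "Univ # Univ # base \<turnstile> Var i \<Ztypecolon> Univ" if "i < 2" for i
    using var[OF wf, of i] that by (auto simp: wk_def less_2_cases_iff)
  from univalence[OF this[of 1] this[of 0]] show ?thesis
    by (simp add: valid_def univ_ax_sel Equiv_def isEquiv_def Homot_def comp_def idf_def idtoequiv_def
      idEquiv_def Prod_def Arr_def wk_def wkb_def upr_def)
qed

definition funext_ax_d where
  "funext_ax_d = mkp 73 (Funext (Var 1) (Var 0)) (PAR UU (\<lambda>A. PAR UU (\<lambda>B. PAR (ARR A B) (\<lambda>f.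
    PAR (ARR A B) (\<lambda>g. FIN (ISEQUIV (PATH (ARR A B) f g) (HOMOT A B f g) (LAM (PATH (ARR A B) f g)
      (\<lambda>p. JJ (ARR A B) (\<lambda>k _. HOMOT A B f k) (LAM A (\<lambda>x. REFL (f \<cdot> x))) f g p))) UU)))))"
abbreviation "funext_ax A B f g \<equiv> con funext_ax_d [g, f, B, A]"
lemmas funext_ax_sel [ev] = prim_sel[OF funext_ax_d_def[unfolded hoas], unfolded ev]

lemma funext_ax_valid [ev]: "valid funext_ax_d = True"
proof -
  let ?G = "Arr (Var 2) (Var 1) # Arr (Var 1) (Var 0) # Univ # Univ # base"
  \<comment> \<open>The checker still serves to show that the context of the parameters is well
    formed.\<close>
  have "tel_ok (red 64) (dpar funext_ax_d) = True"
    by (simp only: ev funext_ax_sel cong: lazy_cong)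
  then have "wf_ctx (trc (dpar funext_ax_d))"
    using tel_ok_wf[OF sound_red] by blast
  then have wf: "wf_ctx ?G"
    by (simp add: funext_ax_sel Arr_def wk_def numeral_2_eq_2)
  have "?G \<turnstile> Var 1 \<Ztypecolon> Pi (Var 3) (Var 3)" "?G \<turnstile> Var 0 \<Ztypecolon> Pi (Var 3) (Var 3)"
    using var[OF wf, of 0] var[OF wf, of 1]
    by (auto simp: wk_def Arr_def upr_def numeral_2_eq_2 numeral_3_eq_3)
  from funext[OF this]
  have "trc (dpar funext_ax_d) \<turnstile> trd funext_ax_d \<Ztypecolon> tr (dty funext_ax_d) (length (dpar funext_ax_d))"
    by (simp add: funext_ax_sel isEquiv_def Homot_def comp_def idf_def happly_def
      Prod_def Arr_def wk_def wkb_def upr_def numeral_2_eq_2 numeral_3_eq_3)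
  then show ?thesis
    by (simp add: valid_def funext_ax_sel)
qed

text \<open>For \<open>happly\<close> and \<open>idtoequiv\<close> the section half of
  \<open>e\<close> supplies the inverse together with the law that the map undoes it.\<close>

definition secof where [hoas]:
  "secof A B f e = (FST (SECT A B f) (\<lambda>_. RETR A B f) e)"

definition secmap where [hoas]:
  "secmap A B f e = (FST (ARR B A) (\<lambda>k. PI B (\<lambda>x. PATH B (f (k \<cdot> x)) x)) (secof A B f e))"

definition sechtpy where [hoas]:
  "sechtpy A B f e = (SND (ARR B A) (\<lambda>k. PI B (\<lambda>x. PATH B (f (k \<cdot> x)) x)) (secof A B f e))"

definition funex_d where
  "funex_d = mkd 74 False False []
   (PAR UU (\<lambda>A. PAR UU (\<lambda>B. PAR (ARR A B) (\<lambda>f. PAR (ARR A B) (\<lambda>g. PAR (HOMOT A B f g) (\<lambda>H.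
      FIN (PATH (ARR A B) f g)
      (secmap (PATH (ARR A B) f g) (HOMOT A B f g)
      (\<lambda>p. JJ (ARR A B) (\<lambda>k _. HOMOT A B f k) (LAM A (\<lambda>x. REFL (f \<cdot> x))) f g p) (funext_ax A B f
        g) \<cdot> H)))))))"
abbreviation "funex A B f g H \<equiv> con funex_d [H, g, f, B, A]"
lemmas funex_sel [ev] = def_sel[OF funex_d_def[unfolded hoas], unfolded ev]
lemma funex_valid [ev]: "valid funex_d = True"
  by (rule chk_valid; simp only: ev cong: lazy_cong)

definition ua_d where
  "ua_d = mkd 75 True False []
   (PAR UU (\<lambda>A. PAR UU (\<lambda>B. PAR (eqv A B) (\<lambda>e.
      FIN (PATH UU A B)
      (secmap (PATH UU A B) (eqv A B) (\<lambda>p. idtoeqv A B p) (univ_ax A B) \<cdot> e)))))"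
abbreviation "ua A B e \<equiv> con ua_d [e, B, A]"
lemmas ua_sel [ev] = def_sel[OF ua_d_def[unfolded hoas], unfolded ev]
lemma ua_valid [ev]: "valid ua_d = True"
  by (rule chk_valid; simp only: ev cong: lazy_cong)

definition uabeta_d where
  "uabeta_d = mkd 76 False False []
   (PAR UU (\<lambda>A. PAR UU (\<lambda>B. PAR (eqv A B) (\<lambda>e.
      FIN (PATH (eqv A B) (idtoeqv A B (ua A B e)) e)
      (sechtpy (PATH UU A B) (eqv A B) (\<lambda>p. idtoeqv A B p) (univ_ax A B) \<cdot> e)))))"
abbreviation "uabeta A B e \<equiv> con uabeta_d [e, B, A]"
lemmas uabeta_sel [ev] = def_sel[OF uabeta_d_def[unfolded hoas], unfolded ev]
lemma uabeta_valid [ev]: "valid uabeta_d = True"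
  by (rule chk_valid; simp only: ev cong: lazy_cong)

definition eqf where [hoas]:
  "eqf A B e = (FST (ARR A B) (\<lambda>f. PRD (SECT A B (app f)) (RETR A B (app f))) e)"

definition FIB where [hoas]:
  "FIB A X k x = (SIG A (\<lambda>a. PATH X (k \<cdot> a) x))"

text \<open>
  Fibers of two maps identified along an equivalence of their domains.  With univalence the
  equivalence may be taken to be the identity, so no half-adjoint coherence is needed.
\<close>

definition transf1_d where
  "transf1_d = mkd 77 False False []
   (PAR UU (\<lambda>W. PAR UU (\<lambda>X. PAR UU (\<lambda>T. PAR (ARR W X) (\<lambda>k. PAR X (\<lambda>x. PAR (ARR W X) (\<lambda>l.
     PAR (HOMOT W X k l) (\<lambda>H. PAR (eqv (FIB W X l x) T) (\<lambda>e.
      FIN (eqv (FIB W X k x) T)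
      (JJ (ARR W X) (\<lambda>l _. ARR (eqv (FIB W X l x) T) (eqv (FIB W X k x) T))
      (LAM (eqv (FIB W X k x) T) (\<lambda>e. e)) k l (funex W X k l H) \<cdot> e))))))))))"
abbreviation "transf1 W X T k x l H e \<equiv>
  con transf1_d [e, H, l, x, k, T, X, W]"
lemmas transf1_sel [ev] = def_sel[OF transf1_d_def[unfolded hoas], unfolded ev]
lemma transf1_valid [ev]: "valid transf1_d = True"
  by (rule chk_valid; simp only: ev cong: lazy_cong)

definition TGT where [hoas]:
  "TGT W X T k x Y m = (PI (ARR Y X) (\<lambda>l. ARR (PI W (\<lambda>w. PATH X (k \<cdot> w) (l \<cdot> (m \<cdot> w)))) (ARR (eqv (FIB
    Y X l x) T) (eqv (FIB W X k x) T))))"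

text \<open>At reflexivity \<open>idtoeqv\<close> computes to the identity equivalence, so the
  homotopy compares \<open>k\<close> with \<open>l\<close> itself and \<open>transf1\<close>
  applies.\<close>

definition transf2_d where
  "transf2_d = mkd 78 False False []
   (PAR UU (\<lambda>W. PAR UU (\<lambda>Y. PAR UU (\<lambda>X. PAR UU (\<lambda>T. PAR (ARR W X) (\<lambda>k. PAR X (\<lambda>x.
     PAR (PATH UU W Y) (\<lambda>p.
      FIN (TGT W X T k x Y (eqf W Y (idtoeqv W Y p)))
      (JJ UU (\<lambda>Y p. TGT W X T k x Y (eqf W Y (idtoeqv W Y p))) (LAM (ARR W X) (\<lambda>l. LAM (HOMOT W X
        k l)
      (\<lambda>H. LAM (eqv (FIB W X l x) T) (\<lambda>e. transf1 W X T k x l H e)))) W Y p)))))))))"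
abbreviation "transf2 W Y X T k x p \<equiv>
  con transf2_d [p, x, k, T, X, Y, W]"
lemmas transf2_sel [ev] = def_sel[OF transf2_d_def[unfolded hoas], unfolded ev]
lemma transf2_valid [ev]: "valid transf2_d = True"
  by (rule chk_valid; simp only: ev cong: lazy_cong)

text \<open>By \<open>uabeta\<close> every equivalence is identified with one that comes from a
  path, for which \<open>transf2\<close> gives the claim; path induction on that identification
  transfers it.\<close>

definition transf3_d where
  "transf3_d = mkd 79 False False []
   (PAR UU (\<lambda>W. PAR UU (\<lambda>Y. PAR UU (\<lambda>X. PAR UU (\<lambda>T. PAR (ARR W X) (\<lambda>k. PAR X (\<lambda>x.
     PAR (eqv W Y) (\<lambda>e.
      FIN (TGT W X T k x Y (eqf W Y e))
      (JJ (eqv W Y) (\<lambda>e _. TGT W X T k x Y (eqf W Y e)) (transf2 W Y X T k x (ua W Y e)) (idtoeqv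
        W Y (ua W Y e)) e (uabeta W Y e))))))))))"
abbreviation "transf3 W Y X T k x e \<equiv>
  con transf3_d [e, x, k, T, X, Y, W]"
lemmas transf3_sel [ev] = def_sel[OF transf3_d_def[unfolded hoas], unfolded ev]
lemma transf3_valid [ev]: "valid transf3_d = True"
  by (rule chk_valid; simp only: ev cong: lazy_cong)

definition final_d where
  "final_d = mkd 80 False False []
   (FIN (eqv (SIG jo (\<lambda>w. PATH tyX (jmap w) ptx)) (jf ptx))
      (transf3 jo tot tyX (jf ptx) hL ptx (EQUIV jo tot (\<lambda>w. fwd w) backL (LAM tot (\<lambda>v. fwdback
        v)) (LAM jo (\<lambda>w. backfwd w)))
 \<cdot> prL \<cdot> LAM jo (\<lambda>w. jmapfwd w) \<cdot> fibproj tyX (LAM tyX (\<lambda>y. jf y)) ptx))"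
abbreviation "final \<equiv> con final_d []"
lemmas final_sel [ev] = def_sel[OF final_d_def[unfolded hoas], unfolded ev]
lemma final_valid [ev]: "valid final_d = True"
  by (rule chk_valid; simp only: ev cong: lazy_cong)

text \<open>The type is given with the composites and identities of \<open>isEquiv\<close>
  unreduced, so that its erasure is literally the type in the theorem. The checker normalises it and
  meets the type of \<open>final\<close>.\<close>

definition result_d where
  "result_d = mkd 81 False False []
   (FIN (EQUIV0 (FIB jo tyX (LAM jo (\<lambda>w. jmap w)) ptx) (join (fib tyA tyX mapf ptx) (fib tyB tyX
     mapg ptx)))
      final)"
lemmas result_sel [ev] = def_sel[OF result_d_def[unfolded hoas], unfolded ev]
lemma result_valid [ev]: "valid result_d = True"
  by (rule chk_valid; simp only: ev cong: lazy_cong)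

section \<open>The theorem\<close>

text \<open>The substitution rule asks for a well-formed target context, while only typing
  judgements over it are given. Well-formedness is a presupposition of every judgement, obtained by
  mutual induction on derivations.\<close>

lemma wf_of: "wf_ctx \<Gamma> \<Longrightarrow> True" "\<Gamma> \<turnstile> A \<doteq> B type \<Longrightarrow> wf_ctx \<Gamma>" "\<Gamma> \<turnstile> a \<doteq> b \<Ztypecolon> A \<Longrightarrow> wf_ctx \<Gamma>"
  by (induction rule: wf_ctx_eq_ty_eq_tm.inducts) auto
lemmas wf_of_tm = wf_of(3)

section \<open>Substitution in the derived notions of the object language\<close>

lemma sub_wk: "sub (up \<sigma>) (wk (Suc 0) t) = wk (Suc 0) (sub \<sigma> t)"
  "sub (up (up \<sigma>)) (wk 2 t) = wk 2 (sub \<sigma> t)"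
  "sub (up (up (up \<sigma>))) (wk 3 t) = wk 3 (sub \<sigma> t)"
  "sub (up (up (up (up \<sigma>)))) (wk 4 t) = wk 4 (sub \<sigma> t)"
  "sub (up (up (up (up (up \<sigma>))))) (wk 5 t) = wk 5 (sub \<sigma> t)"
  by (simp_all add: wk_def sub_ren ren_sub up_Suc eval_nat_numeral ren_ren)

lemma sub_wkb: "sub (up (up \<sigma>)) (wkb (Suc 0) t) = wkb (Suc 0) (sub (up \<sigma>) t)"
proof -
  have "up (up \<sigma>) (upr Suc i) = ren (upr Suc) (up \<sigma> i)" for i
    by (cases i) (simp_all add: up_Suc wk_def ren_ren)
  then show ?thesis by (simp add: wkb_def sub_ren ren_sub)
qed

lemma sub_inst1: "sub (up \<sigma>) (inst (Suc 0) t C) = inst (Suc 0) (sub (up \<sigma>) t) (sub (up \<sigma>) C)"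
proof -
  have "sub (up \<sigma>) (case_nat t (\<lambda>i. Var (i + Suc 0)) i)
      = sub (case_nat (sub (up \<sigma>) t) (\<lambda>i. Var (i + Suc 0))) (up \<sigma> i)" for i
    by (cases i) (simp_all add: up_Suc wk_def sub_ren sub_Var_ren)
  then show ?thesis unfolding inst_def sub_sub by (simp only:)
qed

lemma wk_Var: "wk k (Var i) = Var (i + k)"
  by (simp add: wk_def)

lemmas push = sub_wk sub_wkb sub_inst1 up_Suc wk_Var

lemma sub_Arr: "sub \<sigma> (Arr A B) = Arr (sub \<sigma> A) (sub \<sigma> B)" by (simp add: Arr_def push)
lemma sub_Prod: "sub \<sigma> (Prod A B) = Prod (sub \<sigma> A) (sub \<sigma> B)" by (simp add: Prod_def push)
lemma sub_Fst: "sub \<sigma> (Fst A p) = Fst (sub \<sigma> A) (sub \<sigma> p)" by (simp add: Fst_def push)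
lemma sub_Snd: "sub \<sigma> (Snd A B p) = Snd (sub \<sigma> A) (sub (up \<sigma>) B) (sub \<sigma> p)" by (simp add: Snd_def push sub_Fst)
lemma sub_comp: "sub \<sigma> (comp A g f) = comp (sub \<sigma> A) (sub \<sigma> g) (sub \<sigma> f)" by (simp add: comp_def push)
lemma sub_idf: "sub \<sigma> (idf A) = idf (sub \<sigma> A)" by (simp add: idf_def)
lemma sub_Homot: "sub \<sigma> (Homot A B f g) = Homot (sub \<sigma> A) (sub (up \<sigma>) B) (sub \<sigma> f) (sub \<sigma> g)" by (simp add: Homot_def push)
lemmas push1 = push sub_Arr sub_Prod sub_Fst sub_Snd sub_comp sub_idf sub_Homot
lemma sub_isEquiv: "sub \<sigma> (isEquiv A B f) = isEquiv (sub \<sigma> A) (sub \<sigma> B) (sub \<sigma> f)" by (simp add: isEquiv_def push1)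
lemma sub_Equiv: "sub \<sigma> (Equiv A B) = Equiv (sub \<sigma> A) (sub \<sigma> B)" by (simp add: Equiv_def push1 sub_isEquiv)
lemma sub_Fib: "sub \<sigma> (Fib A X h x) = Fib (sub \<sigma> A) (sub \<sigma> X) (sub \<sigma> h) (sub \<sigma> x)" by (simp add: Fib_def push1)
lemma sub_Join: "sub \<sigma> (Join P Q) = Join (sub \<sigma> P) (sub \<sigma> Q)" by (simp add: Join_def push1)
lemma sub_RecPush: "sub \<sigma> (RecPush u v X l r h e) = RecPush (sub \<sigma> u) (sub \<sigma> v) (sub \<sigma> X) (sub \<sigma> l) (sub \<sigma> r) (sub \<sigma> h) (sub \<sigma> e)"
  by (simp add: RecPush_def Let_def transp_def push1 wk_wk) 
text \<open>The tail is a family over \<open>A\<close>, hence the substitution is lifted under one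
  binder while the arguments, which live outside it, are not.\<close>

lemma sub_PullbackTail: "sub (up \<sigma>) (PullbackTail B X f g) = PullbackTail (sub \<sigma> B) (sub \<sigma> X) (sub \<sigma> f) (sub \<sigma> g)"
  by (simp add: PullbackTail_def push1)

lemma sub_Pullback: "sub \<sigma> (Pullback A B X f g) = Pullback (sub \<sigma> A) (sub \<sigma> B) (sub \<sigma> X) (sub \<sigma> f) (sub \<sigma> g)"
  by (simp add: Pullback_def sub_PullbackTail)
lemma sub_pb_pi1: "sub \<sigma> (pb_pi1 A B X f g) = pb_pi1 (sub \<sigma> A) (sub \<sigma> B) (sub \<sigma> X) (sub \<sigma> f) (sub \<sigma> g)"
  by (simp add: pb_pi1_def sub_Pullback push1)
lemma sub_pb_pi2: "sub \<sigma> (pb_pi2 A B X f g) = pb_pi2 (sub \<sigma> A) (sub \<sigma> B) (sub \<sigma> X) (sub \<sigma> f) (sub \<sigma> g)"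
  by (simp add: pb_pi2_def sub_Pullback push1 sub_PullbackTail)
lemma sub_pb_homot: "sub \<sigma> (pb_homot A B X f g) = pb_homot (sub \<sigma> A) (sub \<sigma> B) (sub \<sigma> X) (sub \<sigma> f) (sub \<sigma> g)"
  by (simp add: pb_homot_def sub_Pullback push1 sub_PullbackTail)
lemma sub_JoinOver: "sub \<sigma> (JoinOver A B X f g) = JoinOver (sub \<sigma> A) (sub \<sigma> B) (sub \<sigma> X) (sub \<sigma> f) (sub \<sigma> g)"
  by (simp add: JoinOver_def sub_Pullback sub_pb_pi1 sub_pb_pi2)
lemma sub_join_map: "sub \<sigma> (join_map A B X f g) = join_map (sub \<sigma> A) (sub \<sigma> B) (sub \<sigma> X) (sub \<sigma> f) (sub \<sigma> g)"
  by (simp add: join_map_def sub_JoinOver sub_RecPush push1 sub_pb_pi1 sub_pb_pi2 sub_pb_homot)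

text \<open>This ties the checked constant to the statement: the erasure of its annotated type
  unfolds to the same raw term as the stated notions at the six variables.\<close>

lemma result_type: "tr (dty result_d) 0 = (let A = Var 5; B = Var 4; X = Var 3; f = Var 2; g = Var 1; x = Var 0 in
   Equiv (Fib (JoinOver A B X f g) X (join_map A B X f g) x) (Join (Fib A X f x) (Fib B X g x)))"
  by (simp add: result_sel jo_sel fib_sel join_sel pb_sel pr1_sel pr2_sel pbhom_sel jmap_sel prec_sel
    tyA_sel tyB_sel tyX_sel mapf_sel mapg_sel ptx_sel env_def
    Let_def Equiv_def isEquiv_def Homot_def comp_def idf_def Prod_def Arr_def Fib_def Join_def JoinOver_def
    join_map_def RecPush_def transp_def pb_pi1_def pb_pi2_def pb_homot_def Pullback_def PullbackTail_def
    Fst_def Snd_def inst_def wk_def wkb_def up_def upr_def)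

theorem theorem2p2:
  fixes \<Gamma> :: ctx and A B X f g x :: tm
  assumes "\<Gamma> \<turnstile> A \<Ztypecolon> Univ" and "\<Gamma> \<turnstile> B \<Ztypecolon> Univ" and "\<Gamma> \<turnstile> X \<Ztypecolon> Univ"
    and "\<Gamma> \<turnstile> f \<Ztypecolon> Arr A X" and "\<Gamma> \<turnstile> g \<Ztypecolon> Arr B X" and "\<Gamma> \<turnstile> x \<Ztypecolon> X"
  shows "\<exists>e. \<Gamma> \<turnstile> e \<Ztypecolon> Equiv (Fib (JoinOver A B X f g) X (join_map A B X f g) x)
                          (Join (Fib A X f x) (Fib B X g x))"
proof -
  \<comment> \<open>Innermost variable first, in the order of \<open>base\<close>. The substitution
    rule constrains only the indices below its length, so the values beyond the list do not
    matter.\<close>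
  let ?s = "\<lambda>i. [x, g, f, X, B, A] ! i"
  have "base \<turnstile> trd result_d \<Ztypecolon> tr (dty result_d) 0"
    using result_valid result_sel by (simp add: valid_def)
  moreover have "\<forall>i<length base. \<Gamma> \<turnstile> ?s i \<Ztypecolon> sub ?s (wk (Suc i) (base ! i))"
    using assms by (auto simp: base_def less_Suc_eq_0_disj numeral_eq_Suc wk_Var sub_Arr Arr_def wk_def sub_ren ren_sub push)
  moreover have "wf_ctx \<Gamma>"
    using assms(1) by (rule wf_of_tm)
  ultimately have "\<Gamma> \<turnstile> sub ?s (trd result_d) \<Ztypecolon> sub ?s (tr (dty result_d) 0)"
    by (intro tm_subst)
  then show ?thesis
    by (auto simp: result_type sub_Equiv sub_Fib sub_Join sub_JoinOver sub_join_map Let_def)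
qed
end
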